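(* Let $G$ be a homogeneous Lie group. Then the operators $d_c:=\Pi_0\,d\,\Pi_E\,\Pi_0$ and $D:=L^{-1}\,d\,L\,\Pi_0$ acting on $\Omega^\bullet G$ coincide: $d_c=D$.
   Context: Homogeneous group. $G$ is a non-trivial connected, simply connected Lie group whose real Lie algebra $\mathfrak g$, of dimension $n$, admits dilations $\delta_r=\mathrm{Exp}(A\ln r)$, $r>0$, which are Lie algebra morphisms, where $A$ is a diagonalisable linear operator on $\mathfrak g$ with positive eigenvalues (so $\mathfrak g$ is nilpotent). Fix a basis $X_1,\dots,X_n$ of $\mathfrak g$ with $AX_j=\upsilon_jX_j$, $0<\upsilon_1\le\dots\le\upsilon_n$, with dual basis $\theta^1,\dots,\theta^n$ of left-invariant 1-forms. $\Omega^kG$ is the space of smooth real $k$-forms, $\Omega^\bullet G=\bigoplus_k\Omega^kG$, $d$ is the exterior derivative, $\mathrm I$ the identity. The forms $\theta^I=\theta^{i_1}\wedge\dots\wedge\theta^{i_k}$, $i_1<\dots<i_k$, form a basis of $\Omega^kG$ over $C^\infty(G)$. Weights. $\delta_r$ acts on forms pointwise by $(\delta_r\theta)(x;V_1,\dots,V_k)=\theta(x;\delta_rV_1,\dots,\delta_rV_k)$, tangent spaces being identified with $\mathfrak g$ by left translation. $\Omega^{\bullet,w}G$ is the space of forms with $\delta_r\theta=r^w\theta$ for all $r>0$. A linear operator $T$ on $\Omega^\bullet G$ strictly increases weights if $T(\Omega^{\bullet,w}G)\subset\bigoplus_{w'>w}\Omega^{\bullet,w'}G$ for every weight $w$; such operators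 are nilpotent, and there is an integer $N_0$ with $T^{N_0}=0$ for all such $T$. Algebraic operators. Left-invariant forms are identified with $\mathrm{Hom}(\bigwedge^\bullet\mathfrak g,\mathbb R)$ with the scalar product making the $\theta^I$ orthonormal. $d_0$ is the restriction of $d$ to left-invariant forms, $d_0^t$ its transpose, $\Box_0=d_0d_0^t+d_0^td_0$, and $\Pi_0$ is the orthogonal projection onto $\ker\Box_0=\ker d_0\cap\ker d_0^t$. The partial inverse $d_0^{-1}$ is the orthogonal projection onto $\mathrm{Im}\,d_0$ followed by the inverse of the bijection $d_0:(\ker d_0)^\perp\to\mathrm{Im}\,d_0$. All these are extended $C^\infty(G)$-linearly to $\Omega^\bullet G$. Rumin's operators. $b:=d_0^{-1}d_0-d_0^{-1}d$ strictly increases weights, so $\mathrm I-b$ is invertible with $(\mathrm I-b)^{-1}=\sum_{j=0}^{N_0-1}b^j$. Set $\Pi:=(\mathrm I-b)^{-1}d_0^{-1}d+d(\mathrm I-b)^{-1}d_0^{-1}$ and $\Pi_E:=\mathrm I-\Pi$. Operators $P$ and $L$. $\Box:=dd_0^t+d_0^td$ and $B:=\Box-\Box_0$ (which strictly increases weights). For $z\in\mathbb C$ not an eigenvalue of $\Box_0$, $z-\Box$ is invertible (on complexified forms) with $(z-\Box)^{-1}=(z-\Box_0)^{-1}\sum_{j=0}^{N_0-1}(B(z-\Box_0)^{-1})^j$, and $P:=\frac1{2\pi i}\oint_{|z|=\varepsilon}(z-\Box)^{-1}dz$, where $\varepsilon>0$ is smaller than every non-zero eigenvalue of $\Box_0$.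 $L:=P\Pi_0+(\mathrm I-P)(\mathrm I-\Pi_0)$, which is invertible on $\Omega^\bullet G$. *)

theory Defs
  imports "HOL-Complex_Analysis.Complex_Analysis" "HOL-Library.Function_Algebras"
begin

section \<open>Lie groups\<close>

primrec Ck_on :: "nat \<Rightarrow> 'e::euclidean_space set \<Rightarrow> ('e \<Rightarrow> 'f::real_normed_vector) \<Rightarrow> bool" where
  "Ck_on 0 S f \<longleftrightarrow> continuous_on S f"
| "Ck_on (Suc k) S f \<longleftrightarrow> (\<forall>x\<in>S. f differentiable (at x)) \<and>
     (\<forall>b\<in>Basis. Ck_on k S (\<lambda>x. frechet_derivative f (at x) b))"

definition smooth_on :: "'e::euclidean_space set \<Rightarrow> ('e \<Rightarrow> 'f::real_normed_vector) \<Rightarrow> bool" where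
  "smooth_on S f \<longleftrightarrow> (\<forall>k. Ck_on k S f)"

text \<open>A chart is a pair of an open domain and a coordinate map; only the values of the coordinate
  map on the domain matter.\<close>

type_synonym ('g, 'e) chart = "'g set \<times> ('g \<Rightarrow> 'e)"

definition smooth_atlas :: "('g::topological_space, 'e::euclidean_space) chart set \<Rightarrow> bool" where
  "smooth_atlas \<A> \<longleftrightarrow>
     (\<Union>(U, \<phi>)\<in>\<A>. U) = UNIV \<and>
     (\<forall>(U, \<phi>)\<in>\<A>. open U \<and> open (\<phi> ` U) \<and> homeomorphism U (\<phi> ` U) \<phi> (inv_into U \<phi>)) \<and>
     (\<forall>(U, \<phi>)\<in>\<A>. \<forall>(V, \<psi>)\<in>\<A>. smooth_on (\<phi> ` (U \<inter> V)) (\<psi> \<circ> inv_into U \<phi>))"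

definition smooth_functions ::
    "('g::topological_space, 'e::euclidean_space) chart set \<Rightarrow> ('g \<Rightarrow> real) set" where
  "smooth_functions \<A> = {f. \<forall>(U, \<phi>)\<in>\<A>. smooth_on (\<phi> ` U) (f \<circ> inv_into U \<phi>)}"

text \<open>The group law of \<open>G\<close> is written additively (but it is not assumed commutative), so that \<open>G\<close> is
  a type of class \<^class>\<open>group_add\<close>. The group operations are smooth when read in charts; the sets on
  which smoothness is required are open because the operations are continuous.\<close>

locale lie_group =
  fixes \<A> :: "('g::{topological_group_add, t2_space, second_countable_topology},
                  'e::euclidean_space) chart set"
  assumes atlas: "smooth_atlas \<A>"
    and smooth_plus: "\<lbrakk>(U, \<phi>) \<in> \<A>; (V, \<psi>) \<in> \<A>; (W, \<eta>) \<in> \<A>\<rbrakk> \<Longrightarrow>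
      smooth_on {(u, v). u \<in> \<phi> ` U \<and> v \<in> \<psi> ` V \<and> inv_into U \<phi> u + inv_into V \<psi> v \<in> W}
        (\<lambda>(u, v). \<eta> (inv_into U \<phi> u + inv_into V \<psi> v))"
    and smooth_uminus: "\<lbrakk>(U, \<phi>) \<in> \<A>; (W, \<eta>) \<in> \<A>\<rbrakk> \<Longrightarrow>
      smooth_on {u. u \<in> \<phi> ` U \<and> - inv_into U \<phi> u \<in> W} (\<lambda>u. \<eta> (- inv_into U \<phi> u))"


section \<open>The Lie algebra of left-invariant vector fields\<close>

text \<open>Smooth vector fields are the derivations of the algebra of smooth functions. As functions are
  total in HOL, a vector field is set to \<open>0\<close> on functions that are not smooth, so that equality of
  vector fields is equality of functions.\<close>

type_synonym 'g vfield = "('g \<Rightarrow> real) \<Rightarrow> 'g \<Rightarrow> real"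

definition vector_fields ::
    "('g::topological_space, 'e::euclidean_space) chart set \<Rightarrow> 'g vfield set" where
  "vector_fields \<A> = {V.
     (\<forall>f\<in>smooth_functions \<A>. V f \<in> smooth_functions \<A>) \<and>
     (\<forall>f\<in>smooth_functions \<A>. \<forall>h\<in>smooth_functions \<A>. \<forall>a b.
        V (\<lambda>x. a * f x + b * h x) = (\<lambda>x. a * V f x + b * V h x)) \<and>
     (\<forall>f\<in>smooth_functions \<A>. \<forall>h\<in>smooth_functions \<A>.
        V (\<lambda>x. f x * h x) = (\<lambda>x. V f x * h x + f x * V h x)) \<and>
     (\<forall>f. f \<notin> smooth_functions \<A> \<longrightarrow> V f = 0)}"

definition lie_algebra ::
    "('g::{topological_space, plus}, 'e::euclidean_space) chart set \<Rightarrow> 'g vfield set" where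
  "lie_algebra \<A> = {V \<in> vector_fields \<A>.
     \<forall>f\<in>smooth_functions \<A>. \<forall>g. V (\<lambda>x. f (g + x)) = (\<lambda>x. V f (g + x))}"

definition lie_bracket :: "'g vfield \<Rightarrow> 'g vfield \<Rightarrow> 'g vfield" where
  "lie_bracket V W = (\<lambda>f. V (W f) - W (V f))"

definition scale_vf :: "real \<Rightarrow> 'g vfield \<Rightarrow> 'g vfield" where
  "scale_vf a V = (\<lambda>f x. a * V f x)"

interpretation vf: vector_space scale_vf
  by standard (auto simp: scale_vf_def fun_eq_iff algebra_simps)

definition linear_endo :: "'g vfield set \<Rightarrow> ('g vfield \<Rightarrow> 'g vfield) \<Rightarrow> bool" where
  "linear_endo \<gg> T \<longleftrightarrow> T ` \<gg> \<subseteq> \<gg> \<and>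
     (\<forall>V\<in>\<gg>. \<forall>W\<in>\<gg>. T (V + W) = T V + T W) \<and>
     (\<forall>V\<in>\<gg>. \<forall>a. T (scale_vf a V) = scale_vf a (T V))"

definition lie_morphism :: "'g vfield set \<Rightarrow> ('g vfield \<Rightarrow> 'g vfield) \<Rightarrow> bool" where
  "lie_morphism \<gg> T \<longleftrightarrow> linear_endo \<gg> T \<and>
     (\<forall>V\<in>\<gg>. \<forall>W\<in>\<gg>. T (lie_bracket V W) = lie_bracket (T V) (T W))"

text \<open>\<open>Exp (ln r A)\<close>, with the exponential series taken pointwise.\<close>

definition dilation :: "('g vfield \<Rightarrow> 'g vfield) \<Rightarrow> real \<Rightarrow> 'g vfield \<Rightarrow> 'g vfield" where
  "dilation A r V = (\<lambda>f x. \<Sum>k. ln r ^ k / fact k * (A ^^ k) V f x)"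


section \<open>Homogeneous groups\<close>

text \<open>The Lie algebra has the eigenbasis \<open>X 1, \<dots>, X n\<close> of the operator \<open>A\<close>, with positive
  eigenvalues \<open>\<upsilon> 1 \<le> \<dots> \<le> \<upsilon> n\<close>.\<close>

locale homogeneous_group = lie_group \<A>
  for \<A> :: "('g::{topological_group_add, t2_space, second_countable_topology},
                'e::euclidean_space) chart set" +
  fixes A :: "'g vfield \<Rightarrow> 'g vfield"
    and n :: nat
    and X :: "nat \<Rightarrow> 'g vfield"
    and \<upsilon> :: "nat \<Rightarrow> real"
  assumes connected: "connected (UNIV :: 'g set)"
    and simply_connected: "simply_connected (UNIV :: 'g set)"
    and nontrivial: "0 < n"
    and basis_inj: "inj_on X {1..n}"
    and basis_independent: "vf.independent (X ` {1..n})"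
    and basis_span: "vf.span (X ` {1..n}) = lie_algebra \<A>"
    and linear_A: "linear_endo (lie_algebra \<A>) A"
    and eigenvector: "j \<in> {1..n} \<Longrightarrow> A (X j) = scale_vf (\<upsilon> j) (X j)"
    and weight_pos: "j \<in> {1..n} \<Longrightarrow> 0 < \<upsilon> j"
    and weight_mono: "mono_on {1..n} \<upsilon>"
    and dilation_morphism: "0 < r \<Longrightarrow> lie_morphism (lie_algebra \<A>) (dilation A r)"
begin

abbreviation \<gg> :: "'g vfield set" where "\<gg> \<equiv> lie_algebra \<A>"


subsection \<open>Forms\<close>

text \<open>An element of \<open>Hom (\<And>\<^sup>\<bullet> \<gg>, \<real>)\<close> is a function on lists of vectors in \<open>\<gg>\<close> whose
  restriction to lists of length \<open>k\<close> is its component of degree \<open>k\<close>, an alternating \<open>k\<close>-linear form.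
  The components of degree greater than \<open>n\<close> vanish automatically. Lists that leave \<open>\<gg>\<close> are sent to
  \<open>0\<close>, so that equality is equality of functions.\<close>

definition alt_forms :: "('g vfield list \<Rightarrow> real) set" where
  "alt_forms = {\<alpha>.
     (\<forall>Vs. \<not> set Vs \<subseteq> \<gg> \<longrightarrow> \<alpha> Vs = 0) \<and>
     (\<forall>Us Ws V W a b. set Us \<subseteq> \<gg> \<and> set Ws \<subseteq> \<gg> \<and> V \<in> \<gg> \<and> W \<in> \<gg> \<longrightarrow>
        \<alpha> (Us @ (scale_vf a V + scale_vf b W) # Ws) =
          a * \<alpha> (Us @ V # Ws) + b * \<alpha> (Us @ W # Ws)) \<and>
     (\<forall>Vs. \<not> distinct Vs \<longrightarrow> \<alpha> Vs = 0)}"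

text \<open>\<open>\<Omega>\<^sup>\<bullet>G\<close>, tangent spaces being identified with \<open>\<gg>\<close> by left translation. The left-invariant forms
  are those that are constant in the point, and are identified with their value.\<close>

definition forms :: "('g \<Rightarrow> 'g vfield list \<Rightarrow> real) set" where
  "forms = {\<omega>. (\<forall>x. \<omega> x \<in> alt_forms) \<and>
     (\<forall>Vs. set Vs \<subseteq> \<gg> \<longrightarrow> (\<lambda>x. \<omega> x Vs) \<in> smooth_functions \<A>)}"

text \<open>The invariant formula for the exterior derivative, on left-invariant vector fields. Positions
  are counted from \<open>0\<close>, and \<^term>\<open>nths Vs (- J)\<close> omits from \<open>Vs\<close> the entries at the positions in \<open>J\<close>.\<close>

definition ext_d ::
    "('g \<Rightarrow> 'g vfield list \<Rightarrow> real) \<Rightarrow> 'g \<Rightarrow> 'g vfield list \<Rightarrow> real" where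
  "ext_d \<omega> = (\<lambda>x Vs. if set Vs \<subseteq> \<gg> then
       (\<Sum>i<length Vs. (- 1) ^ i * (Vs ! i) (\<lambda>y. \<omega> y (nths Vs (- {i}))) x)
     + (\<Sum>j<length Vs. \<Sum>i<j.
          (- 1) ^ (i + j) * \<omega> x (lie_bracket (Vs ! i) (Vs ! j) # nths Vs (- {i, j})))
     else 0)"

definition extend ::
    "(('g vfield list \<Rightarrow> real) \<Rightarrow> 'g vfield list \<Rightarrow> real) \<Rightarrow>
     ('g \<Rightarrow> 'g vfield list \<Rightarrow> real) \<Rightarrow> 'g \<Rightarrow> 'g vfield list \<Rightarrow> real" where
  "extend T \<omega> = (\<lambda>x. T (\<omega> x))"


subsection \<open>Algebraic operators\<close>

text \<open>The value of \<open>\<alpha>\<close> on \<open>(X i\<^sub>1, \<dots>, X i\<^sub>k)\<close>, where \<open>I = {i\<^sub>1 < \<dots> < i\<^sub>k}\<close>, is the coefficient of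
  \<open>\<theta>\<^sup>I\<close> in \<open>\<alpha>\<close>, so this is the scalar product for which the \<open>\<theta>\<^sup>I\<close> are orthonormal.\<close>

definition ip :: "('g vfield list \<Rightarrow> real) \<Rightarrow> ('g vfield list \<Rightarrow> real) \<Rightarrow> real" where
  "ip \<alpha> \<beta> = (\<Sum>I\<in>Pow {1..n}.
     \<alpha> (map X (sorted_list_of_set I)) * \<beta> (map X (sorted_list_of_set I)))"

definition adjoint_op ::
    "(('g vfield list \<Rightarrow> real) \<Rightarrow> 'g vfield list \<Rightarrow> real) \<Rightarrow>
     ('g vfield list \<Rightarrow> real) \<Rightarrow> 'g vfield list \<Rightarrow> real" where
  "adjoint_op T \<alpha> = (THE \<beta>. \<beta> \<in> alt_forms \<and> (\<forall>\<gamma>\<in>alt_forms. ip (T \<gamma>) \<alpha> = ip \<gamma> \<beta>))"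

definition orth_proj ::
    "('g vfield list \<Rightarrow> real) set \<Rightarrow> ('g vfield list \<Rightarrow> real) \<Rightarrow> 'g vfield list \<Rightarrow> real" where
  "orth_proj S \<alpha> = (THE \<beta>. \<beta> \<in> S \<and> (\<forall>\<gamma>\<in>S. ip (\<alpha> - \<beta>) \<gamma> = 0))"

text \<open>The exterior derivative of a left-invariant form is left-invariant, hence given by its value
  at the neutral element.\<close>

definition d0 :: "('g vfield list \<Rightarrow> real) \<Rightarrow> 'g vfield list \<Rightarrow> real" where
  "d0 \<alpha> = ext_d (\<lambda>_. \<alpha>) 0"

definition d0t :: "('g vfield list \<Rightarrow> real) \<Rightarrow> 'g vfield list \<Rightarrow> real" where
  "d0t = adjoint_op d0"

definition box0 :: "('g vfield list \<Rightarrow> real) \<Rightarrow> 'g vfield list \<Rightarrow> real" where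
  "box0 \<alpha> = d0 (d0t \<alpha>) + d0t (d0 \<alpha>)"

definition eigenvalue_box0 :: "real \<Rightarrow> bool" where
  "eigenvalue_box0 \<mu> \<longleftrightarrow> (\<exists>\<alpha>\<in>alt_forms. \<alpha> \<noteq> 0 \<and> box0 \<alpha> = (\<lambda>Vs. \<mu> * \<alpha> Vs))"

definition Pi0 :: "('g vfield list \<Rightarrow> real) \<Rightarrow> 'g vfield list \<Rightarrow> real" where
  "Pi0 = orth_proj {\<alpha> \<in> alt_forms. box0 \<alpha> = 0}"

definition d0inv :: "('g vfield list \<Rightarrow> real) \<Rightarrow> 'g vfield list \<Rightarrow> real" where
  "d0inv \<alpha> = inv_into {\<beta> \<in> alt_forms. \<forall>\<gamma>\<in>alt_forms. d0 \<gamma> = 0 \<longrightarrow> ip \<beta> \<gamma> = 0} d0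
               (orth_proj (d0 ` alt_forms) \<alpha>)"


subsection \<open>Rumin's operators\<close>

definition b_op :: "('g \<Rightarrow> 'g vfield list \<Rightarrow> real) \<Rightarrow> 'g \<Rightarrow> 'g vfield list \<Rightarrow> real" where
  "b_op \<omega> = extend d0inv (extend d0 \<omega>) - extend d0inv (ext_d \<omega>)"

definition inv_I_minus_b ::
    "('g \<Rightarrow> 'g vfield list \<Rightarrow> real) \<Rightarrow> 'g \<Rightarrow> 'g vfield list \<Rightarrow> real" where
  "inv_I_minus_b = inv_into forms (\<lambda>\<omega>. \<omega> - b_op \<omega>)"

definition Pi_op :: "('g \<Rightarrow> 'g vfield list \<Rightarrow> real) \<Rightarrow> 'g \<Rightarrow> 'g vfield list \<Rightarrow> real" where
  "Pi_op \<omega> = inv_I_minus_b (extend d0inv (ext_d \<omega>)) + ext_d (inv_I_minus_b (extend d0inv \<omega>))"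

definition Pi_E :: "('g \<Rightarrow> 'g vfield list \<Rightarrow> real) \<Rightarrow> 'g \<Rightarrow> 'g vfield list \<Rightarrow> real" where
  "Pi_E \<omega> = \<omega> - Pi_op \<omega>"

definition d_c :: "('g \<Rightarrow> 'g vfield list \<Rightarrow> real) \<Rightarrow> 'g \<Rightarrow> 'g vfield list \<Rightarrow> real" where
  "d_c \<omega> = extend Pi0 (ext_d (Pi_E (extend Pi0 \<omega>)))"


subsection \<open>The operators \<open>P\<close>, \<open>L\<close> and \<open>D\<close>\<close>

definition box :: "('g \<Rightarrow> 'g vfield list \<Rightarrow> real) \<Rightarrow> 'g \<Rightarrow> 'g vfield list \<Rightarrow> real" where
  "box \<omega> = ext_d (extend d0t \<omega>) + extend d0t (ext_d \<omega>)"

definition complex_forms :: "('g \<Rightarrow> 'g vfield list \<Rightarrow> complex) set" where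
  "complex_forms =
     {\<omega>. (\<lambda>x Vs. Re (\<omega> x Vs)) \<in> forms \<and> (\<lambda>x Vs. Im (\<omega> x Vs)) \<in> forms}"

definition of_real_form ::
    "('g \<Rightarrow> 'g vfield list \<Rightarrow> real) \<Rightarrow> 'g \<Rightarrow> 'g vfield list \<Rightarrow> complex" where
  "of_real_form \<omega> = (\<lambda>x Vs. complex_of_real (\<omega> x Vs))"

definition complexify ::
    "(('g \<Rightarrow> 'g vfield list \<Rightarrow> real) \<Rightarrow> 'g \<Rightarrow> 'g vfield list \<Rightarrow> real) \<Rightarrow>
     ('g \<Rightarrow> 'g vfield list \<Rightarrow> complex) \<Rightarrow> 'g \<Rightarrow> 'g vfield list \<Rightarrow> complex" where
  "complexify T \<omega> = (\<lambda>x Vs. Complex (T (\<lambda>y Ws. Re (\<omega> y Ws)) x Vs) (T (\<lambda>y Ws. Im (\<omega> y Ws)) x Vs))"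

definition resolvent ::
    "complex \<Rightarrow> ('g \<Rightarrow> 'g vfield list \<Rightarrow> complex) \<Rightarrow> 'g \<Rightarrow> 'g vfield list \<Rightarrow> complex" where
  "resolvent z = inv_into complex_forms (\<lambda>\<omega> x Vs. z * \<omega> x Vs - complexify box \<omega> x Vs)"

text \<open>The operator-valued contour integral is taken pointwise, on the coefficients of the form.\<close>

definition P_complex ::
    "real \<Rightarrow> ('g \<Rightarrow> 'g vfield list \<Rightarrow> complex) \<Rightarrow> 'g \<Rightarrow> 'g vfield list \<Rightarrow> complex" where
  "P_complex \<epsilon> \<omega> = (\<lambda>x Vs.
     1 / (2 * of_real pi * \<i>) * contour_integral (circlepath 0 \<epsilon>) (\<lambda>z. resolvent z \<omega> x Vs))"

text \<open>The contour integral maps real forms to real forms; \<open>P\<close> is its restriction to them.\<close>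

definition P :: "real \<Rightarrow> ('g \<Rightarrow> 'g vfield list \<Rightarrow> real) \<Rightarrow> 'g \<Rightarrow> 'g vfield list \<Rightarrow> real" where
  "P \<epsilon> \<omega> = inv_into forms of_real_form (P_complex \<epsilon> (of_real_form \<omega>))"

definition L :: "real \<Rightarrow> ('g \<Rightarrow> 'g vfield list \<Rightarrow> real) \<Rightarrow> 'g \<Rightarrow> 'g vfield list \<Rightarrow> real" where
  "L \<epsilon> \<omega> = P \<epsilon> (extend Pi0 \<omega>) + ((\<omega> - extend Pi0 \<omega>) - P \<epsilon> (\<omega> - extend Pi0 \<omega>))"

definition D :: "real \<Rightarrow> ('g \<Rightarrow> 'g vfield list \<Rightarrow> real) \<Rightarrow> 'g \<Rightarrow> 'g vfield list \<Rightarrow> real" where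
  "D \<epsilon> \<omega> = inv_into forms (L \<epsilon>) (ext_d (L \<epsilon> (extend Pi0 \<omega>)))"

end

end

theory Submission
  imports Defs "HOL-Computational_Algebra.Fundamental_Theorem_Algebra"
begin

text \<open>With \<open>Q\<close> for \<open>d\<^sub>0\<^sup>-\<^sup>1\<close> and \<open>K = (I - b)\<^sup>-\<^sup>1 Q\<close>, one has \<open>\<Pi> = K d + d K\<close>. The key point is that the
  spectral projection \<open>P\<close> equals \<open>\<Pi>\<^sub>E\<close>. On the image of \<open>\<Pi>\<^sub>E\<close> both \<open>Q\<close> and \<open>Q d\<close> vanish, hence so do
  \<open>d\<^sub>0\<^sup>t\<close> and \<open>d\<^sub>0\<^sup>t d\<close>, so \<open>\<box>\<close> vanishes and the resolvent is \<open>1 / z\<close>. The image of \<open>\<Pi>\<close> consists of forms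
  \<open>h + d k\<close> with \<open>h\<close>, \<open>k\<close> pointwise in \<open>H = (ker d\<^sub>0)\<^sup>\<bottom>\<close>. The operator \<open>\<box>\<close> commutes with \<open>d\<close> and preserves
  \<open>H\<close>-valued forms, on which it differs from \<open>\<box>\<^sub>0\<close>, invertible there, by a weight-increasing operator;
  so the resolvent is holomorphic inside the contour on the image of \<open>\<Pi>\<close>, and \<open>P\<close> kills it.
  Then \<open>L = \<Pi>\<^sub>E \<Pi>\<^sub>0 + (I - \<Pi>\<^sub>E) (I - \<Pi>\<^sub>0)\<close>, and Rumin's relations \<open>\<Pi>\<^sub>E \<Pi>\<^sub>0 \<Pi>\<^sub>E = \<Pi>\<^sub>E\<close>, \<open>\<Pi>\<^sub>0 \<Pi>\<^sub>E \<Pi>\<^sub>0 = \<Pi>\<^sub>0\<close>,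
  \<open>d \<Pi>\<^sub>E = \<Pi>\<^sub>E d\<close> show that \<open>L\<close> is injective and that \<open>L d\<^sub>c = d \<Pi>\<^sub>E \<Pi>\<^sub>0 = d L \<Pi>\<^sub>0\<close>.\<close>


section \<open>Smooth functions\<close>

text \<open>Forms make up an infinite-dimensional space carrying no topology here. Analysis is done
  on scalar coefficients at a fixed point and argument list, spectral theory in the
  finite-dimensional \<open>alt_forms\<close>. The weight filtration joins the two:
  \<open>d - d\<^sub>0\<close> gains at least \<open>\<upsilon> 1 > 0\<close>, and weights are
  bounded by the sum of all \<open>\<upsilon> i\<close>, so every perturbation series around an
  algebraic operator is finite. Inverses and projections are given by \<open>inv_into\<close> and
  \<open>THE\<close>, and each is evaluated by a candidate together with uniqueness. For the
  resolvent, uniqueness holds because the kernel of \<open>z - \<box>\<close> climbs the filtration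
  until it is 0. The candidate on the image of \<open>\<Pi>\<close> must be holomorphic at z = 0
  too, where \<open>z - \<box>\<close> may fail to be invertible on all forms; it is built from an
  eigenbasis of \<open>\<box>\<^sub>0\<close> on H, where 0 is not an eigenvalue. That basis also
  diagonalises a dilation, so that passing to eigencomponents loses no weight. Likewise the inverse
  of \<open>L\<close> is evaluated at a value that is visibly \<open>L\<close> of a form, so
  injectivity settles it.\<close>

lemma has_derivative_cong_open:
  assumes "open S" "x \<in> S" "\<And>y. y \<in> S \<Longrightarrow> f y = g y"
  shows "(f has_derivative D) (at x) \<longleftrightarrow> (g has_derivative D) (at x)"
  using assms has_derivative_transform_within_open[of f D x UNIV S g]
    has_derivative_transform_within_open[of g D x UNIV S f] by auto

text \<open>On an open set a derivative depends only on values inside the set. This lets the rules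
  below replace \<open>frechet_derivative\<close> by a formula that is known on S alone.\<close>

lemma Ck_on_cong:
  assumes "open S" "\<And>x. x \<in> S \<Longrightarrow> f x = g x"
  shows "Ck_on k S f \<longleftrightarrow> Ck_on k S g"
  using assms(2)
proof (induction k arbitrary: f g)
  case 0
  then show ?case by (auto intro: continuous_on_cong)
next
  case (Suc k)
  have D: "(f has_derivative D) (at x) \<longleftrightarrow> (g has_derivative D) (at x)" if "x \<in> S" for x D
    using has_derivative_cong_open[OF assms(1) that Suc.prems] .
  have 1: "f differentiable (at x) \<longleftrightarrow> g differentiable (at x)" if "x \<in> S" for x
    using D[OF that] by (simp add: differentiable_def)
  have 2: "frechet_derivative f (at x) = frechet_derivative g (at x)" if "x \<in> S" for x
    using D[OF that] by (simp add: frechet_derivative_def)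
  have "Ck_on k S (\<lambda>x. frechet_derivative f (at x) b) \<longleftrightarrow>
      Ck_on k S (\<lambda>x. frechet_derivative g (at x) b)" for b
    by (rule Suc.IH) (simp add: 2)
  with 1 show ?case by simp
qed

lemma Ck_on_SucD:
  assumes "Ck_on (Suc k) S f"
  shows "Ck_on k S f"
  using assms
proof (induction k arbitrary: f)
  case 0
  then show ?case
    by (auto intro!: continuous_at_imp_continuous_on differentiable_imp_continuous_within)
next
  case (Suc k)
  then show ?case by simp
qed

lemma Ck_on_const: "Ck_on k S (\<lambda>_. c)"
proof (induction k arbitrary: c)
  case (Suc k)
  have "frechet_derivative (\<lambda>_. c) (at x) b = 0" for x :: 'a and b
    by (simp add: frechet_derivative_const)
  with Suc show ?case by simp
qed simp

lemma Ck_on_linear_combination: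
  fixes f g :: "'e::euclidean_space \<Rightarrow> real"
  assumes "open S" "Ck_on k S f" "Ck_on k S g"
  shows "Ck_on k S (\<lambda>x. a * f x + b * g x)"
  using assms(2-)
proof (induction k arbitrary: f g)
  case 0
  then show ?case by (auto intro!: continuous_intros)
next
  case (Suc k)
  have D: "((\<lambda>x. a * f x + b * g x) has_derivative
      (\<lambda>h. a * frechet_derivative f (at x) h + b * frechet_derivative g (at x) h)) (at x)"
    if "x \<in> S" for x
    using Suc.prems that
    by (auto intro!: derivative_intros simp: frechet_derivative_works[symmetric])
  have "Ck_on k S (\<lambda>x. frechet_derivative (\<lambda>x. a * f x + b * g x) (at x) v)" if "v \<in> Basis" for v
  proof -
    have "Ck_on k S (\<lambda>x. a * frechet_derivative f (at x) v + b * frechet_derivative g (at x) v)"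
      using Suc.prems that by (intro Suc.IH) auto
    then show ?thesis
      using frechet_derivative_at[OF D]
      by (subst Ck_on_cong[OF assms(1)]) (auto simp: fun_eq_iff)
  qed
  with D show ?case by (auto simp: differentiable_def)
qed

lemma Ck_on_mult:
  fixes f g :: "'e::euclidean_space \<Rightarrow> real"
  assumes "open S" "Ck_on k S f" "Ck_on k S g"
  shows "Ck_on k S (\<lambda>x. f x * g x)"
  using assms(2-)
proof (induction k arbitrary: f g)
  case 0
  then show ?case by (auto intro!: continuous_intros)
next
  case (Suc k)
  have D: "((\<lambda>x. f x * g x) has_derivative
      (\<lambda>h. f x * frechet_derivative g (at x) h + frechet_derivative f (at x) h * g x)) (at x)"
    if "x \<in> S" for x
    using Suc.prems that
    by (auto intro!: derivative_intros simp: frechet_derivative_works[symmetric])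
  have "Ck_on k S (\<lambda>x. frechet_derivative (\<lambda>x. f x * g x) (at x) v)" if "v \<in> Basis" for v
  proof -
    \<comment> \<open>The product rule involves f and g themselves besides their derivatives, so
      their order is lowered from \<open>Suc k\<close> to k before the induction hypothesis
      applies.\<close>
    have "Ck_on k S (\<lambda>x. 1 * (f x * frechet_derivative g (at x) v)
        + 1 * (frechet_derivative f (at x) v * g x))"
      using Suc.prems that Ck_on_SucD[OF Suc.prems(1)] Ck_on_SucD[OF Suc.prems(2)]
      by (intro Ck_on_linear_combination[OF assms(1)] Suc.IH) auto
    then show ?thesis
      using frechet_derivative_at[OF D]
      by (subst Ck_on_cong[OF assms(1)]) (auto simp: fun_eq_iff)
  qed
  with D show ?case by (auto simp: differentiable_def)
qed

context lie_group
begin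

lemma open_chart_image: "(U, \<phi>) \<in> \<A> \<Longrightarrow> open (\<phi> ` U)"
  using atlas unfolding smooth_atlas_def by auto

lemma smooth_linear_combination:
  "\<lbrakk>f \<in> smooth_functions \<A>; h \<in> smooth_functions \<A>\<rbrakk> \<Longrightarrow>
    (\<lambda>x. a * f x + b * h x) \<in> smooth_functions \<A>"
  using open_chart_image
  by (fastforce simp: smooth_functions_def smooth_on_def o_def intro: Ck_on_linear_combination)

lemma smooth_mult:
  "\<lbrakk>f \<in> smooth_functions \<A>; h \<in> smooth_functions \<A>\<rbrakk> \<Longrightarrow>
    (\<lambda>x. f x * h x) \<in> smooth_functions \<A>"
  using open_chart_image
  by (fastforce simp: smooth_functions_def smooth_on_def o_def intro: Ck_on_mult)

lemma smooth_const: "(\<lambda>_. c) \<in> smooth_functions \<A>"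
  by (auto simp: smooth_functions_def smooth_on_def o_def intro: Ck_on_const)

lemma smooth_add:
  "\<lbrakk>f \<in> smooth_functions \<A>; h \<in> smooth_functions \<A>\<rbrakk> \<Longrightarrow> (\<lambda>x. f x + h x) \<in> smooth_functions \<A>"
  using smooth_linear_combination[of f h 1 1] by simp

lemma smooth_diff:
  "\<lbrakk>f \<in> smooth_functions \<A>; h \<in> smooth_functions \<A>\<rbrakk> \<Longrightarrow> (\<lambda>x. f x - h x) \<in> smooth_functions \<A>"
  using smooth_linear_combination[of f h 1 "-1"] by simp

lemma smooth_sum:
  "(\<And>i. i \<in> I \<Longrightarrow> f i \<in> smooth_functions \<A>) \<Longrightarrow> (\<lambda>x. \<Sum>i\<in>I. f i x) \<in> smooth_functions \<A>"
  by (induction I rule: infinite_finite_induct) (auto simp: smooth_const intro!: smooth_add)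

end


section \<open>Finite-dimensional linear algebra on spaces of functions\<close>

text \<open>Operators are total functions that are linear only on a carrier M, such as
  \<open>alt_forms\<close> or \<open>forms\<close>. The locale is instantiated for functions of one
  argument (\<open>fscale\<close>) and of two (\<open>Fscale\<close>).\<close>

locale linear_operators = vector_space
begin

definition lin_op :: "'b set \<Rightarrow> ('b \<Rightarrow> 'b) \<Rightarrow> bool" where
  "lin_op M T \<longleftrightarrow> (\<forall>u\<in>M. T u \<in> M) \<and> (\<forall>u\<in>M. \<forall>v\<in>M. T (u + v) = T u + T v) \<and>
     (\<forall>u\<in>M. \<forall>a. T (scale a u) = scale a (T u))"

lemma lin_op_mem: "lin_op M T \<Longrightarrow> u \<in> M \<Longrightarrow> T u \<in> M"
  by (simp add: lin_op_def)

lemma lin_op_add: "lin_op M T \<Longrightarrow> u \<in> M \<Longrightarrow> v \<in> M \<Longrightarrow> T (u + v) = T u + T v"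
  by (simp add: lin_op_def)

lemma lin_op_scale: "lin_op M T \<Longrightarrow> u \<in> M \<Longrightarrow> T (scale a u) = scale a (T u)"
  by (simp add: lin_op_def)

lemma lin_op_zero: "lin_op M T \<Longrightarrow> subspace M \<Longrightarrow> T 0 = 0"
  using lin_op_scale[of M T 0 0] by (simp add: subspace_0)

lemma lin_op_diff: "lin_op M T \<Longrightarrow> subspace M \<Longrightarrow> u \<in> M \<Longrightarrow> v \<in> M \<Longrightarrow> T (u - v) = T u - T v"
  using lin_op_add[of M T u "scale (-1) v"] lin_op_scale[of M T v "-1"]
  by (simp add: subspace_neg)

lemma lin_op_sum:
  assumes "lin_op M T" "subspace M" "\<And>i. i \<in> I \<Longrightarrow> f i \<in> M"
  shows "T (\<Sum>i\<in>I. f i) = (\<Sum>i\<in>I. T (f i))"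
  using assms(3)
  by (induction I rule: infinite_finite_induct)
    (auto simp: lin_op_zero[OF assms(1,2)] lin_op_add[OF assms(1)] subspace_sum[OF assms(2)])

lemma lin_op_comp: "lin_op M T \<Longrightarrow> lin_op M R \<Longrightarrow> lin_op M (\<lambda>u. T (R u))"
  by (auto simp: lin_op_def)

lemma lin_op_plus: "lin_op M T \<Longrightarrow> lin_op M R \<Longrightarrow> subspace M \<Longrightarrow> lin_op M (\<lambda>u. T u + R u)"
  by (auto simp: lin_op_def subspace_add scale_right_distrib)

lemma lin_op_minus: "lin_op M T \<Longrightarrow> lin_op M R \<Longrightarrow> subspace M \<Longrightarrow> lin_op M (\<lambda>u. T u - R u)"
  by (auto simp: lin_op_def subspace_diff scale_right_diff_distrib)

lemma lin_op_id: "lin_op M (\<lambda>u. u)"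
  by (auto simp: lin_op_def)

lemma lin_op_funpow: "lin_op M T \<Longrightarrow> lin_op M (T ^^ k)"
  by (induction k) (auto simp: lin_op_def)

end

definition fscale :: "real \<Rightarrow> ('a \<Rightarrow> real) \<Rightarrow> 'a \<Rightarrow> real" where
  "fscale a f = (\<lambda>x. a * f x)"

lemma fscale_apply [simp]: "fscale a f x = a * f x"
  by (simp add: fscale_def)

interpretation fs: linear_operators fscale
  by standard (auto simp: fun_eq_iff algebra_simps)

lemma sum_fun_apply: "(\<Sum>i\<in>I. f i) x = (\<Sum>i\<in>I. f i x)"
  by (induction I rule: infinite_finite_induct) auto

text \<open>A finite-dimensional function space, with finite dimension expressed by finitely many
  separating evaluation points. Their values serve as orthonormal coordinates; for
  \<open>alt_forms\<close>, evaluated on increasing basis lists, \<open>dot\<close> becomes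
  \<open>ip\<close>.\<close>

locale evaluation_space =
  fixes M :: "('a \<Rightarrow> real) set" and I :: "'i set" and e :: "'i \<Rightarrow> 'a"
  assumes finite_index: "finite I"
    and subspace_M: "fs.subspace M"
    and separating: "f \<in> M \<Longrightarrow> (\<And>i. i \<in> I \<Longrightarrow> f (e i) = 0) \<Longrightarrow> f = 0"
begin

definition dot :: "('a \<Rightarrow> real) \<Rightarrow> ('a \<Rightarrow> real) \<Rightarrow> real" where
  "dot f g = (\<Sum>i\<in>I. f (e i) * g (e i))"

lemma dot_commute: "dot f g = dot g f"
  by (simp add: dot_def mult.commute)

lemma dot_add_left: "dot (f + g) h = dot f h + dot g h"
  by (simp add: dot_def sum.distrib algebra_simps)

lemma dot_diff_left: "dot (f - g) h = dot f h - dot g h"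
  by (simp add: dot_def sum_subtractf algebra_simps)

lemma dot_scale_left: "dot (fscale a f) h = a * dot f h"
  by (simp add: dot_def sum_distrib_left mult.assoc)

lemma dot_zero_left [simp]: "dot 0 h = 0"
  by (simp add: dot_def)

lemma dot_sum_left: "dot (\<Sum>k\<in>K. f k) h = (\<Sum>k\<in>K. dot (f k) h)"
  unfolding dot_def sum_fun_apply sum_distrib_right by (rule sum.swap)

lemma dot_add_right: "dot h (f + g) = dot h f + dot h g"
  and dot_scale_right: "dot h (fscale a f) = a * dot h f"
  and dot_zero_right [simp]: "dot h 0 = 0"
  and dot_sum_right: "dot h (\<Sum>k\<in>K. F k) = (\<Sum>k\<in>K. dot h (F k))"
  by (simp_all add: dot_commute[of h] dot_add_left dot_scale_left dot_sum_left)

lemma dot_self_nonneg: "0 \<le> dot f f"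
  by (auto simp: dot_def intro: sum_nonneg)

lemma dot_self_eq_0: "f \<in> M \<Longrightarrow> dot f f = 0 \<Longrightarrow> f = 0"
  using finite_index by (intro separating) (auto simp: dot_def sum_nonneg_eq_0_iff)

lemma dot_eq_0_imp_eq:
  assumes "f \<in> M" "g \<in> M" "\<And>h. h \<in> M \<Longrightarrow> dot f h = dot g h"
  shows "f = g"
proof -
  have "f - g \<in> M"
    using assms subspace_M by (simp add: fs.subspace_diff)
  then show ?thesis
    using dot_self_eq_0[of "f - g"] assms(3)[of "f - g"] by (simp add: dot_diff_left)
qed

definition orthonormal :: "('a \<Rightarrow> real) set \<Rightarrow> bool" where
  "orthonormal B \<longleftrightarrow> finite B \<and> (\<forall>u\<in>B. \<forall>v\<in>B. dot u v = (if u = v then 1 else 0))"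

text \<open>Bessel's inequality for the evaluation functionals bounds the size of orthonormal sets.\<close>

lemma card_orthonormal_le:
  assumes "orthonormal B"
  shows "card B \<le> card I"
proof -
  have fin: "finite B" and on: "\<And>u v. u \<in> B \<Longrightarrow> v \<in> B \<Longrightarrow> dot u v = (if u = v then 1 else 0)"
    using assms by (auto simp: orthonormal_def)
  have bessel: "(\<Sum>b\<in>B. b (e i) * b (e i)) \<le> 1" if i: "i \<in> I" for i
  proof -
    let ?s = "\<lambda>j. \<Sum>b\<in>B. b (e i) * b (e j)"
    \<comment> \<open>\<open>?s j\<close> is coordinate j of the expansion along B of the functional
      evaluating at i. Its squared distance to the unit vector at i expands to
      \<open>1 - ?s i\<close>.\<close>
    have "0 \<le> (\<Sum>j\<in>I. (of_bool (j = i) - ?s j)\<^sup>2)"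
      by (simp add: sum_nonneg)
    also have "\<dots> = (\<Sum>j\<in>I. of_bool (j = i) - 2 * (of_bool (j = i) * ?s j) + ?s j * ?s j)"
      by (intro sum.cong) (auto simp: power2_eq_square algebra_simps)
    also have "\<dots> = (\<Sum>j\<in>I. of_bool (j = i)) - 2 * (\<Sum>j\<in>I. of_bool (j = i) * ?s j) + (\<Sum>j\<in>I. ?s j * ?s j)"
      by (simp add: sum.distrib sum_subtractf sum_distrib_left)
    also have "(\<Sum>j\<in>I. of_bool (j = i) :: real) = 1"
      using i finite_index by (subst sum.remove[of _ i]) auto
    also have "(\<Sum>j\<in>I. of_bool (j = i) * ?s j) = ?s i"
      using i finite_index by (subst sum.remove[of _ i]) auto
    also have "(\<Sum>j\<in>I. ?s j * ?s j) = (\<Sum>j\<in>I. \<Sum>b\<in>B. \<Sum>c\<in>B. b (e i) * c (e i) * (b (e j) * c (e j)))"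
      by (simp add: sum_product algebra_simps)
    also have "\<dots> = (\<Sum>b\<in>B. \<Sum>j\<in>I. \<Sum>c\<in>B. b (e i) * c (e i) * (b (e j) * c (e j)))"
      by (rule sum.swap)
    also have "\<dots> = (\<Sum>b\<in>B. \<Sum>c\<in>B. \<Sum>j\<in>I. b (e i) * c (e i) * (b (e j) * c (e j)))"
      by (intro sum.cong refl sum.swap)
    also have "\<dots> = (\<Sum>b\<in>B. \<Sum>c\<in>B. b (e i) * c (e i) * dot b c)"
      by (simp add: dot_def sum_distrib_left)
    also have "\<dots> = (\<Sum>b\<in>B. \<Sum>c\<in>B. if c = b then b (e i) * c (e i) else 0)"
      by (intro sum.cong refl) (auto simp: on)
    also have "\<dots> = ?s i"
      using fin by (intro sum.cong) auto
    finally show ?thesis by simp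
  qed
  have "real (card B) = (\<Sum>b\<in>B. dot b b)"
    by (simp add: on)
  also have "\<dots> = (\<Sum>i\<in>I. \<Sum>b\<in>B. b (e i) * b (e i))"
    unfolding dot_def by (rule sum.swap)
  also have "\<dots> \<le> (\<Sum>i\<in>I. 1)"
    by (intro sum_mono bessel)
  finally show ?thesis by simp
qed

text \<open>Bounded cardinality yields a largest orthonormal set with property Q; a unit vector with
  Q orthogonal to all of it would enlarge it.\<close>

lemma maximal_orthonormal:
  obtains B where "orthonormal B" "\<And>b. b \<in> B \<Longrightarrow> Q b"
    "\<And>u. Q u \<Longrightarrow> dot u u = 1 \<Longrightarrow> \<exists>b\<in>B. dot u b \<noteq> 0"
proof -
  define S where "S = (\<lambda>B. orthonormal B \<and> (\<forall>b\<in>B. Q b))"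
  have S0: "S {}" by (simp add: S_def orthonormal_def)
  have "\<forall>B. S B \<longrightarrow> card B \<le> card I"
    using card_orthonormal_le by (simp add: S_def)
  then obtain B where SB: "S B" and mx: "\<And>C. S C \<Longrightarrow> card C \<le> card B"
    using ex_has_greatest_nat[of S "{}" card "Suc (card I)", OF S0] by (auto simp: less_Suc_eq_le)
  have B: "orthonormal B" "\<And>b. b \<in> B \<Longrightarrow> Q b" using SB by (auto simp: S_def)
  have "\<exists>b\<in>B. dot u b \<noteq> 0" if u: "Q u" "dot u u = 1" for u
  proof (rule ccontr)
    assume "\<not> (\<exists>b\<in>B. dot u b \<noteq> 0)"
    then have orth: "\<And>b. b \<in> B \<Longrightarrow> dot u b = 0" by auto
    then have orth': "\<And>b. b \<in> B \<Longrightarrow> dot b u = 0" using dot_commute[of u] by simp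
    have "u \<notin> B" using orth u by auto
    moreover have "S (insert u B)"
      using B u orth orth' by (auto simp: S_def orthonormal_def)
    ultimately show False
      using mx[of "insert u B"] B(1) by (simp add: orthonormal_def card_insert_if)
  qed
  then show thesis using that[of B] B by blast
qed

text \<open>If the expansion failed for f, the residual would be a nonzero vector of W orthogonal to
  B; the hypothesis trades it for one with Q, which contradicts maximality after normalisation. A
  trivial Q gives orthonormal bases, and Q = "is a common eigenvector" gives the spectral
  theorem.\<close>

lemma orthonormal_expansion:
  assumes W: "fs.subspace W" "W \<subseteq> M"
    and ex: "\<And>B. orthonormal B \<Longrightarrow> B \<subseteq> W \<Longrightarrow> (\<And>b. b \<in> B \<Longrightarrow> Q b) \<Longrightarrow>
      (\<exists>u\<in>W. u \<noteq> 0 \<and> (\<forall>b\<in>B. dot u b = 0)) \<Longrightarrow> \<exists>u\<in>W. u \<noteq> 0 \<and> Q u \<and> (\<forall>b\<in>B. dot u b = 0)"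
    and scale: "\<And>u a. u \<in> W \<Longrightarrow> Q u \<Longrightarrow> Q (fscale a u)"
  obtains B where "orthonormal B" "B \<subseteq> W" "\<And>b. b \<in> B \<Longrightarrow> Q b"
    "\<And>f. f \<in> W \<Longrightarrow> f = (\<Sum>b\<in>B. fscale (dot f b) b)"
proof -
  obtain B where B: "orthonormal B" "\<And>b. b \<in> B \<Longrightarrow> b \<in> W \<and> Q b"
    "\<And>u. u \<in> W \<and> Q u \<Longrightarrow> dot u u = 1 \<Longrightarrow> \<exists>b\<in>B. dot u b \<noteq> 0"
    using maximal_orthonormal[of "\<lambda>u. u \<in> W \<and> Q u"] by metis
  have fin: "finite B" using B by (simp add: orthonormal_def)
  have "f = (\<Sum>b\<in>B. fscale (dot f b) b)" if f: "f \<in> W" for f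
  proof (rule ccontr)
    assume ne: "\<not> ?thesis"
    define r where "r = f - (\<Sum>b\<in>B. fscale (dot f b) b)"
    have "r \<in> W"
      unfolding r_def using W f B(2) by (intro fs.subspace_diff fs.subspace_sum fs.subspace_scale) auto
    moreover have "r \<noteq> 0" using ne by (simp add: r_def)
    moreover have "dot r c = 0" if "c \<in> B" for c
    proof -
      have "(\<Sum>b\<in>B. dot f b * dot b c) = (\<Sum>b\<in>B. if b = c then dot f b else 0)"
        using B(1) that by (intro sum.cong) (auto simp: orthonormal_def)
      then show ?thesis
        using fin that by (simp add: r_def dot_diff_left dot_sum_left dot_scale_left)
    qed
    ultimately obtain u where u: "u \<in> W" "u \<noteq> 0" "Q u" "\<forall>b\<in>B. dot u b = 0"
      using ex[of B] B by blast
    have pos: "dot u u > 0"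
      using dot_self_nonneg[of u] dot_self_eq_0[of u] u W by force
    have "dot (fscale (1 / sqrt (dot u u)) u) (fscale (1 / sqrt (dot u u)) u) = 1"
      using pos by (simp add: dot_scale_left dot_scale_right)
    then show False
      using B(3)[of "fscale (1 / sqrt (dot u u)) u"] u scale fs.subspace_scale[OF W(1)]
      by (auto simp: dot_scale_left)
  qed
  with that B show thesis by blast
qed

lemma orthonormal_basis:
  assumes W: "fs.subspace W" "W \<subseteq> M"
  obtains B where "orthonormal B" "B \<subseteq> W" "\<And>f. f \<in> W \<Longrightarrow> f = (\<Sum>b\<in>B. fscale (dot f b) b)"
  using orthonormal_expansion[OF W, of "\<lambda>_. True"] by (metis (full_types))

lemma orthogonal_projection_exists:
  assumes W: "fs.subspace W" "W \<subseteq> M"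
  shows "\<exists>g\<in>W. \<forall>h\<in>W. dot (f - g) h = 0"
proof -
  obtain B where B: "orthonormal B" "B \<subseteq> W" "\<And>f. f \<in> W \<Longrightarrow> f = (\<Sum>b\<in>B. fscale (dot f b) b)"
    using orthonormal_basis[OF W] by metis
  let ?g = "\<Sum>b\<in>B. fscale (dot f b) b"
  have "dot (f - ?g) h = 0" if "h \<in> W" for h
  proof -
    have 1: "dot f h = (\<Sum>b\<in>B. dot h b * dot f b)"
      by (subst B(3)[OF that]) (simp add: dot_sum_right dot_scale_right)
    show ?thesis
      by (simp add: dot_diff_left dot_sum_left dot_scale_left 1 dot_commute[of h] mult.commute)
  qed
  moreover have "?g \<in> W"
    using W B by (intro fs.subspace_sum fs.subspace_scale) auto
  ultimately show ?thesis by blast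
qed

lemma adjoint_exists:
  assumes "fs.lin_op M T"
  shows "\<exists>g\<in>M. \<forall>h\<in>M. dot (T h) f = dot h g"
proof -
  obtain B where B: "orthonormal B" "B \<subseteq> M" "\<And>f. f \<in> M \<Longrightarrow> f = (\<Sum>b\<in>B. fscale (dot f b) b)"
    using orthonormal_basis[OF subspace_M] by blast
  let ?g = "\<Sum>b\<in>B. fscale (dot (T b) f) b"
  have "dot (T h) f = dot h ?g" if "h \<in> M" for h
  proof -
    have "T h = (\<Sum>b\<in>B. fscale (dot h b) (T b))"
      using B(2) by (subst B(3)[OF that], subst fs.lin_op_sum[OF assms subspace_M])
        (auto intro!: sum.cong fs.subspace_scale[OF subspace_M] fs.lin_op_scale[OF assms])
    then show ?thesis
      by (simp add: dot_sum_left dot_sum_right dot_scale_left dot_scale_right mult.commute)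
  qed
  moreover have "?g \<in> M"
    using subspace_M B by (intro fs.subspace_sum fs.subspace_scale) auto
  ultimately show ?thesis by blast
qed

text \<open>Among f, T f, ... there are more vectors than an orthonormal basis of W has. The
  relation is packaged as a polynomial, so that a minimal one can be factored over the complex
  numbers.\<close>

lemma krylov_dependent:
  assumes W: "fs.subspace W" "W \<subseteq> M" and T: "fs.lin_op W T" and f: "f \<in> W"
  obtains p :: "real poly" where "p \<noteq> 0" "(\<Sum>k\<le>degree p. fscale (coeff p k) ((T ^^ k) f)) = 0"
proof -
  obtain B where B: "orthonormal B" "B \<subseteq> W" "\<And>f. f \<in> W \<Longrightarrow> f = (\<Sum>b\<in>B. fscale (dot f b) b)"
    using orthonormal_basis[OF W] by metis
  have fin: "finite B" using B by (simp add: orthonormal_def)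
  have sp: "W \<subseteq> fs.span B"
  proof
    fix f assume "f \<in> W"
    then show "f \<in> fs.span B"
      by (subst B(3)) (auto intro: fs.span_sum fs.span_scale fs.span_base)
  qed
  have memW: "(T ^^ k) f \<in> W" for k
    using fs.lin_op_mem[OF fs.lin_op_funpow[OF T] f] .
  define N where "N = card B"
  let ?v = "\<lambda>k. (T ^^ k) f"
  \<comment> \<open>\<open>fs.independent\<close> speaks of sets, so coinciding iterates would not
    be counted twice; a coincidence is itself a relation and is treated separately.\<close>
  have "\<exists>c. (\<exists>k\<le>N. c k \<noteq> 0) \<and> (\<Sum>k\<le>N. fscale (c k) (?v k)) = 0"
  proof (cases "inj_on ?v {..N}")
    case True
    have "\<not> fs.independent (?v ` {..N})"
    proof
      assume "fs.independent (?v ` {..N})"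
      then have "card (?v ` {..N}) \<le> card B"
        using fs.independent_span_bound[OF fin] memW sp by blast
      then show False using card_image[OF True] by (simp add: N_def)
    qed
    then obtain u where u: "\<exists>v\<in>?v ` {..N}. u v \<noteq> 0" "(\<Sum>v\<in>?v ` {..N}. fscale (u v) v) = 0"
      using fs.dependent_finite[of "?v ` {..N}"] by auto
    have "(\<Sum>k\<le>N. fscale (u (?v k)) (?v k)) = 0"
      using u(2) by (subst (asm) sum.reindex[OF True]) (simp add: o_def)
    with u(1) show ?thesis by (intro exI[of _ "\<lambda>k. u (?v k)"]) auto
  next
    case False
    then obtain i j where ij: "i \<le> N" "j \<le> N" "i \<noteq> j" "?v i = ?v j"
      by (auto simp: inj_on_def)
    have "(\<Sum>k\<le>N. fscale (of_bool (k = i) - of_bool (k = j)) (?v k)) =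
        (\<Sum>k\<le>N. (if k = i then ?v k else 0)) - (\<Sum>k\<le>N. (if k = j then ?v k else 0))"
      unfolding sum_subtractf[symmetric] by (intro sum.cong) auto
    also have "\<dots> = 0" using ij by simp
    finally show ?thesis
      using ij by (intro exI[of _ "\<lambda>k. of_bool (k = i) - of_bool (k = j)"]) auto
  qed
  then obtain c k where c: "k \<le> N" "c k \<noteq> 0" "(\<Sum>k\<le>N. fscale (c k) (?v k)) = 0"
    by blast
  define p where "p = (\<Sum>k\<le>N. monom (c k) k)"
  have coeff_p: "coeff p m = (if m \<le> N then c m else 0)" for m
    unfolding p_def coeff_sum by (simp add: coeff_monom)
  have "p \<noteq> 0" using coeff_p[of k] c by force
  have "degree p \<le> N" using coeff_p by (intro degree_le) auto
  have "(\<Sum>k\<le>degree p. fscale (coeff p k) (?v k)) = (\<Sum>k\<le>N. fscale (coeff p k) (?v k))"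
    using \<open>degree p \<le> N\<close> by (intro sum.mono_neutral_left) (auto simp: coeff_eq_0)
  also have "\<dots> = 0"
    using c(3) by (simp add: coeff_p)
  finally show thesis using that \<open>p \<noteq> 0\<close> by blast
qed

text \<open>The minimal polynomial \<open>p\<close> of \<open>f\<close> has a complex root \<open>a + \<i> b\<close>. With \<open>q = p / (x - a - \<i> b)\<close>,
  the real and imaginary parts of \<open>q(T) f\<close> span the real plane of a complex eigenvector, and symmetry
  forces \<open>b = 0\<close>.\<close>

lemma symmetric_eigenvector:
  assumes W: "fs.subspace W" "W \<subseteq> M" and T: "fs.lin_op W T"
    and sym: "\<And>u v. u \<in> W \<Longrightarrow> v \<in> W \<Longrightarrow> dot (T u) v = dot u (T v)"
    and f: "f \<in> W" "f \<noteq> 0"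
  obtains u \<mu> where "u \<in> W" "u \<noteq> 0" "T u = fscale \<mu> u"
proof -
  define pa where "pa = (\<lambda>p :: real poly. \<Sum>k\<le>degree p. fscale (coeff p k) ((T ^^ k) f))"
  have pa_N: "pa p = (\<Sum>k\<le>N. fscale (coeff p k) ((T ^^ k) f))" if "degree p \<le> N" for p N
    unfolding pa_def using that by (intro sum.mono_neutral_left) (auto simp: coeff_eq_0)
  have memW: "(T ^^ k) f \<in> W" for k
    using fs.lin_op_mem[OF fs.lin_op_funpow[OF T] f(1)] .
  have pa_W: "pa p \<in> W" for p
    unfolding pa_def using W memW by (intro fs.subspace_sum fs.subspace_scale) auto
  have pa_add: "pa (p + q) = pa p + pa q" for p q
    using pa_N[of "p + q" "max (degree p) (degree q)"] pa_N[of p "max (degree p) (degree q)"]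
      pa_N[of q "max (degree p) (degree q)"]
    by (simp add: degree_add_le fs.scale_left_distrib sum.distrib)
  have pa_smult: "pa (smult a p) = fscale a (pa p)" for a p
    using pa_N[of "smult a p" "degree p"] pa_N[of p "degree p"]
    by (simp add: degree_smult_le fs.scale_sum_right)
  have pa_diff: "pa (p - q) = pa p - pa q" for p q
    using pa_add[of p "smult (-1) q"] pa_smult[of "-1" q] by simp
  have pa_pCons: "pa (pCons 0 p) = T (pa p)" for p
  proof -
    have "pa (pCons 0 p) = (\<Sum>k\<le>Suc (degree p). fscale (coeff (pCons 0 p) k) ((T ^^ k) f))"
      by (intro pa_N degree_pCons_le)
    also have "\<dots> = (\<Sum>k\<le>degree p. fscale (coeff p k) (T ((T ^^ k) f)))"
      by (subst sum.atMost_Suc_shift) simp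
    also have "\<dots> = T (pa p)"
      unfolding pa_def using memW
      by (subst fs.lin_op_sum[OF T W(1)]) (auto intro!: fs.subspace_scale[OF W(1)] sum.cong
          simp: fs.lin_op_scale[OF T])
    finally show ?thesis .
  qed
  obtain p0 where p0: "p0 \<noteq> 0 \<and> pa p0 = 0"
    using krylov_dependent[OF W T f(1)] unfolding pa_def by metis
  define p where "p = arg_min degree (\<lambda>p. p \<noteq> 0 \<and> pa p = 0)"
  have p: "p \<noteq> 0" "pa p = 0" and min: "\<And>q. q \<noteq> 0 \<Longrightarrow> pa q = 0 \<Longrightarrow> degree p \<le> degree q"
    using arg_min_nat_lemma[of "\<lambda>p. p \<noteq> 0 \<and> pa p = 0" p0 degree, OF p0, folded p_def] by blast+
  define pc where "pc = map_poly complex_of_real p"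
  have coeff_pc: "coeff pc k = of_real (coeff p k)" for k
    by (simp add: pc_def coeff_map_poly)
  have deg_pc: "degree pc = degree p"
    unfolding pc_def by (rule degree_map_poly) auto
  have "degree p \<noteq> 0"
  proof
    assume d: "degree p = 0"
    then have "pa p = fscale (coeff p 0) f" by (simp add: pa_def)
    then have "coeff p 0 = 0" using p f by simp
    then have "lead_coeff p = 0" using d by simp
    then show False using p(1) by (simp only: leading_coeff_0_iff)
  qed
  then have "\<not> constant (poly pc)"
    using deg_pc by (simp add: constant_degree)
  then obtain z where "poly pc z = 0"
    using fundamental_theorem_of_algebra by blast
  then obtain q where q: "pc = [:- z, 1:] * q"
    by (auto simp: poly_eq_0_iff_dvd)
  have "pc \<noteq> 0" using deg_pc \<open>degree p \<noteq> 0\<close> by auto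
  then have "q \<noteq> 0" using q by auto
  have deg_q: "degree p = Suc (degree q)"
    using \<open>q \<noteq> 0\<close> by (subst deg_pc[symmetric], subst q, subst degree_mult_eq) auto
  have pc_eq: "pc = pCons 0 q - smult z q"
    unfolding q by (simp add: mult_pCons_left)
  define q1 q2 where "q1 = map_poly Re q" and "q2 = map_poly Im q"
  have c1: "coeff q1 k = Re (coeff q k)" and c2: "coeff q2 k = Im (coeff q k)" for k
    by (simp_all add: q1_def q2_def coeff_map_poly)
  have ck: "of_real (coeff p k) = coeff (pCons 0 q) k - z * coeff q k" for k
    using coeff_pc[of k] by (simp add: pc_eq)
  \<comment> \<open>Real and imaginary parts of the coefficient identity pc = x q - z q.\<close>
  have e1: "p = pCons 0 q1 - smult (Re z) q1 + smult (Im z) q2"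
  proof (rule poly_eqI)
    fix k show "coeff p k = coeff (pCons 0 q1 - smult (Re z) q1 + smult (Im z) q2) k"
      using arg_cong[OF ck[of k], of Re] by (cases k) (simp_all add: c1 c2)
  qed
  have e2: "0 = pCons 0 q2 - smult (Re z) q2 - smult (Im z) q1"
  proof (rule poly_eqI)
    fix k show "coeff 0 k = coeff (pCons 0 q2 - smult (Re z) q2 - smult (Im z) q1) k"
      using arg_cong[OF ck[of k], of Im] by (cases k) (simp_all add: c1 c2)
  qed
  let ?u = "pa q1" and ?w = "pa q2"
  have pa0: "pa 0 = 0" by (simp add: pa_def)
  have Tu: "T ?u = fscale (Re z) ?u - fscale (Im z) ?w"
    using arg_cong[OF e1, of pa] p(2) by (simp add: pa_add pa_diff pa_smult pa_pCons algebra_simps)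
  have Tw: "T ?w = fscale (Re z) ?w + fscale (Im z) ?u"
    using arg_cong[OF e2, of pa] by (simp add: pa_add pa_diff pa_smult pa_pCons pa0 algebra_simps)
  have "dot (T ?u) ?w = dot ?u (T ?w)"
    by (intro sym pa_W)
  then have "Im z * (dot ?u ?u + dot ?w ?w) = 0"
    unfolding Tu Tw
    by (simp add: dot_diff_left dot_add_right dot_scale_left dot_scale_right algebra_simps)
  \<comment> \<open>The leading coefficient of q equals that of p, hence is real and nonzero. So q1
    is a nonzero polynomial of smaller degree than p and cannot annihilate f.\<close>
  moreover have "?u \<noteq> 0"
  proof
    assume "?u = 0"
    have "coeff pc (degree p) = coeff q (degree q)"
      unfolding pc_eq deg_q by (simp add: coeff_eq_0)
    then have "coeff q (degree q) = of_real (coeff p (degree p))"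
      by (simp add: coeff_pc)
    then have "coeff q1 (degree q) \<noteq> 0"
      using p(1) by (simp add: c1)
    then have "q1 \<noteq> 0" by auto
    moreover have "degree q1 \<le> degree q"
      by (rule degree_le) (simp add: c1 coeff_eq_0)
    ultimately show False
      using min[of q1] \<open>?u = 0\<close> deg_q by simp
  qed
  then have "dot ?u ?u \<noteq> 0"
    using dot_self_eq_0[of ?u] pa_W W by auto
  then have "dot ?u ?u + dot ?w ?w \<noteq> 0"
    using dot_self_nonneg[of ?u] dot_self_nonneg[of ?w] by linarith
  ultimately have "Im z = 0" by simp
  then have "T ?u = fscale (Re z) ?u" using Tu by simp
  with that pa_W \<open>?u \<noteq> 0\<close> show thesis by blast
qed

text \<open>The orthogonal complement of the eigenvectors already found is invariant under both
  operators. It contains an eigenvector of T, and as S commutes with T it preserves that eigenspace,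
  inside which it has an eigenvector of its own.\<close>

lemma simultaneous_eigenbasis:
  assumes W: "fs.subspace W" "W \<subseteq> M" and T: "fs.lin_op W T" and S: "fs.lin_op W S"
    and symT: "\<And>u v. u \<in> W \<Longrightarrow> v \<in> W \<Longrightarrow> dot (T u) v = dot u (T v)"
    and symS: "\<And>u v. u \<in> W \<Longrightarrow> v \<in> W \<Longrightarrow> dot (S u) v = dot u (S v)"
    and comm: "\<And>u. u \<in> W \<Longrightarrow> S (T u) = T (S u)"
  obtains B where "orthonormal B" "B \<subseteq> W"
    "\<And>b. b \<in> B \<Longrightarrow> (\<exists>\<mu>. T b = fscale \<mu> b) \<and> (\<exists>\<sigma>. S b = fscale \<sigma> b)"
    "\<And>f. f \<in> W \<Longrightarrow> f = (\<Sum>b\<in>B. fscale (dot f b) b)"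
proof (rule orthonormal_expansion[OF W,
      of "\<lambda>b. (\<exists>\<mu>. T b = fscale \<mu> b) \<and> (\<exists>\<sigma>. S b = fscale \<sigma> b)"])
  fix B
  assume B: "B \<subseteq> W" "\<And>b. b \<in> B \<Longrightarrow> (\<exists>\<mu>. T b = fscale \<mu> b) \<and> (\<exists>\<sigma>. S b = fscale \<sigma> b)"
    and "\<exists>u\<in>W. u \<noteq> 0 \<and> (\<forall>b\<in>B. dot u b = 0)"
  then obtain u where u: "u \<in> W" "u \<noteq> 0" "\<forall>b\<in>B. dot u b = 0" by blast
  define W1 where "W1 = {v \<in> W. \<forall>b\<in>B. dot v b = 0}"
  have W1: "fs.subspace W1" "W1 \<subseteq> M"
    using W by (auto simp: W1_def fs.subspace_def dot_add_left dot_scale_left)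
  have inv: "R v \<in> W1" if R: "fs.lin_op W R" "\<And>u v. u \<in> W \<Longrightarrow> v \<in> W \<Longrightarrow> dot (R u) v = dot u (R v)"
    "\<And>b. b \<in> B \<Longrightarrow> \<exists>\<mu>. R b = fscale \<mu> b" and v: "v \<in> W1" for R v
  proof -
    have "dot (R v) b = 0" if b: "b \<in> B" for b
    proof -
      obtain \<mu> where "R b = fscale \<mu> b" using R(3)[OF b] by blast
      then show ?thesis
        using v b B R(2)[of v b] by (auto simp: W1_def dot_scale_right)
    qed
    then show ?thesis
      using v fs.lin_op_mem[OF R(1)] by (auto simp: W1_def)
  qed
  have lin: "fs.lin_op W1 R" if R: "fs.lin_op W R" "\<And>v. v \<in> W1 \<Longrightarrow> R v \<in> W1" for R
    using R by (auto simp: fs.lin_op_def W1_def)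
  have invT: "T v \<in> W1" if "v \<in> W1" for v
    using inv[OF T symT _ that] B by blast
  have invS: "S v \<in> W1" if "v \<in> W1" for v
    using inv[OF S symS _ that] B by blast
  have W1W: "v \<in> W1 \<Longrightarrow> v \<in> W" for v by (simp add: W1_def)
  obtain v \<mu> where v: "v \<in> W1" "v \<noteq> 0" "T v = fscale \<mu> v"
    using symmetric_eigenvector[OF W1 lin[OF T invT] symT[OF W1W W1W], of u] u
    by (auto simp: W1_def)
  define W2 where "W2 = {v \<in> W1. T v = fscale \<mu> v}"
  have W2: "fs.subspace W2" "W2 \<subseteq> M"
    using W1 fs.lin_op_zero[OF T W(1)] fs.lin_op_add[OF T W1W W1W] fs.lin_op_scale[OF T W1W]
    by (auto simp: W2_def fs.subspace_def fs.scale_right_distrib fs.scale_left_commute)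
  have invS2: "S x \<in> W2" if "x \<in> W2" for x
  proof -
    have "T (S x) = S (T x)" using comm[of x] that W1W by (simp add: W2_def)
    also have "\<dots> = fscale \<mu> (S x)" using that W1W fs.lin_op_scale[OF S] by (simp add: W2_def)
    finally show ?thesis using invS that by (simp add: W2_def)
  qed
  have S2: "fs.lin_op W2 S"
    using lin[OF S invS] invS2 by (auto simp: fs.lin_op_def W2_def)
  have W2W: "x \<in> W2 \<Longrightarrow> x \<in> W" for x by (simp add: W2_def W1_def)
  obtain w \<sigma> where w: "w \<in> W2" "w \<noteq> 0" "S w = fscale \<sigma> w"
    using symmetric_eigenvector[OF W2 S2 symS[OF W2W W2W], of v] v by (auto simp: W2_def)
  then show "\<exists>u\<in>W. u \<noteq> 0 \<and> ((\<exists>\<mu>. T u = fscale \<mu> u) \<and> (\<exists>\<sigma>. S u = fscale \<sigma> u)) \<and> (\<forall>b\<in>B. dot u b = 0)"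
    by (auto simp: W2_def W1_def)
next
  fix u a
  assume "u \<in> W" "(\<exists>\<mu>. T u = fscale \<mu> u) \<and> (\<exists>\<sigma>. S u = fscale \<sigma> u)"
  then show "(\<exists>\<mu>. T (fscale a u) = fscale \<mu> (fscale a u)) \<and> (\<exists>\<sigma>. S (fscale a u) = fscale \<sigma> (fscale a u))"
    by (metis fs.lin_op_scale[OF T] fs.lin_op_scale[OF S] fs.scale_left_commute)
qed (use that in blast)

end


section \<open>The exterior derivative\<close>

context lie_group
begin

lemma lie_algebra_smooth:
  "V \<in> lie_algebra \<A> \<Longrightarrow> f \<in> smooth_functions \<A> \<Longrightarrow> V f \<in> smooth_functions \<A>"
  by (simp add: lie_algebra_def vector_fields_def)

lemma lie_algebra_linear:
  "V \<in> lie_algebra \<A> \<Longrightarrow> f \<in> smooth_functions \<A> \<Longrightarrow> h \<in> smooth_functions \<A> \<Longrightarrow>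
    V (\<lambda>x. a * f x + b * h x) = (\<lambda>x. a * V f x + b * V h x)"
  by (simp add: lie_algebra_def vector_fields_def)

lemma lie_algebra_Leibniz:
  "V \<in> lie_algebra \<A> \<Longrightarrow> f \<in> smooth_functions \<A> \<Longrightarrow> h \<in> smooth_functions \<A> \<Longrightarrow>
    V (\<lambda>x. f x * h x) = (\<lambda>x. V f x * h x + f x * V h x)"
  by (simp add: lie_algebra_def vector_fields_def)

lemma lie_algebra_left_invariant:
  "V \<in> lie_algebra \<A> \<Longrightarrow> f \<in> smooth_functions \<A> \<Longrightarrow> V (\<lambda>x. f (g + x)) = (\<lambda>x. V f (g + x))"
  by (simp add: lie_algebra_def)

lemma lie_algebra_not_smooth: "V \<in> lie_algebra \<A> \<Longrightarrow> f \<notin> smooth_functions \<A> \<Longrightarrow> V f = (\<lambda>_. 0)"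
  by (simp add: lie_algebra_def vector_fields_def zero_fun_def)

lemma lie_algebra_diff:
  "V \<in> lie_algebra \<A> \<Longrightarrow> f \<in> smooth_functions \<A> \<Longrightarrow> h \<in> smooth_functions \<A> \<Longrightarrow>
    V (\<lambda>x. f x - h x) = (\<lambda>x. V f x - V h x)"
  using lie_algebra_linear[of V f h 1 "-1"] by simp

lemma lie_algebra_const:
  assumes "V \<in> lie_algebra \<A>"
  shows "V (\<lambda>_. c) = (\<lambda>_. 0)"
proof -
  have "V (\<lambda>_. 1) = (\<lambda>_. 0)"
    using lie_algebra_Leibniz[OF assms smooth_const[of 1] smooth_const[of 1]] by (auto simp: fun_eq_iff)
  then show ?thesis
    using lie_algebra_linear[OF assms smooth_const[of 1] smooth_const[of 1], of c 0] by simp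
qed

lemma lie_bracket_apply: "lie_bracket V W f x = V (W f) x - W (V f) x"
  by (simp add: lie_bracket_def)

text \<open>Vector fields are compared on all functions, so the bracket must respect the convention
  that they are 0 on functions that are not smooth.\<close>

lemma lie_bracket_not_smooth:
  "V \<in> lie_algebra \<A> \<Longrightarrow> W \<in> lie_algebra \<A> \<Longrightarrow> f \<notin> smooth_functions \<A> \<Longrightarrow> lie_bracket V W f = (\<lambda>_. 0)"
  by (simp add: fun_eq_iff lie_bracket_apply lie_algebra_not_smooth lie_algebra_const)

lemma lie_bracket_closed:
  assumes V: "V \<in> lie_algebra \<A>" and W: "W \<in> lie_algebra \<A>"
  shows "lie_bracket V W \<in> lie_algebra \<A>"
proof -
  note sm = lie_algebra_smooth[OF V] lie_algebra_smooth[OF W]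
  have 1: "lie_bracket V W f \<in> smooth_functions \<A>" if "f \<in> smooth_functions \<A>" for f
  proof -
    have "(\<lambda>x. lie_bracket V W f x) \<in> smooth_functions \<A>"
      unfolding lie_bracket_apply using that by (intro smooth_diff sm)
    then show ?thesis by simp
  qed
  have 2: "lie_bracket V W (\<lambda>x. a * f x + b * h x) =
      (\<lambda>x. a * lie_bracket V W f x + b * lie_bracket V W h x)"
    if "f \<in> smooth_functions \<A>" "h \<in> smooth_functions \<A>" for f h a b
    using that by (simp add: fun_eq_iff lie_bracket_apply lie_algebra_linear[OF V]
        lie_algebra_linear[OF W] sm algebra_simps)
  have 3: "lie_bracket V W (\<lambda>x. f x * h x) =
      (\<lambda>x. lie_bracket V W f x * h x + f x * lie_bracket V W h x)"
    if "f \<in> smooth_functions \<A>" "h \<in> smooth_functions \<A>" for f h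
  proof -
    have *: "A (B (\<lambda>x. f x * h x)) x =
        A (B f) x * h x + B f x * A h x + (A f x * B h x + f x * A (B h) x)"
      if A: "A \<in> lie_algebra \<A>" and B: "B \<in> lie_algebra \<A>" for A B x
    proof -
      have "B (\<lambda>x. f x * h x) = (\<lambda>x. 1 * (B f x * h x) + 1 * (f x * B h x))"
        using lie_algebra_Leibniz[OF B] \<open>f \<in> _\<close> \<open>h \<in> _\<close> by simp
      then have "A (B (\<lambda>x. f x * h x)) =
          (\<lambda>x. 1 * A (\<lambda>x. B f x * h x) x + 1 * A (\<lambda>x. f x * B h x) x)"
        using lie_algebra_linear[OF A, of "\<lambda>x. B f x * h x" "\<lambda>x. f x * B h x" 1 1]
          smooth_mult lie_algebra_smooth[OF B] \<open>f \<in> _\<close> \<open>h \<in> _\<close> by simp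
      then show ?thesis
        using lie_algebra_Leibniz[OF A] lie_algebra_smooth[OF B] \<open>f \<in> _\<close> \<open>h \<in> _\<close> by simp
    qed
    show ?thesis
      by (simp add: fun_eq_iff lie_bracket_apply *[OF V W] *[OF W V] algebra_simps)
  qed
  have 4: "lie_bracket V W (\<lambda>x. f (g + x)) = (\<lambda>x. lie_bracket V W f (g + x))"
    if "f \<in> smooth_functions \<A>" for f g
    using that by (simp add: fun_eq_iff lie_bracket_apply lie_algebra_left_invariant[OF V]
        lie_algebra_left_invariant[OF W] sm)
  show ?thesis
    using 1 2 3 4 lie_bracket_not_smooth[OF V W]
    by (simp add: lie_algebra_def vector_fields_def zero_fun_def)
qed

lemma lie_bracket_self: "lie_bracket V V = 0"
  by (simp add: lie_bracket_def zero_fun_def)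

lemma lie_bracket_commute: "lie_bracket W V = scale_vf (-1) (lie_bracket V W)"
  by (simp add: fun_eq_iff lie_bracket_apply scale_vf_def)

lemma lie_bracket_linear_right:
  assumes "V \<in> lie_algebra \<A>" "W \<in> lie_algebra \<A>" "U \<in> lie_algebra \<A>"
  shows "lie_bracket V (scale_vf a W + scale_vf b U) =
    scale_vf a (lie_bracket V W) + scale_vf b (lie_bracket V U)"
proof (intro ext)
  fix f x
  have "V (\<lambda>x. a * W f x + b * U f x) x = a * V (W f) x + b * V (U f) x"
  proof (cases "f \<in> smooth_functions \<A>")
    case True
    then show ?thesis using assms by (simp add: lie_algebra_linear lie_algebra_smooth)
  next
    case False
    then show ?thesis using assms by (simp add: lie_algebra_not_smooth lie_algebra_const)
  qed
  then show "lie_bracket V (scale_vf a W + scale_vf b U) f x =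
      (scale_vf a (lie_bracket V W) + scale_vf b (lie_bracket V U)) f x"
    by (simp add: lie_bracket_apply scale_vf_def plus_fun_def algebra_simps)
qed

lemma lie_bracket_linear_left:
  assumes "V \<in> lie_algebra \<A>" "W \<in> lie_algebra \<A>" "U \<in> lie_algebra \<A>"
  shows "lie_bracket (scale_vf a W + scale_vf b U) V =
    scale_vf a (lie_bracket W V) + scale_vf b (lie_bracket U V)"
  using lie_bracket_linear_right[OF assms, of a b]
  by (simp add: lie_bracket_commute[of _ V] vf.scale_right_distrib mult.commute)

lemma Jacobi:
  assumes "V \<in> lie_algebra \<A>" "W \<in> lie_algebra \<A>" "U \<in> lie_algebra \<A>"
  shows "lie_bracket (lie_bracket V W) U =
    scale_vf 1 (lie_bracket V (lie_bracket W U)) + scale_vf (-1) (lie_bracket W (lie_bracket V U))"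
proof (intro ext)
  fix f x
  have *: "A (lie_bracket B C f) x = A (B (C f)) x - A (C (B f)) x"
    if "A \<in> lie_algebra \<A>" "B \<in> lie_algebra \<A>" "C \<in> lie_algebra \<A>" for A B C
  proof (cases "f \<in> smooth_functions \<A>")
    case True
    have "lie_bracket B C f = (\<lambda>x. B (C f) x - C (B f) x)"
      by (simp add: fun_eq_iff lie_bracket_apply)
    then show ?thesis using that True by (simp add: lie_algebra_diff lie_algebra_smooth)
  next
    case False
    then show ?thesis using that
      by (simp add: lie_bracket_not_smooth lie_algebra_not_smooth lie_algebra_const)
  qed
  show "lie_bracket (lie_bracket V W) U f x = (scale_vf 1 (lie_bracket V (lie_bracket W U)) +
      scale_vf (-1) (lie_bracket W (lie_bracket V U))) f x"
    using assms by (simp add: lie_bracket_apply * scale_vf_def)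
qed

end

definition Fscale :: "real \<Rightarrow> ('a \<Rightarrow> 'b \<Rightarrow> real) \<Rightarrow> 'a \<Rightarrow> 'b \<Rightarrow> real" where
  "Fscale a \<omega> = (\<lambda>x y. a * \<omega> x y)"

lemma Fscale_apply [simp]: "Fscale a \<omega> x y = a * \<omega> x y"
  by (simp add: Fscale_def)

interpretation Fs: linear_operators Fscale
  by standard (auto simp: fun_eq_iff algebra_simps)

text \<open>The interior product \<open>\<iota>\<^sub>V\<close>.\<close>

definition insert_vf :: "'g vfield \<Rightarrow> ('g \<Rightarrow> 'g vfield list \<Rightarrow> real) \<Rightarrow> 'g \<Rightarrow> 'g vfield list \<Rightarrow> real" where
  "insert_vf V \<omega> = (\<lambda>x Vs. \<omega> x (V # Vs))"

primrec lie_deriv_at :: "'g vfield \<Rightarrow> 'g vfield list \<Rightarrow> ('g \<Rightarrow> 'g vfield list \<Rightarrow> real) \<Rightarrow> 'g \<Rightarrow> real" where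
  "lie_deriv_at V [] \<omega> = V (\<lambda>y. \<omega> y [])"
| "lie_deriv_at V (U # R) \<omega> = (\<lambda>x. lie_deriv_at V R (insert_vf U \<omega>) x - \<omega> x (lie_bracket V U # R))"

text \<open>Cartan's formula \<open>\<iota>\<^sub>V d = L\<^sub>V - d \<iota>\<^sub>V\<close> determines the exterior derivative by recursion.\<close>

primrec cartan_d :: "'g vfield list \<Rightarrow> ('g \<Rightarrow> 'g vfield list \<Rightarrow> real) \<Rightarrow> 'g \<Rightarrow> real" where
  "cartan_d [] \<omega> = (\<lambda>x. 0)"
| "cartan_d (V # R) \<omega> = (\<lambda>x. lie_deriv_at V R \<omega> x - cartan_d R (insert_vf V \<omega>) x)"

lemma insert_vf_apply [simp]: "insert_vf V \<omega> x Vs = \<omega> x (V # Vs)"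
  by (simp add: insert_vf_def)

section \<open>Alternating forms, and criteria for a function on lists to be one\<close>

context homogeneous_group
begin

lemma subspace_lie_algebra: "vf.subspace \<gg>"
  unfolding basis_span[symmetric] by (rule vf.subspace_span)

lemma lin_comb_closed: "V \<in> \<gg> \<Longrightarrow> W \<in> \<gg> \<Longrightarrow> scale_vf a V + scale_vf b W \<in> \<gg>"
  by (intro vf.subspace_add vf.subspace_scale subspace_lie_algebra)

lemma X_closed: "i \<in> {1..n} \<Longrightarrow> X i \<in> \<gg>"
  unfolding basis_span[symmetric] by (intro vf.span_base) auto

lemma alt_outside: "\<alpha> \<in> alt_forms \<Longrightarrow> \<not> set Vs \<subseteq> \<gg> \<Longrightarrow> \<alpha> Vs = 0"
  by (simp add: alt_forms_def)

lemma alt_linear: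
  "\<alpha> \<in> alt_forms \<Longrightarrow> set Us \<subseteq> \<gg> \<Longrightarrow> set Ws \<subseteq> \<gg> \<Longrightarrow> V \<in> \<gg> \<Longrightarrow> W \<in> \<gg> \<Longrightarrow>
    \<alpha> (Us @ (scale_vf a V + scale_vf b W) # Ws) = a * \<alpha> (Us @ V # Ws) + b * \<alpha> (Us @ W # Ws)"
  by (simp add: alt_forms_def)

lemma alt_linear_Cons:
  "\<alpha> \<in> alt_forms \<Longrightarrow> set Ws \<subseteq> \<gg> \<Longrightarrow> V \<in> \<gg> \<Longrightarrow> W \<in> \<gg> \<Longrightarrow>
    \<alpha> ((scale_vf a V + scale_vf b W) # Ws) = a * \<alpha> (V # Ws) + b * \<alpha> (W # Ws)"
  using alt_linear[of \<alpha> "[]"] by simp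

lemma alt_zero_Cons: "\<alpha> \<in> alt_forms \<Longrightarrow> set R \<subseteq> \<gg> \<Longrightarrow> \<alpha> (0 # R) = 0"
  using alt_linear_Cons[of \<alpha> R 0 0 0 0] vf.subspace_0[OF subspace_lie_algebra] by simp

lemma alt_not_distinct: "\<alpha> \<in> alt_forms \<Longrightarrow> \<not> distinct Vs \<Longrightarrow> \<alpha> Vs = 0"
  by (simp add: alt_forms_def)

lemma alt_forms_Cons: "\<alpha> \<in> alt_forms \<Longrightarrow> V \<in> \<gg> \<Longrightarrow> (\<lambda>Vs. \<alpha> (V # Vs)) \<in> alt_forms"
  using alt_linear[of \<alpha> "V # _"] by (auto simp: alt_forms_def)

lemma alt_swap:
  assumes "\<alpha> \<in> alt_forms" "V \<in> \<gg>" "W \<in> \<gg>" "set R \<subseteq> \<gg>"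
  shows "\<alpha> (W # V # R) = - \<alpha> (V # W # R)"
proof -
  let ?S = "scale_vf 1 V + scale_vf 1 W"
  have S: "?S \<in> \<gg>" using assms by (intro lin_comb_closed)
  have "0 = \<alpha> (?S # ?S # R)"
    using assms by (simp add: alt_not_distinct)
  also have "\<dots> = \<alpha> (V # ?S # R) + \<alpha> (W # ?S # R)"
    using alt_linear_Cons[OF assms(1), of "?S # R" V W 1 1] assms S by simp
  also have "\<dots> = \<alpha> (V # V # R) + \<alpha> (V # W # R) + (\<alpha> (W # V # R) + \<alpha> (W # W # R))"
    using alt_linear[OF assms(1), of "[V]" R V W 1 1] alt_linear[OF assms(1), of "[W]" R V W 1 1] assms
    by simp
  finally show ?thesis
    using assms by (simp add: alt_not_distinct)
qed

lemma alt_move_front: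
  assumes "\<alpha> \<in> alt_forms" "V \<in> \<gg>" "set As \<subseteq> \<gg>" "set Bs \<subseteq> \<gg>"
  shows "\<alpha> (As @ V # Bs) = (- 1) ^ length As * \<alpha> (V # As @ Bs)"
  using assms
proof (induction As arbitrary: \<alpha>)
  case (Cons A As)
  have "\<alpha> ((A # As) @ V # Bs) = (- 1) ^ length As * \<alpha> (A # V # As @ Bs)"
    using Cons.IH[OF alt_forms_Cons[OF Cons.prems(1), of A]] Cons.prems by simp
  also have "\<alpha> (A # V # As @ Bs) = - \<alpha> (V # A # As @ Bs)"
    using Cons.prems by (intro alt_swap) auto
  finally show ?case by simp
qed simp

lemma alt_forms_subspace: "fs.subspace alt_forms"
  by (auto simp: fs.subspace_def alt_forms_def algebra_simps)

text \<open>Contraction with a vector field lowers the degree, so alternation of \<open>L\<^sub>V \<omega>\<close> and \<open>d \<omega>\<close> is proved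
  degree by degree, by Cartan's formula.\<close>

definition degree_part :: "nat \<Rightarrow> ('g vfield list \<Rightarrow> real) \<Rightarrow> 'g vfield list \<Rightarrow> real" where
  "degree_part k \<alpha> = (\<lambda>Vs. if length Vs = k then \<alpha> Vs else 0)"

lemma degree_part_alt: "\<alpha> \<in> alt_forms \<Longrightarrow> degree_part k \<alpha> \<in> alt_forms"
  by (auto simp: alt_forms_def degree_part_def)

text \<open>Each condition in \<open>alt_forms\<close> involves lists of one length only, so it may
  be checked degree by degree.\<close>

lemma alt_forms_by_degree:
  assumes "\<And>k. degree_part k \<alpha> \<in> alt_forms"
  shows "\<alpha> \<in> alt_forms"
  unfolding alt_forms_def
proof (intro CollectI conjI allI impI)
  have 1: "\<alpha> Vs = degree_part (length Vs) \<alpha> Vs" for Vs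
    by (simp add: degree_part_def)
  fix Vs
  show "\<not> set Vs \<subseteq> \<gg> \<Longrightarrow> \<alpha> Vs = 0" by (subst 1) (rule alt_outside[OF assms])
  show "\<not> distinct Vs \<Longrightarrow> \<alpha> Vs = 0" by (subst 1) (rule alt_not_distinct[OF assms])
next
  fix Us Ws V W a b
  assume "set Us \<subseteq> \<gg> \<and> set Ws \<subseteq> \<gg> \<and> V \<in> \<gg> \<and> W \<in> \<gg>"
  then show "\<alpha> (Us @ (scale_vf a V + scale_vf b W) # Ws) = a * \<alpha> (Us @ V # Ws) + b * \<alpha> (Us @ W # Ws)"
    using alt_linear[OF assms[of "length Us + Suc (length Ws)"], of Us Ws V W a b]
    by (simp add: degree_part_def)
qed

text \<open>If all contractions alternate, only conditions on the first two slots remain: a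
  repetition of the first argument deeper in the list is moved up to the second place at the cost of
  a sign.\<close>

lemma degree_part_SucI:
  assumes out: "\<And>Vs. \<not> set Vs \<subseteq> \<gg> \<Longrightarrow> \<alpha> Vs = 0"
    and lin: "\<And>V W a b R. V \<in> \<gg> \<Longrightarrow> W \<in> \<gg> \<Longrightarrow> set R \<subseteq> \<gg> \<Longrightarrow>
      \<alpha> ((scale_vf a V + scale_vf b W) # R) = a * \<alpha> (V # R) + b * \<alpha> (W # R)"
    and sq: "\<And>V R. V \<in> \<gg> \<Longrightarrow> set R \<subseteq> \<gg> \<Longrightarrow> \<alpha> (V # V # R) = 0"
    and Cons: "\<And>V. V \<in> \<gg> \<Longrightarrow> degree_part k (\<lambda>R. \<alpha> (V # R)) \<in> alt_forms"
  shows "degree_part (Suc k) \<alpha> \<in> alt_forms"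
  unfolding alt_forms_def
proof (intro CollectI conjI allI impI)
  fix Vs show "\<not> set Vs \<subseteq> \<gg> \<Longrightarrow> degree_part (Suc k) \<alpha> Vs = 0"
    by (simp add: degree_part_def out)
next
  have *: "degree_part (Suc k) \<alpha> (V # R) = degree_part k (\<lambda>R. \<alpha> (V # R)) R" for V R
    by (simp add: degree_part_def)
  fix Us Ws V W a b
  assume "set Us \<subseteq> \<gg> \<and> set Ws \<subseteq> \<gg> \<and> V \<in> \<gg> \<and> W \<in> \<gg>"
  then show "degree_part (Suc k) \<alpha> (Us @ (scale_vf a V + scale_vf b W) # Ws) =
      a * degree_part (Suc k) \<alpha> (Us @ V # Ws) + b * degree_part (Suc k) \<alpha> (Us @ W # Ws)"
    using alt_linear[OF Cons, of _ "tl Us" Ws V W a b]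
    by (cases Us) (auto simp: * simp: degree_part_def lin)
next
  have *: "degree_part (Suc k) \<alpha> (V # R) = degree_part k (\<lambda>R. \<alpha> (V # R)) R" for V R
    by (simp add: degree_part_def)
  fix Vs :: "'g vfield list" assume nd: "\<not> distinct Vs"
  show "degree_part (Suc k) \<alpha> Vs = 0"
  proof (cases "set Vs \<subseteq> \<gg>")
    case True
    from nd obtain V R where Vs: "Vs = V # R" by (cases Vs) auto
    show ?thesis
    proof (cases "distinct R")
      case False
      then show ?thesis
        using alt_not_distinct[OF Cons] True by (simp add: Vs *)
    next
      case True
      then have "V \<in> set R" using nd Vs by simp
      then obtain As Bs where R: "R = As @ V # Bs" by (auto simp: in_set_conv_decomp)
      have "degree_part k (\<lambda>R. \<alpha> (V # R)) R =
          (- 1) ^ length As * degree_part k (\<lambda>R. \<alpha> (V # R)) (V # As @ Bs)"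
        using \<open>set Vs \<subseteq> \<gg>\<close> unfolding R Vs by (intro alt_move_front Cons) auto
      also have "degree_part k (\<lambda>R. \<alpha> (V # R)) (V # As @ Bs) = 0"
        using \<open>set Vs \<subseteq> \<gg>\<close> by (auto simp: degree_part_def Vs R intro!: sq)
      finally show ?thesis by (simp add: Vs *)
    qed
  qed (simp add: degree_part_def out)
qed

lemma alt_form_cong:
  assumes "\<alpha> \<in> alt_forms" "\<beta> \<in> alt_forms" "\<And>Vs. set Vs \<subseteq> \<gg> \<Longrightarrow> \<alpha> Vs = \<beta> Vs"
  shows "\<alpha> = \<beta>"
  using assms(3) alt_outside[OF assms(1)] alt_outside[OF assms(2)] by (metis ext)

lemma forms_alt: "\<omega> \<in> forms \<Longrightarrow> \<omega> x \<in> alt_forms"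
  by (simp add: forms_def)

lemma forms_smooth: "\<omega> \<in> forms \<Longrightarrow> (\<lambda>x. \<omega> x Vs) \<in> smooth_functions \<A>"
  by (cases "set Vs \<subseteq> \<gg>") (auto simp: forms_def smooth_const alt_outside)

lemma formsI: "(\<And>x. \<omega> x \<in> alt_forms) \<Longrightarrow>
    (\<And>Vs. set Vs \<subseteq> \<gg> \<Longrightarrow> (\<lambda>x. \<omega> x Vs) \<in> smooth_functions \<A>) \<Longrightarrow> \<omega> \<in> forms"
  by (simp add: forms_def)

lemma forms_subspace: "Fs.subspace forms"
  unfolding Fs.subspace_def
proof (intro conjI ballI allI)
  show "0 \<in> forms"
    using fs.subspace_0[OF alt_forms_subspace] by (intro formsI) (simp_all add: smooth_const)
  fix \<omega> \<eta> assume f: "\<omega> \<in> forms" "\<eta> \<in> forms"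
  show "\<omega> + \<eta> \<in> forms"
    using fs.subspace_add[OF alt_forms_subspace forms_alt forms_alt, OF f]
    by (intro formsI) (simp_all add: smooth_add forms_smooth f)
next
  fix a \<omega> assume f: "\<omega> \<in> forms"
  have 1: "Fscale a \<omega> x = fscale a (\<omega> x)" for x by (simp add: fun_eq_iff)
  show "Fscale a \<omega> \<in> forms"
    using smooth_linear_combination[OF forms_smooth[OF f] smooth_const, of a _ 0 0]
    by (intro formsI) (auto simp: 1 fs.subspace_scale[OF alt_forms_subspace] forms_alt[OF f])
qed

lemma forms_0: "0 \<in> forms"
  and forms_add: "\<omega> \<in> forms \<Longrightarrow> \<eta> \<in> forms \<Longrightarrow> \<omega> + \<eta> \<in> forms"
  and forms_diff: "\<omega> \<in> forms \<Longrightarrow> \<eta> \<in> forms \<Longrightarrow> \<omega> - \<eta> \<in> forms"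
  and forms_scale: "\<omega> \<in> forms \<Longrightarrow> Fscale a \<omega> \<in> forms"
  using Fs.subspace_0 Fs.subspace_add Fs.subspace_diff Fs.subspace_scale forms_subspace by metis+

lemma forms_insert: "\<omega> \<in> forms \<Longrightarrow> V \<in> \<gg> \<Longrightarrow> insert_vf V \<omega> \<in> forms"
  by (intro formsI) (simp_all add: insert_vf_def forms_smooth alt_forms_Cons forms_alt)

lemma insert_linear:
  assumes "\<omega> \<in> forms" "V \<in> \<gg>" "W \<in> \<gg>"
  shows "insert_vf (scale_vf a V + scale_vf b W) \<omega> = Fscale a (insert_vf V \<omega>) + Fscale b (insert_vf W \<omega>)"
proof (intro ext)
  fix x R
  show "insert_vf (scale_vf a V + scale_vf b W) \<omega> x R = (Fscale a (insert_vf V \<omega>) + Fscale b (insert_vf W \<omega>)) x R"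
    using assms alt_linear_Cons[OF forms_alt[OF assms(1)]] alt_outside[OF forms_alt[OF assms(1)]]
    by (cases "set R \<subseteq> \<gg>") auto
qed

lemma insert_lin_comb: "insert_vf V (Fscale a \<omega> + Fscale b \<eta>) = Fscale a (insert_vf V \<omega>) + Fscale b (insert_vf V \<eta>)"
  by (simp add: fun_eq_iff)

lemma insert_insert_self:
  assumes "\<omega> \<in> forms"
  shows "insert_vf V (insert_vf V \<omega>) = 0"
  using alt_not_distinct[OF forms_alt[OF assms]] by (simp add: fun_eq_iff)

section \<open>Lie derivatives and Cartan's calculus on forms\<close>

lemma lie_deriv_at_smooth:
  assumes "\<omega> \<in> forms" "V \<in> \<gg>" "set R \<subseteq> \<gg>"
  shows "lie_deriv_at V R \<omega> \<in> smooth_functions \<A>"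
  using assms
proof (induction R arbitrary: \<omega>)
  case Nil
  then show "lie_deriv_at V [] \<omega> \<in> smooth_functions \<A>"
    by (simp add: lie_algebra_smooth forms_smooth)
next
  case (Cons U R)
  then show "lie_deriv_at V (U # R) \<omega> \<in> smooth_functions \<A>"
    unfolding lie_deriv_at.simps
    by (intro smooth_diff forms_smooth Cons.IH forms_insert) auto
qed

lemma lie_deriv_at_lin_comb:
  assumes "\<omega> \<in> forms" "\<eta> \<in> forms" "V \<in> \<gg>" "set R \<subseteq> \<gg>"
  shows "lie_deriv_at V R (Fscale a \<omega> + Fscale b \<eta>) = (\<lambda>x. a * lie_deriv_at V R \<omega> x + b * lie_deriv_at V R \<eta> x)"
  using assms
proof (induction R arbitrary: \<omega> \<eta>)
  case Nil
  then show "lie_deriv_at V [] (Fscale a \<omega> + Fscale b \<eta>) =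
      (\<lambda>x. a * lie_deriv_at V [] \<omega> x + b * lie_deriv_at V [] \<eta> x)"
    by (simp add: lie_algebra_linear[OF \<open>V \<in> \<gg>\<close>] forms_smooth)
next
  case (Cons U R)
  then have "lie_deriv_at V R (insert_vf U (Fscale a \<omega> + Fscale b \<eta>)) =
      (\<lambda>x. a * lie_deriv_at V R (insert_vf U \<omega>) x + b * lie_deriv_at V R (insert_vf U \<eta>) x)"
    unfolding insert_lin_comb by (intro Cons.IH forms_insert) auto
  then show "lie_deriv_at V (U # R) (Fscale a \<omega> + Fscale b \<eta>) =
      (\<lambda>x. a * lie_deriv_at V (U # R) \<omega> x + b * lie_deriv_at V (U # R) \<eta> x)"
    by (simp add: algebra_simps)
qed

lemma lie_deriv_at_zero:
  assumes "V \<in> \<gg>" "set R \<subseteq> \<gg>"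
  shows "lie_deriv_at V R 0 = (\<lambda>_. 0)"
  using lie_deriv_at_lin_comb[OF forms_0 forms_0 assms, of 0 0] by (simp add: fun_eq_iff)

lemma lie_deriv_at_linear:
  assumes "\<omega> \<in> forms" "V \<in> \<gg>" "W \<in> \<gg>" "set R \<subseteq> \<gg>"
  shows "lie_deriv_at (scale_vf a V + scale_vf b W) R \<omega> = (\<lambda>x. a * lie_deriv_at V R \<omega> x + b * lie_deriv_at W R \<omega> x)"
  using assms
proof (induction R arbitrary: \<omega>)
  case Nil
  then show ?case by (simp add: fun_eq_iff scale_vf_def)
next
  case (Cons U R)
  have "lie_deriv_at (scale_vf a V + scale_vf b W) R (insert_vf U \<omega>) =
      (\<lambda>x. a * lie_deriv_at V R (insert_vf U \<omega>) x + b * lie_deriv_at W R (insert_vf U \<omega>) x)"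
    using Cons.prems by (intro Cons.IH forms_insert) auto
  moreover have "\<omega> x (lie_bracket (scale_vf a V + scale_vf b W) U # R) =
      a * \<omega> x (lie_bracket V U # R) + b * \<omega> x (lie_bracket W U # R)" for x
    using Cons.prems alt_linear_Cons[OF forms_alt[OF Cons.prems(1)], of R "lie_bracket V U" "lie_bracket W U"]
    by (simp add: lie_bracket_linear_left lie_bracket_closed)
  ultimately show "lie_deriv_at (scale_vf a V + scale_vf b W) (U # R) \<omega> =
      (\<lambda>x. a * lie_deriv_at V (U # R) \<omega> x + b * lie_deriv_at W (U # R) \<omega> x)"
    by (simp add: algebra_simps)
qed

definition lie_deriv ::
    "'g vfield \<Rightarrow> ('g \<Rightarrow> 'g vfield list \<Rightarrow> real) \<Rightarrow> 'g \<Rightarrow> 'g vfield list \<Rightarrow> real" where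
  "lie_deriv V \<omega> = (\<lambda>x Vs. if set Vs \<subseteq> \<gg> then lie_deriv_at V Vs \<omega> x else 0)"

lemma insert_lie_deriv:
  assumes "\<omega> \<in> forms" "V \<in> \<gg>" "U \<in> \<gg>"
  shows "insert_vf U (lie_deriv V \<omega>) = lie_deriv V (insert_vf U \<omega>) - insert_vf (lie_bracket V U) \<omega>"
  using assms alt_outside[OF forms_alt[OF assms(1)]]
  by (auto simp: fun_eq_iff lie_deriv_def)

lemma lie_deriv_lin_comb:
  "\<omega> \<in> forms \<Longrightarrow> \<eta> \<in> forms \<Longrightarrow> V \<in> \<gg> \<Longrightarrow>
    lie_deriv V (Fscale a \<omega> + Fscale b \<eta>) = Fscale a (lie_deriv V \<omega>) + Fscale b (lie_deriv V \<eta>)"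
  by (auto simp: fun_eq_iff lie_deriv_def lie_deriv_at_lin_comb)

lemma lie_deriv_diff:
  "\<omega> \<in> forms \<Longrightarrow> \<eta> \<in> forms \<Longrightarrow> V \<in> \<gg> \<Longrightarrow> lie_deriv V (\<omega> - \<eta>) = lie_deriv V \<omega> - lie_deriv V \<eta>"
  using lie_deriv_lin_comb[of \<omega> \<eta> V 1 "-1"] by simp

lemma lie_deriv_forms:
  assumes "\<omega> \<in> forms" "V \<in> \<gg>"
  shows "lie_deriv V \<omega> \<in> forms"
proof (rule formsI)
  fix x
  have "\<omega> \<in> forms \<Longrightarrow> degree_part k (lie_deriv V \<omega> x) \<in> alt_forms" for k \<omega>
  proof (induction k arbitrary: \<omega>)
    case 0
    show ?case by (auto simp: alt_forms_def degree_part_def)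
  next
    case (Suc k)
    note \<omega> = \<open>\<omega> \<in> forms\<close>
    show ?case
    proof (rule degree_part_SucI)
      fix R U W a b assume h: "U \<in> \<gg>" "W \<in> \<gg>" "set R \<subseteq> \<gg>"
      show "lie_deriv V \<omega> x ((scale_vf a U + scale_vf b W) # R) =
          a * lie_deriv V \<omega> x (U # R) + b * lie_deriv V \<omega> x (W # R)"
        using h assms(2) \<omega> lin_comb_closed[OF h(1,2)]
          alt_linear_Cons[OF forms_alt[OF \<omega>], of R "lie_bracket V U" "lie_bracket V W"]
        by (simp add: lie_deriv_def insert_linear lie_deriv_at_lin_comb forms_insert
            lie_bracket_linear_right lie_bracket_closed algebra_simps)
    next
      fix R U assume h: "U \<in> \<gg>" "set R \<subseteq> \<gg>"
      \<comment> \<open>Two steps of the recursion leave \<open>\<omega>([V,U],U,R)\<close> and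
        \<open>\<omega>(U,[V,U],R)\<close>, which cancel by antisymmetry, besides a term with
        \<open>\<iota>\<^sub>U \<iota>\<^sub>U \<omega> = 0\<close>.\<close>
      show "lie_deriv V \<omega> x (U # U # R) = 0"
        using h assms(2) alt_swap[OF forms_alt[OF \<omega>], of U "lie_bracket V U" R x]
        by (simp add: lie_deriv_def insert_insert_self[OF \<omega>] lie_deriv_at_zero lie_bracket_closed)
    next
      fix U assume U: "U \<in> \<gg>"
      have "degree_part k (\<lambda>R. lie_deriv V \<omega> x (U # R)) =
          degree_part k (lie_deriv V (insert_vf U \<omega>) x) - degree_part k (insert_vf (lie_bracket V U) \<omega> x)"
        using fun_cong[OF insert_lie_deriv[OF \<omega> assms(2) U], of x]
        by (auto simp: fun_eq_iff degree_part_def)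
      also have "\<dots> \<in> alt_forms"
        using \<omega> U assms(2)
        by (intro fs.subspace_diff alt_forms_subspace Suc.IH degree_part_alt forms_alt forms_insert lie_bracket_closed)
      finally show "degree_part k (\<lambda>R. lie_deriv V \<omega> x (U # R)) \<in> alt_forms" .
    qed (simp add: lie_deriv_def)
  qed
  then show "lie_deriv V \<omega> x \<in> alt_forms"
    using assms alt_forms_by_degree by blast
next
  fix Vs assume "set Vs \<subseteq> \<gg>"
  then show "(\<lambda>x. lie_deriv V \<omega> x Vs) \<in> smooth_functions \<A>"
    using lie_deriv_at_smooth[OF assms] by (simp add: lie_deriv_def)
qed

text \<open>Bringing the bracket from position j to the front produces the sign. The sum matches the
  terms of \<open>ext_d\<close> that involve the first argument.\<close>

lemma lie_deriv_at_sum: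
  assumes "\<omega> \<in> forms" "V \<in> \<gg>" "set R \<subseteq> \<gg>"
  shows "lie_deriv_at V R \<omega> x = V (\<lambda>y. \<omega> y R) x -
    (\<Sum>j<length R. (- 1) ^ j * \<omega> x (lie_bracket V (R ! j) # nths R (- {j})))"
  using assms
proof (induction R arbitrary: \<omega>)
  case (Cons U R)
  have sw: "\<omega> x (U # lie_bracket V (R ! j) # nths R (- {j})) =
      - \<omega> x (lie_bracket V (R ! j) # U # nths R (- {j}))" if "j < length R" for j
    using Cons.prems that set_nths_subset[of R "- {j}"] nth_mem[OF that]
    by (intro alt_swap forms_alt lie_bracket_closed) auto
  have "(\<Sum>j<length R. (- 1) ^ j * \<omega> x (U # lie_bracket V (R ! j) # nths R (- {j}))) =
      (\<Sum>j<length R. - ((- 1) ^ j * \<omega> x (lie_bracket V (R ! j) # U # nths R (- {j}))))"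
    by (intro sum.cong) (auto simp: sw)
  moreover have "lie_deriv_at V R (insert_vf U \<omega>) x = V (\<lambda>y. insert_vf U \<omega> y R) x -
      (\<Sum>j<length R. (- 1) ^ j * insert_vf U \<omega> x (lie_bracket V (R ! j) # nths R (- {j})))"
    using Cons.prems by (intro Cons.IH forms_insert) auto
  ultimately show "lie_deriv_at V (U # R) \<omega> x = V (\<lambda>y. \<omega> y (U # R)) x -
      (\<Sum>j<length (U # R). (- 1) ^ j * \<omega> x (lie_bracket V ((U # R) ! j) # nths (U # R) (- {j})))"
    by (simp add: sum.lessThan_Suc_shift nths_Cons nths_all Collect_neg_eq sum_negf del: sum.lessThan_Suc)
qed simp

text \<open>In the invariant formula, the terms that use V as derivation or inside a bracket form
  the Lie derivative. In all others V stays an argument; shifting positions by one, or swapping V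
  with the bracket, turns these into the negative of
  \<open>ext_d (insert_vf V \<omega>)\<close>.\<close>

lemma ext_d_eq_cartan_d:
  assumes "\<omega> \<in> forms"
  shows "ext_d \<omega> x Vs = (if set Vs \<subseteq> \<gg> then cartan_d Vs \<omega> x else 0)"
  using assms
proof (induction Vs arbitrary: \<omega>)
  case Nil
  then show ?case by (simp add: ext_d_def)
next
  case (Cons V R)
  show ?case
  proof (cases "set (V # R) \<subseteq> \<gg>")
    case True
    have sw: "\<omega> x (V # lie_bracket (R ! i) (R ! j) # nths R (- {i, j})) =
        - \<omega> x (lie_bracket (R ! i) (R ! j) # V # nths R (- {i, j}))" if "i < j" "j < length R" for i j
      using Cons.prems that set_nths_subset[of R "- {i, j}"] True nth_mem[of _ R]
      by (intro alt_swap forms_alt lie_bracket_closed) auto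
    have "ext_d (insert_vf V \<omega>) x R =
        (\<Sum>i<length R. (- 1) ^ i * (R ! i) (\<lambda>y. \<omega> y (V # nths R (- {i}))) x)
      + (\<Sum>j<length R. \<Sum>i<j. (- 1) ^ (i + j) * \<omega> x (V # lie_bracket (R ! i) (R ! j) # nths R (- {i, j})))"
      using True by (simp add: ext_d_def)
    also have "(\<Sum>j<length R. \<Sum>i<j. (- 1) ^ (i + j) * \<omega> x (V # lie_bracket (R ! i) (R ! j) # nths R (- {i, j})))
      = (\<Sum>j<length R. \<Sum>i<j. - ((- 1) ^ (i + j) * \<omega> x (lie_bracket (R ! i) (R ! j) # V # nths R (- {i, j}))))"
      by (intro sum.cong refl) (simp add: sw)
    finally have IH': "cartan_d R (insert_vf V \<omega>) x =
        (\<Sum>i<length R. (- 1) ^ i * (R ! i) (\<lambda>y. \<omega> y (V # nths R (- {i}))) x)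
      - (\<Sum>j<length R. \<Sum>i<j. (- 1) ^ (i + j) * \<omega> x (lie_bracket (R ! i) (R ! j) # V # nths R (- {i, j})))"
      using Cons.IH[OF forms_insert[OF Cons.prems], of V] True by (simp add: sum_negf)
    have s1: "(\<Sum>i<length (V # R). (- 1) ^ i * ((V # R) ! i) (\<lambda>y. \<omega> y (nths (V # R) (- {i}))) x) =
        V (\<lambda>y. \<omega> y R) x - (\<Sum>i<length R. (- 1) ^ i * (R ! i) (\<lambda>y. \<omega> y (V # nths R (- {i}))) x)"
      by (simp add: sum.lessThan_Suc_shift nths_Cons nths_all sum_negf Collect_neg_eq del: sum.lessThan_Suc)
    have pair: "{j. j \<noteq> i \<and> j \<noteq> k} = - {i, k}" and single: "{j. j \<noteq> k} = - {k}" for i k :: nat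
      by auto
    have "(\<Sum>j<length (V # R). \<Sum>i<j. (- 1) ^ (i + j) *
          \<omega> x (lie_bracket ((V # R) ! i) ((V # R) ! j) # nths (V # R) (- {i, j}))) =
        (\<Sum>j<length R. \<Sum>i<Suc j. (- 1) ^ (i + Suc j) *
          \<omega> x (lie_bracket ((V # R) ! i) (R ! j) # nths (V # R) (- {i, Suc j})))"
      by (simp add: sum.lessThan_Suc_shift del: sum.lessThan_Suc)
    also have "\<dots> = (\<Sum>j<length R. - ((- 1) ^ j * \<omega> x (lie_bracket V (R ! j) # nths R (- {j}))) +
        (\<Sum>i<j. (- 1) ^ (i + j) * \<omega> x (lie_bracket (R ! i) (R ! j) # V # nths R (- {i, j}))))"
      by (intro sum.cong refl, subst sum.lessThan_Suc_shift)
        (simp add: nths_Cons pair single del: sum.lessThan_Suc)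
    also have "\<dots> = - (\<Sum>j<length R. (- 1) ^ j * \<omega> x (lie_bracket V (R ! j) # nths R (- {j}))) +
        (\<Sum>j<length R. \<Sum>i<j. (- 1) ^ (i + j) * \<omega> x (lie_bracket (R ! i) (R ! j) # V # nths R (- {i, j})))"
      by (simp add: sum.distrib sum_negf sum_subtractf)
    finally have s2: "(\<Sum>j<length (V # R). \<Sum>i<j. (- 1) ^ (i + j) *
          \<omega> x (lie_bracket ((V # R) ! i) ((V # R) ! j) # nths (V # R) (- {i, j}))) =
        - (\<Sum>j<length R. (- 1) ^ j * \<omega> x (lie_bracket V (R ! j) # nths R (- {j}))) +
        (\<Sum>j<length R. \<Sum>i<j. (- 1) ^ (i + j) * \<omega> x (lie_bracket (R ! i) (R ! j) # V # nths R (- {i, j})))" .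
    have "ext_d \<omega> x (V # R) = cartan_d (V # R) \<omega> x"
      unfolding ext_d_def s1 s2
      using True IH' lie_deriv_at_sum[OF Cons.prems, of V R x] by simp
    with True show "ext_d \<omega> x (V # R) = (if set (V # R) \<subseteq> \<gg> then cartan_d (V # R) \<omega> x else 0)"
      by simp
  next
    case False
    then have "ext_d \<omega> x (V # R) = 0"
      by (simp only: ext_d_def if_False)
    with False show "ext_d \<omega> x (V # R) = (if set (V # R) \<subseteq> \<gg> then cartan_d (V # R) \<omega> x else 0)"
      by (simp only: if_False)
  qed
qed

text \<open>Cartan's formula, by which contractions are moved past \<open>ext_d\<close> in the
  inductions below.\<close>

lemma insert_ext_d:
  assumes "\<omega> \<in> forms" "V \<in> \<gg>"
  shows "insert_vf V (ext_d \<omega>) = lie_deriv V \<omega> - ext_d (insert_vf V \<omega>)"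
  using assms by (auto simp: fun_eq_iff ext_d_eq_cartan_d forms_insert lie_deriv_def)

lemma cartan_d_lin_comb:
  assumes "\<omega> \<in> forms" "\<eta> \<in> forms" "set R \<subseteq> \<gg>"
  shows "cartan_d R (Fscale a \<omega> + Fscale b \<eta>) x = a * cartan_d R \<omega> x + b * cartan_d R \<eta> x"
  using assms
proof (induction R arbitrary: \<omega> \<eta>)
  case (Cons V R)
  have "cartan_d R (insert_vf V (Fscale a \<omega> + Fscale b \<eta>)) x =
      a * cartan_d R (insert_vf V \<omega>) x + b * cartan_d R (insert_vf V \<eta>) x"
    unfolding insert_lin_comb using Cons.prems by (intro Cons.IH forms_insert) auto
  moreover have "lie_deriv_at V R (Fscale a \<omega> + Fscale b \<eta>) x =
      a * lie_deriv_at V R \<omega> x + b * lie_deriv_at V R \<eta> x"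
    using Cons.prems by (subst lie_deriv_at_lin_comb) auto
  ultimately show "cartan_d (V # R) (Fscale a \<omega> + Fscale b \<eta>) x =
      a * cartan_d (V # R) \<omega> x + b * cartan_d (V # R) \<eta> x"
    by (simp add: algebra_simps)
qed simp

lemma ext_d_lin_comb:
  assumes "\<omega> \<in> forms" "\<eta> \<in> forms"
  shows "ext_d (Fscale a \<omega> + Fscale b \<eta>) = Fscale a (ext_d \<omega>) + Fscale b (ext_d \<eta>)"
proof (intro ext)
  fix x Vs
  have "Fscale a \<omega> + Fscale b \<eta> \<in> forms"
    using assms by (intro forms_add forms_scale)
  then show "ext_d (Fscale a \<omega> + Fscale b \<eta>) x Vs = (Fscale a (ext_d \<omega>) + Fscale b (ext_d \<eta>)) x Vs"
    using assms by (simp add: ext_d_eq_cartan_d cartan_d_lin_comb)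
qed

lemma cartan_d_smooth:
  assumes "\<omega> \<in> forms" "set R \<subseteq> \<gg>"
  shows "cartan_d R \<omega> \<in> smooth_functions \<A>"
  using assms
proof (induction R arbitrary: \<omega>)
  case (Cons V R)
  then show "cartan_d (V # R) \<omega> \<in> smooth_functions \<A>"
    unfolding cartan_d.simps
    by (intro smooth_diff lie_deriv_at_smooth Cons.IH forms_insert) auto
qed (simp add: smooth_const)

lemma ext_d_zero: "ext_d 0 = 0"
  using ext_d_lin_comb[OF forms_0 forms_0, of 0 0] by simp

lemma ext_d_forms:
  assumes "\<omega> \<in> forms"
  shows "ext_d \<omega> \<in> forms"
proof (rule formsI)
  fix x
  have "\<omega> \<in> forms \<Longrightarrow> degree_part k (ext_d \<omega> x) \<in> alt_forms" for k \<omega>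
  proof (induction k arbitrary: \<omega>)
    case 0
    show ?case by (auto simp: alt_forms_def degree_part_def)
  next
    case (Suc k)
    note \<omega> = \<open>\<omega> \<in> forms\<close>
    show ?case
    proof (rule degree_part_SucI)
      fix R V W a b assume h: "V \<in> \<gg>" "W \<in> \<gg>" "set R \<subseteq> \<gg>"
      show "ext_d \<omega> x ((scale_vf a V + scale_vf b W) # R) =
          a * ext_d \<omega> x (V # R) + b * ext_d \<omega> x (W # R)"
        using h \<omega> lin_comb_closed[OF h(1,2), of a b]
        by (simp add: ext_d_eq_cartan_d insert_linear cartan_d_lin_comb forms_insert
            lie_deriv_at_linear algebra_simps)
    next
      fix R V assume h: "V \<in> \<gg>" "set R \<subseteq> \<gg>"
      have "cartan_d R 0 x = 0"
        using cartan_d_lin_comb[OF forms_0 forms_0 h(2), of 0 0] by simp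
      \<comment> \<open>Unfolding Cartan's recursion twice, the two copies of
        \<open>L\<^sub>V (\<iota>\<^sub>V \<omega>)\<close> cancel; what remains contains
        \<open>[V,V] = 0\<close> or
        \<open>\<iota>\<^sub>V \<iota>\<^sub>V \<omega> = 0\<close>.\<close>
      then show "ext_d \<omega> x (V # V # R) = 0"
        using h by (simp add: ext_d_eq_cartan_d[OF \<omega>] insert_insert_self[OF \<omega>] lie_bracket_self
            alt_zero_Cons[OF forms_alt[OF \<omega>]])
    next
      fix V assume V: "V \<in> \<gg>"
      have "degree_part k (\<lambda>R. ext_d \<omega> x (V # R)) =
          degree_part k (lie_deriv V \<omega> x) - degree_part k (ext_d (insert_vf V \<omega>) x)"
        using fun_cong[OF insert_ext_d[OF \<omega> V], of x]
        by (auto simp: fun_eq_iff degree_part_def)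
      also have "\<dots> \<in> alt_forms"
        using \<omega> V
        by (intro fs.subspace_diff alt_forms_subspace Suc.IH degree_part_alt forms_alt forms_insert lie_deriv_forms)
      finally show "degree_part k (\<lambda>R. ext_d \<omega> x (V # R)) \<in> alt_forms" .
    qed (simp add: ext_d_def)
  qed
  then show "ext_d \<omega> x \<in> alt_forms"
    using assms alt_forms_by_degree by blast
next
  fix Vs assume "set Vs \<subseteq> \<gg>"
  then show "(\<lambda>x. ext_d \<omega> x Vs) \<in> smooth_functions \<A>"
    using cartan_d_smooth[OF assms] by (simp add: ext_d_eq_cartan_d[OF assms])
qed

lemma form_cong:
  assumes "\<omega> \<in> forms" "\<eta> \<in> forms" "\<And>x Vs. set Vs \<subseteq> \<gg> \<Longrightarrow> \<omega> x Vs = \<eta> x Vs"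
  shows "\<omega> = \<eta>"
  using alt_form_cong[OF forms_alt[OF assms(1)] forms_alt[OF assms(2)] assms(3)] by blast

lemma insert_diff: "insert_vf U (\<omega> - \<eta>) = insert_vf U \<omega> - insert_vf U \<eta>"
  by (simp add: fun_eq_iff)

text \<open>On functions this is the definition of the bracket. Contracting with U reproduces the
  claim for \<open>insert_vf U \<omega>\<close>, with an error term made of double brackets that the
  Jacobi identity matches on both sides.\<close>

lemma lie_deriv_commutator:
  assumes "\<omega> \<in> forms" "V \<in> \<gg>" "W \<in> \<gg>"
  shows "lie_deriv V (lie_deriv W \<omega>) - lie_deriv W (lie_deriv V \<omega>) = lie_deriv (lie_bracket V W) \<omega>"
proof (rule form_cong)
  note cl = lie_bracket_closed
  fix x Vs assume "set Vs \<subseteq> \<gg>"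
  then show "(lie_deriv V (lie_deriv W \<omega>) - lie_deriv W (lie_deriv V \<omega>)) x Vs =
      lie_deriv (lie_bracket V W) \<omega> x Vs"
    using assms(1)
  proof (induction Vs arbitrary: \<omega>)
    case Nil
    then show ?case by (simp add: lie_deriv_def lie_bracket_apply)
  next
    case (Cons U R)
    then have U: "U \<in> \<gg>" and R: "set R \<subseteq> \<gg>" and \<omega>: "\<omega> \<in> forms" by auto
    have exp: "insert_vf U (lie_deriv A (lie_deriv B \<omega>)) =
        lie_deriv A (lie_deriv B (insert_vf U \<omega>)) - lie_deriv A (insert_vf (lie_bracket B U) \<omega>)
        - (lie_deriv B (insert_vf (lie_bracket A U) \<omega>) - insert_vf (lie_bracket B (lie_bracket A U)) \<omega>)"
      if "A \<in> \<gg>" "B \<in> \<gg>" for A B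
      using that U \<omega> by (simp add: insert_lie_deriv lie_deriv_forms forms_insert cl lie_deriv_diff)
    have jac: "insert_vf (lie_bracket (lie_bracket V W) U) \<omega> =
        insert_vf (lie_bracket V (lie_bracket W U)) \<omega> - insert_vf (lie_bracket W (lie_bracket V U)) \<omega>"
      unfolding Jacobi[OF assms(2,3) U]
        insert_linear[OF \<omega> cl[OF assms(2) cl[OF assms(3) U]] cl[OF assms(3) cl[OF assms(2) U]]]
      by simp
    have "insert_vf U (lie_deriv V (lie_deriv W \<omega>) - lie_deriv W (lie_deriv V \<omega>)) x R =
        (lie_deriv V (lie_deriv W (insert_vf U \<omega>)) - lie_deriv W (lie_deriv V (insert_vf U \<omega>))) x R
        - insert_vf (lie_bracket (lie_bracket V W) U) \<omega> x R"
      unfolding insert_diff exp[OF assms(2,3)] exp[OF assms(3,2)] jac by simp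
    also have "\<dots> = lie_deriv (lie_bracket V W) (insert_vf U \<omega>) x R
        - insert_vf (lie_bracket (lie_bracket V W) U) \<omega> x R"
      using R U \<omega> by (subst Cons.IH) (auto intro: forms_insert)
    also have "\<dots> = insert_vf U (lie_deriv (lie_bracket V W) \<omega>) x R"
      using assms U \<omega> by (simp only: insert_lie_deriv cl) simp
    finally show "(lie_deriv V (lie_deriv W \<omega>) - lie_deriv W (lie_deriv V \<omega>)) x (U # R) =
        lie_deriv (lie_bracket V W) \<omega> x (U # R)"
      by simp
  qed
qed (simp_all add: assms forms_diff lie_deriv_forms lie_bracket_closed)

lemma ext_d_diff: "\<omega> \<in> forms \<Longrightarrow> \<eta> \<in> forms \<Longrightarrow> ext_d (\<omega> - \<eta>) = ext_d \<omega> - ext_d \<eta>"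
  using ext_d_lin_comb[of \<omega> \<eta> 1 "-1"] by simp

lemma ext_d_Nil: "ext_d \<omega> x [] = 0"
  by (simp add: ext_d_def)

lemma lie_deriv_ext_d:
  assumes "\<omega> \<in> forms" "V \<in> \<gg>"
  shows "lie_deriv V (ext_d \<omega>) = ext_d (lie_deriv V \<omega>)"
proof (rule form_cong)
  note cl = lie_bracket_closed
  fix x Vs assume "set Vs \<subseteq> \<gg>"
  then show "lie_deriv V (ext_d \<omega>) x Vs = ext_d (lie_deriv V \<omega>) x Vs"
    using assms(1)
  proof (induction Vs arbitrary: \<omega>)
    case Nil
    then show ?case using assms(2) by (simp add: lie_deriv_def ext_d_Nil lie_algebra_const)
  next
    case (Cons W R)
    then have W: "W \<in> \<gg>" and R: "set R \<subseteq> \<gg>" and \<omega>: "\<omega> \<in> forms" by auto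
    have 1: "insert_vf W (lie_deriv V (ext_d \<omega>)) =
        lie_deriv V (lie_deriv W \<omega>) - lie_deriv V (ext_d (insert_vf W \<omega>))
        - (lie_deriv (lie_bracket V W) \<omega> - ext_d (insert_vf (lie_bracket V W) \<omega>))"
      using W \<omega> assms(2)
      by (simp add: insert_lie_deriv insert_ext_d lie_deriv_forms ext_d_forms forms_insert cl lie_deriv_diff)
    have 2: "insert_vf W (ext_d (lie_deriv V \<omega>)) =
        lie_deriv W (lie_deriv V \<omega>) - (ext_d (lie_deriv V (insert_vf W \<omega>)) - ext_d (insert_vf (lie_bracket V W) \<omega>))"
      using W \<omega> assms(2)
      by (simp add: insert_lie_deriv insert_ext_d lie_deriv_forms ext_d_forms forms_insert cl ext_d_diff)
    have 3: "lie_deriv V (ext_d (insert_vf W \<omega>)) x R = ext_d (lie_deriv V (insert_vf W \<omega>)) x R"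
      using R W \<omega> by (intro Cons.IH forms_insert) auto
    have "insert_vf W (lie_deriv V (ext_d \<omega>)) x R = insert_vf W (ext_d (lie_deriv V \<omega>)) x R"
      unfolding 1 2 using 3 lie_deriv_commutator[OF \<omega> assms(2) W, symmetric] by simp
    then show "lie_deriv V (ext_d \<omega>) x (W # R) = ext_d (lie_deriv V \<omega>) x (W # R)"
      by simp
  qed
qed (simp_all add: assms ext_d_forms lie_deriv_forms)

text \<open>Cartan's formula used twice, with \<open>L\<^sub>V d = d L\<^sub>V\<close>, gives
  \<open>\<iota>\<^sub>V d d = d d \<iota>\<^sub>V\<close>, so contraction shortens the list until a
  function is left.\<close>

lemma ext_d_ext_d:
  assumes "\<omega> \<in> forms"
  shows "ext_d (ext_d \<omega>) = 0"
proof (rule form_cong)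
  fix x Vs assume "set Vs \<subseteq> \<gg>"
  then show "ext_d (ext_d \<omega>) x Vs = 0 x Vs"
    using assms
  proof (induction Vs arbitrary: \<omega>)
    case Nil
    then show ?case by (simp add: ext_d_Nil)
  next
    case (Cons V R)
    then have V: "V \<in> \<gg>" and R: "set R \<subseteq> \<gg>" and \<omega>: "\<omega> \<in> forms" by auto
    have "insert_vf V (ext_d (ext_d \<omega>)) = ext_d (ext_d (insert_vf V \<omega>))"
      using V \<omega>
      by (simp add: insert_ext_d lie_deriv_forms ext_d_forms forms_insert ext_d_diff lie_deriv_ext_d)
    then have "ext_d (ext_d \<omega>) x (V # R) = ext_d (ext_d (insert_vf V \<omega>)) x R"
      by (metis insert_vf_apply)
    also have "\<dots> = 0 x R"
      using R V \<omega> by (intro Cons.IH forms_insert) auto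
    finally show "ext_d (ext_d \<omega>) x (V # R) = 0 x (V # R)" by simp
  qed
qed (simp_all add: assms ext_d_forms forms_0)

lemma ext_d_lin_op: "Fs.lin_op forms ext_d"
  unfolding Fs.lin_op_def
proof (intro conjI ballI allI ext_d_forms)
  fix \<omega> \<eta> a assume f: "\<omega> \<in> forms" "\<eta> \<in> forms"
  show "ext_d (\<omega> + \<eta>) = ext_d \<omega> + ext_d \<eta>"
    using ext_d_lin_comb[OF f, of 1 1] by simp
next
  fix \<omega> a assume f: "\<omega> \<in> forms"
  show "ext_d (Fscale a \<omega>) = Fscale a (ext_d \<omega>)"
    using ext_d_lin_comb[OF f f, of a 0] by simp
qed

end


section \<open>Algebraic operators\<close>

context homogeneous_group
begin

text \<open>Reordering arguments only changes a sign; asking for vanishing alone avoids computing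
  it.\<close>

lemma alt_eq_0_if_mset_eq:
  assumes "\<alpha> \<in> alt_forms" "mset Vs = mset Ws" "set Vs \<subseteq> \<gg>" "\<alpha> Ws = 0"
  shows "\<alpha> Vs = 0"
  using assms
proof (induction Vs arbitrary: \<alpha> Ws)
  case (Cons V Vs)
  then have "V \<in> set Ws" by (metis list.set_intros(1) set_mset_mset)
  then obtain As Bs where Ws: "Ws = As @ V # Bs" by (auto simp: in_set_conv_decomp)
  have g: "set Ws \<subseteq> \<gg>" using Cons.prems by (metis set_mset_mset)
  have "(- 1) ^ length As * \<alpha> (V # As @ Bs) = 0"
    using alt_move_front[OF Cons.prems(1), of V As Bs] Cons.prems g by (simp add: Ws)
  then have "\<alpha> (V # As @ Bs) = 0" by simp
  then show ?case
    using Cons.prems Ws by (intro Cons.IH[of "\<lambda>R. \<alpha> (V # R)" "As @ Bs"] alt_forms_Cons) auto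
qed auto

text \<open>Arguments are traded for basis vectors one by one, from the right: the vectors V for
  which the value vanishes form a subspace that contains the basis.\<close>

lemma alt_eq_0_if_zero_on_basis:
  assumes \<alpha>: "\<alpha> \<in> alt_forms" and z: "\<And>is. set is \<subseteq> {1..n} \<Longrightarrow> \<alpha> (map X is) = 0"
  shows "\<alpha> = 0"
proof -
  have "\<alpha> (Vs @ map X is) = 0" if "set Vs \<subseteq> \<gg>" "set is \<subseteq> {1..n}" for Vs "is"
    using that
  proof (induction Vs arbitrary: "is" rule: rev_induct)
    case Nil
    then show ?case using z by simp
  next
    case (snoc V Vs)
    let ?S = "{V \<in> \<gg>. \<alpha> (Vs @ V # map X is) = 0}"
    have isg: "set (map X is) \<subseteq> \<gg>" using snoc.prems X_closed by auto
    have Vs: "set Vs \<subseteq> \<gg>" using snoc.prems by simp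
    note lin = alt_linear[OF \<alpha> Vs isg]
    have "vf.subspace ?S"
      unfolding vf.subspace_def
    proof (intro conjI ballI allI)
      have 0: "0 \<in> \<gg>" using vf.subspace_0[OF subspace_lie_algebra] .
      then show "0 \<in> ?S" using lin[of 0 0 0 0] by simp
      fix V W a assume "V \<in> ?S" "W \<in> ?S"
      then show "V + W \<in> ?S"
        using lin[of V W 1 1] vf.subspace_add[OF subspace_lie_algebra] by simp
    next
      fix V a assume "V \<in> ?S"
      then show "scale_vf a V \<in> ?S"
        using lin[of V V a 0] vf.subspace_scale[OF subspace_lie_algebra] by simp
    qed
    moreover have "X ` {1..n} \<subseteq> ?S"
    proof safe
      fix i assume "i \<in> {1..n}"
      then show "X i \<in> \<gg>" and "\<alpha> (Vs @ X i # map X is) = 0"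
        using snoc.IH[of "i # is"] snoc.prems X_closed by auto
    qed
    ultimately have "\<gg> \<subseteq> ?S"
      unfolding basis_span[symmetric] by (intro vf.span_minimal)
    then show ?case using snoc.prems by auto
  qed
  from this[of _ "[]"] show ?thesis
    using \<alpha> by (intro alt_form_cong) (auto simp: fs.subspace_0[OF alt_forms_subspace])
qed

lemma alt_eq_0_if_zero_on_increasing:
  assumes \<alpha>: "\<alpha> \<in> alt_forms"
    and z: "\<And>I. I \<in> Pow {1..n} \<Longrightarrow> \<alpha> (map X (sorted_list_of_set I)) = 0"
  shows "\<alpha> = 0"
proof (rule alt_eq_0_if_zero_on_basis[OF \<alpha>])
  fix "is" assume i: "set is \<subseteq> {1..n}"
  show "\<alpha> (map X is) = 0"
  proof (cases "distinct is")
    case True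
    then have "mset (sorted_list_of_set (set is)) = mset is"
      by (subst set_eq_iff_mset_eq_distinct[symmetric]) auto
    then have "mset (map X is) = mset (map X (sorted_list_of_set (set is)))"
      by (metis mset_map)
    moreover have "set (map X is) \<subseteq> \<gg>" using i X_closed by auto
    ultimately show ?thesis
      using z[of "set is"] i alt_eq_0_if_mset_eq[OF \<alpha>] by blast
  next
    case False
    then show ?thesis using alt_not_distinct[OF \<alpha>] by (simp add: distinct_map)
  qed
qed

end

sublocale homogeneous_group \<subseteq> ev: evaluation_space alt_forms "Pow {1..n}" "\<lambda>I. map X (sorted_list_of_set I)"
proof unfold_locales
  show "finite (Pow {1..n})" by simp
  show "fs.subspace alt_forms" by (rule alt_forms_subspace)
  show "f = 0" if "f \<in> alt_forms" "\<And>I. I \<in> Pow {1..n} \<Longrightarrow> f (map X (sorted_list_of_set I)) = 0" for f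
    using that by (rule alt_eq_0_if_zero_on_increasing)
qed

section \<open>Finite-dimensional Hodge theory of \<open>d0\<close>\<close>

context homogeneous_group
begin

lemma ip_eq_dot: "ip = ev.dot"
  by (intro ext) (simp only: ip_def ev.dot_def)

lemmas ip_commute = ev.dot_commute[folded ip_eq_dot]
lemmas ip_add_left = ev.dot_add_left[folded ip_eq_dot]
lemmas ip_add_right = ev.dot_add_right[folded ip_eq_dot]
lemmas ip_diff_left = ev.dot_diff_left[folded ip_eq_dot]
lemmas ip_scale_left = ev.dot_scale_left[folded ip_eq_dot]
lemmas ip_scale_right = ev.dot_scale_right[folded ip_eq_dot]
lemmas ip_self_nonneg = ev.dot_self_nonneg[folded ip_eq_dot]
lemmas ip_self_eq_0 = ev.dot_self_eq_0[folded ip_eq_dot]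
lemmas ip_eqI = ev.dot_eq_0_imp_eq[folded ip_eq_dot]
lemmas ip_zero_left [simp] = ev.dot_zero_left[folded ip_eq_dot]
lemmas ip_zero_right [simp] = ev.dot_zero_right[folded ip_eq_dot]

lemmas alt_0 = fs.subspace_0[OF alt_forms_subspace]
lemmas alt_add = fs.subspace_add[OF alt_forms_subspace]
lemmas alt_diff = fs.subspace_diff[OF alt_forms_subspace]
lemmas alt_scale = fs.subspace_scale[OF alt_forms_subspace]

lemma const_form: "\<alpha> \<in> alt_forms \<Longrightarrow> (\<lambda>_. \<alpha>) \<in> forms"
  by (simp add: forms_def smooth_const)

lemma ext_d_const: "ext_d (\<lambda>_. \<alpha>) = (\<lambda>_. d0 \<alpha>)"
proof (intro ext)
  fix x Vs
  have "(Vs ! i) (\<lambda>y. \<alpha> (nths Vs (- {i}))) z = 0" if "set Vs \<subseteq> \<gg>" "i < length Vs" for i z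
    using lie_algebra_const[of "Vs ! i"] that nth_mem[OF that(2)] by (simp add: subset_iff)
  then show "ext_d (\<lambda>_. \<alpha>) x Vs = d0 \<alpha> Vs"
    by (simp add: d0_def ext_d_def)
qed

lemma d0_lin_op: "fs.lin_op alt_forms d0"
  unfolding fs.lin_op_def
proof (intro conjI ballI allI)
  fix \<alpha> \<beta> a assume a: "\<alpha> \<in> alt_forms" "\<beta> \<in> alt_forms"
  have *: "Fscale a (\<lambda>_. \<alpha>) + Fscale b (\<lambda>_. \<beta>) = (\<lambda>_ :: 'g. fscale a \<alpha> + fscale b \<beta>)" for a b
    by (simp add: fun_eq_iff)
  have lin: "d0 (fscale a \<alpha> + fscale b \<beta>) = fscale a (d0 \<alpha>) + fscale b (d0 \<beta>)" for a b
    using ext_d_lin_comb[OF const_form[OF a(1)] const_form[OF a(2)], of a b]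
    unfolding * ext_d_const by (simp add: fun_eq_iff)
  show "d0 (\<alpha> + \<beta>) = d0 \<alpha> + d0 \<beta>" using lin[of 1 1] by simp
next
  fix \<alpha> a assume a: "\<alpha> \<in> alt_forms"
  show "d0 \<alpha> \<in> alt_forms"
    unfolding d0_def by (rule forms_alt[OF ext_d_forms[OF const_form[OF a]]])
  have *: "Fscale a (\<lambda>_. \<alpha>) + Fscale 0 (\<lambda>_. \<alpha>) = (\<lambda>_ :: 'g. fscale a \<alpha>)"
    by (simp add: fun_eq_iff)
  show "d0 (fscale a \<alpha>) = fscale a (d0 \<alpha>)"
    using ext_d_lin_comb[OF const_form[OF a] const_form[OF a], of a 0]
    unfolding * ext_d_const by (simp add: fun_eq_iff)
qed

lemmas d0_alt = fs.lin_op_mem[OF d0_lin_op]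
lemmas d0_add = fs.lin_op_add[OF d0_lin_op]
lemmas d0_scale = fs.lin_op_scale[OF d0_lin_op]
lemmas d0_0 = fs.lin_op_zero[OF d0_lin_op alt_forms_subspace]
lemmas d0_diff = fs.lin_op_diff[OF d0_lin_op alt_forms_subspace]

lemma d0_d0: "\<alpha> \<in> alt_forms \<Longrightarrow> d0 (d0 \<alpha>) = 0"
  using ext_d_ext_d[OF const_form, of \<alpha>] by (simp add: fun_eq_iff ext_d_const)

text \<open>\<open>ip\<close> is definite on \<open>alt_forms\<close>, so the description inside
  \<open>adjoint_op\<close> has at most one solution.\<close>

lemma d0t_unique:
  assumes "\<beta> \<in> alt_forms" "\<And>\<gamma>. \<gamma> \<in> alt_forms \<Longrightarrow> ip (d0 \<gamma>) \<alpha> = ip \<gamma> \<beta>"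
  shows "d0t \<alpha> = \<beta>"
  unfolding d0t_def adjoint_op_def
proof (rule the_equality)
  fix \<beta>' assume "\<beta>' \<in> alt_forms \<and> (\<forall>\<gamma>\<in>alt_forms. ip (d0 \<gamma>) \<alpha> = ip \<gamma> \<beta>')"
  then show "\<beta>' = \<beta>" using assms by (intro ip_eqI) (auto simp: ip_commute[of \<beta>] ip_commute[of \<beta>'])
qed (use assms in auto)

lemma d0t_alt: "d0t \<alpha> \<in> alt_forms"
  and d0t_adjoint: "\<gamma> \<in> alt_forms \<Longrightarrow> ip (d0 \<gamma>) \<alpha> = ip \<gamma> (d0t \<alpha>)"
proof -
  obtain \<beta> where b: "\<beta> \<in> alt_forms" "\<forall>\<gamma>\<in>alt_forms. ip (d0 \<gamma>) \<alpha> = ip \<gamma> \<beta>"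
    using ev.adjoint_exists[OF d0_lin_op, of \<alpha>, folded ip_eq_dot] by blast
  then have "d0t \<alpha> = \<beta>" by (intro d0t_unique) auto
  with b show "d0t \<alpha> \<in> alt_forms" "\<gamma> \<in> alt_forms \<Longrightarrow> ip (d0 \<gamma>) \<alpha> = ip \<gamma> (d0t \<alpha>)" by auto
qed

lemma d0t_lin_op: "fs.lin_op alt_forms d0t"
  unfolding fs.lin_op_def
proof (intro conjI ballI allI)
  fix \<alpha> \<beta> show "d0t (\<alpha> + \<beta>) = d0t \<alpha> + d0t \<beta>"
    by (intro d0t_unique alt_add d0t_alt) (simp add: ip_add_right d0t_adjoint)
next
  fix \<alpha> a show "d0t (fscale a \<alpha>) = fscale a (d0t \<alpha>)"
    by (intro d0t_unique alt_scale d0t_alt) (simp add: ip_scale_right d0t_adjoint)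
qed (rule d0t_alt)

lemma orth_proj_unique:
  assumes W: "fs.subspace W" "W \<subseteq> alt_forms"
    and \<beta>: "\<beta> \<in> W" "\<And>\<gamma>. \<gamma> \<in> W \<Longrightarrow> ip (\<alpha> - \<beta>) \<gamma> = 0"
  shows "orth_proj W \<alpha> = \<beta>"
  unfolding orth_proj_def
proof (rule the_equality)
  fix \<beta>' assume b': "\<beta>' \<in> W \<and> (\<forall>\<gamma>\<in>W. ip (\<alpha> - \<beta>') \<gamma> = 0)"
  then have m: "\<beta>' - \<beta> \<in> W" using fs.subspace_diff[OF W(1)] \<beta> by blast
  then have "ip (\<beta>' - \<beta>) (\<beta>' - \<beta>) = 0"
    using \<beta>(2)[OF m] b' by (simp add: ip_diff_left)
  then show "\<beta>' = \<beta>" using ip_self_eq_0[of "\<beta>' - \<beta>"] m W by auto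
qed (use \<beta> in auto)

lemma orth_proj_props:
  assumes W: "fs.subspace W" "W \<subseteq> alt_forms"
  shows "orth_proj W \<alpha> \<in> W" and "\<gamma> \<in> W \<Longrightarrow> ip (\<alpha> - orth_proj W \<alpha>) \<gamma> = 0"
proof -
  obtain \<beta> where b: "\<beta> \<in> W" "\<forall>\<gamma>\<in>W. ip (\<alpha> - \<beta>) \<gamma> = 0"
    using ev.orthogonal_projection_exists[OF W, folded ip_eq_dot] by blast
  then have "orth_proj W \<alpha> = \<beta>" by (intro orth_proj_unique[OF W]) auto
  with b show "orth_proj W \<alpha> \<in> W" "\<gamma> \<in> W \<Longrightarrow> ip (\<alpha> - orth_proj W \<alpha>) \<gamma> = 0" by auto
qed

text \<open>The space H of the overview, written as it occurs in \<open>d0inv\<close>.\<close>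

definition coexact :: "('g vfield list \<Rightarrow> real) set" where
  "coexact = {\<beta> \<in> alt_forms. \<forall>\<gamma>\<in>alt_forms. d0 \<gamma> = 0 \<longrightarrow> ip \<beta> \<gamma> = 0}"

lemma coexact_subspace: "fs.subspace coexact"
  by (auto simp: fs.subspace_def coexact_def alt_0 alt_add alt_scale ip_add_left ip_scale_left)

lemma coexact_alt: "\<beta> \<in> coexact \<Longrightarrow> \<beta> \<in> alt_forms"
  by (simp add: coexact_def)

lemma coexact_eq_0: "\<beta> \<in> coexact \<Longrightarrow> d0 \<beta> = 0 \<Longrightarrow> \<beta> = 0"
  using ip_self_eq_0 by (simp add: coexact_def)

lemma exact_subspace: "fs.subspace (d0 ` alt_forms)"
  unfolding fs.subspace_def
proof (intro conjI ballI allI)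
  show "0 \<in> d0 ` alt_forms" using d0_0 alt_0 by force
  fix x y assume "x \<in> d0 ` alt_forms" "y \<in> d0 ` alt_forms"
  then show "x + y \<in> d0 ` alt_forms" using d0_add[symmetric] alt_add by force
next
  fix x c assume "x \<in> d0 ` alt_forms"
  then show "fscale c x \<in> d0 ` alt_forms" using d0_scale[symmetric] alt_scale by force
qed

lemma exact_alt: "d0 ` alt_forms \<subseteq> alt_forms"
  using d0_alt by auto

text \<open>Subtracting from a form its projection onto the kernel of \<open>d0\<close> does not
  change its image.\<close>

lemma d0_image_coexact: "d0 ` coexact = d0 ` alt_forms"
proof (intro equalityI subsetI)
  fix x assume "x \<in> d0 ` alt_forms"
  then obtain \<gamma> where \<gamma>: "\<gamma> \<in> alt_forms" "x = d0 \<gamma>" by auto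
  let ?K = "{\<alpha> \<in> alt_forms. d0 \<alpha> = 0}"
  have K: "fs.subspace ?K" "?K \<subseteq> alt_forms"
    by (auto simp: fs.subspace_def alt_0 alt_add alt_scale d0_0 d0_add d0_scale)
  let ?p = "orth_proj ?K \<gamma>"
  have p: "?p \<in> ?K" "\<And>\<delta>. \<delta> \<in> ?K \<Longrightarrow> ip (\<gamma> - ?p) \<delta> = 0"
    using orth_proj_props[OF K] by blast+
  then have "\<gamma> - ?p \<in> coexact" using \<gamma> by (simp add: coexact_def alt_diff)
  moreover have "d0 (\<gamma> - ?p) = x" using \<gamma> p by (simp add: d0_diff)
  ultimately show "x \<in> d0 ` coexact" by blast
qed (auto dest: coexact_alt)

lemma inj_on_d0_coexact: "inj_on d0 coexact"
proof (rule inj_onI)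
  fix x y assume h: "x \<in> coexact" "y \<in> coexact" "d0 x = d0 y"
  then have "x - y \<in> coexact" using fs.subspace_diff[OF coexact_subspace] by blast
  moreover have "d0 (x - y) = 0" using h by (simp add: d0_diff coexact_alt)
  ultimately show "x = y" using coexact_eq_0[of "x - y"] by simp
qed

lemma d0inv_eq: "d0inv \<alpha> = inv_into coexact d0 (orth_proj (d0 ` alt_forms) \<alpha>)"
  by (simp add: d0inv_def coexact_def)

lemma d0inv_coexact: "d0inv \<alpha> \<in> coexact"
  and d0_d0inv: "d0 (d0inv \<alpha>) = orth_proj (d0 ` alt_forms) \<alpha>"
  using orth_proj_props(1)[OF exact_subspace exact_alt, of \<alpha>]
  by (auto simp: d0inv_eq d0_image_coexact[symmetric] inv_into_into f_inv_into_f)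

lemma d0inv_orth: "\<gamma> \<in> alt_forms \<Longrightarrow> ip (\<alpha> - d0 (d0inv \<alpha>)) (d0 \<gamma>) = 0"
  unfolding d0_d0inv by (intro orth_proj_props(2)[OF exact_subspace exact_alt]) auto

text \<open>Projection and inverse are merged into one condition: \<open>d0 \<beta>\<close> is the
  point of the image of \<open>d0\<close> nearest to \<alpha>. The condition is linear, which makes
  identities for \<open>d0inv\<close> easy to verify.\<close>

lemma d0inv_unique:
  assumes "\<beta> \<in> coexact" "\<And>\<gamma>. \<gamma> \<in> alt_forms \<Longrightarrow> ip (\<alpha> - d0 \<beta>) (d0 \<gamma>) = 0"
  shows "d0inv \<alpha> = \<beta>"
proof -
  have "orth_proj (d0 ` alt_forms) \<alpha> = d0 \<beta>"
    using assms by (intro orth_proj_unique[OF exact_subspace exact_alt]) (auto dest: coexact_alt)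
  then show ?thesis
    using assms inv_into_f_f[OF inj_on_d0_coexact] by (simp add: d0inv_eq)
qed

lemma d0inv_alt: "d0inv \<alpha> \<in> alt_forms"
  using d0inv_coexact coexact_alt by blast

lemma d0inv_lin_op: "fs.lin_op alt_forms d0inv"
  unfolding fs.lin_op_def
proof (intro conjI ballI allI d0inv_alt)
  fix \<alpha> \<beta>
  have "ip (\<alpha> + \<beta> - d0 (d0inv \<alpha> + d0inv \<beta>)) (d0 \<gamma>) = 0" if "\<gamma> \<in> alt_forms" for \<gamma>
    using d0inv_orth[OF that, of \<alpha>] d0inv_orth[OF that, of \<beta>]
    by (simp add: d0_add d0inv_alt ip_add_left ip_diff_left)
  then show "d0inv (\<alpha> + \<beta>) = d0inv \<alpha> + d0inv \<beta>"
    by (intro d0inv_unique fs.subspace_add[OF coexact_subspace] d0inv_coexact)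
next
  fix \<alpha> a
  have "ip (fscale a \<alpha> - d0 (fscale a (d0inv \<alpha>))) (d0 \<gamma>) = 0" if "\<gamma> \<in> alt_forms" for \<gamma>
    using d0inv_orth[OF that, of \<alpha>]
    by (simp add: d0_scale d0inv_alt ip_scale_left ip_diff_left)
  then show "d0inv (fscale a \<alpha>) = fscale a (d0inv \<alpha>)"
    by (intro d0inv_unique fs.subspace_scale[OF coexact_subspace] d0inv_coexact)
qed

lemma d0inv_d0: "h \<in> coexact \<Longrightarrow> d0inv (d0 h) = h"
  by (intro d0inv_unique) auto

lemma d0_d0inv_d0: "\<alpha> \<in> alt_forms \<Longrightarrow> d0 (d0inv (d0 \<alpha>)) = d0 \<alpha>"
proof -
  assume "\<alpha> \<in> alt_forms"
  then have "d0 \<alpha> \<in> d0 ` coexact" using d0_image_coexact by simp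
  then obtain h where "h \<in> coexact" "d0 \<alpha> = d0 h" by auto
  then show ?thesis by (simp add: d0inv_d0)
qed

text \<open>The image of \<open>d0\<close> lies in its kernel, to which h is orthogonal, so h
  projects to 0. In particular \<open>d0inv\<close> squares to 0.\<close>

lemma d0inv_of_coexact: "h \<in> coexact \<Longrightarrow> d0inv h = 0"
  by (intro d0inv_unique fs.subspace_0[OF coexact_subspace]) (simp add: d0_0 coexact_def d0_alt d0_d0)

text \<open>A form whose projection onto the image of \<open>d0\<close> is 0 is killed by the
  adjoint. This is the passage from Rumin's operators to \<open>box\<close>.\<close>

lemma d0inv_eq_0D:
  assumes "d0inv \<alpha> = 0"
  shows "d0t \<alpha> = 0"
  using d0inv_orth[of _ \<alpha>] assms by (intro d0t_unique alt_0) (simp add: d0_0 ip_commute[of "d0 _"])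

lemma d0t_coexact: "d0t \<alpha> \<in> coexact"
  by (auto simp: coexact_def d0t_alt ip_commute[of "d0t \<alpha>"] d0t_adjoint[symmetric])

lemma d0t_of_coexact: "h \<in> coexact \<Longrightarrow> d0t h = 0"
  using d0inv_of_coexact d0inv_eq_0D by blast

lemma box0_lin_op: "fs.lin_op alt_forms box0"
proof -
  have "box0 = (\<lambda>\<alpha>. d0 (d0t \<alpha>) + d0t (d0 \<alpha>))" by (simp add: fun_eq_iff box0_def)
  then show ?thesis
    using fs.lin_op_plus[OF fs.lin_op_comp[OF d0_lin_op d0t_lin_op]
        fs.lin_op_comp[OF d0t_lin_op d0_lin_op] alt_forms_subspace] by simp
qed

lemma ip_box0:
  assumes "\<alpha> \<in> alt_forms" "\<beta> \<in> alt_forms"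
  shows "ip (box0 \<alpha>) \<beta> = ip (d0t \<alpha>) (d0t \<beta>) + ip (d0 \<alpha>) (d0 \<beta>)"
  using d0t_adjoint[OF d0t_alt, of \<alpha> \<beta>] d0t_adjoint[OF assms(2), of "d0 \<alpha>"]
    ip_commute[of "d0t (d0 \<alpha>)" \<beta>] ip_commute[of "d0 \<beta>" "d0 \<alpha>"]
  by (simp add: box0_def ip_add_left)

lemma box0_symmetric:
  "\<alpha> \<in> alt_forms \<Longrightarrow> \<beta> \<in> alt_forms \<Longrightarrow> ip (box0 \<alpha>) \<beta> = ip \<alpha> (box0 \<beta>)"
  using ip_box0[of \<alpha> \<beta>] ip_box0[of \<beta> \<alpha>] ip_commute[of \<alpha> "box0 \<beta>"]
    ip_commute[of "d0t \<alpha>" "d0t \<beta>"] ip_commute[of "d0 \<alpha>" "d0 \<beta>"]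
  by simp

lemma box0_eq_0D:
  assumes "\<alpha> \<in> alt_forms" "box0 \<alpha> = 0"
  shows "d0 \<alpha> = 0" and "d0t \<alpha> = 0"
proof -
  have "ip (d0t \<alpha>) (d0t \<alpha>) = 0 \<and> ip (d0 \<alpha>) (d0 \<alpha>) = 0"
    using ip_box0[of \<alpha> \<alpha>] assms ip_self_nonneg[of "d0t \<alpha>"] ip_self_nonneg[of "d0 \<alpha>"] by simp
  then show "d0 \<alpha> = 0" "d0t \<alpha> = 0" using assms ip_self_eq_0 d0_alt d0t_alt by blast+
qed

text \<open>Hodge decomposition: the two subtracted terms are the components in H and in the image
  of \<open>d0\<close>, both orthogonal to the kernel of \<open>box0\<close>. The formula makes the
  relations between \<open>Pi0\<close> and \<open>Pi_E\<close> purely algebraic.\<close>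

lemma Pi0_eq:
  assumes "\<alpha> \<in> alt_forms"
  shows "Pi0 \<alpha> = \<alpha> - d0inv (d0 \<alpha>) - d0 (d0inv \<alpha>)"
  unfolding Pi0_def
proof (rule orth_proj_unique)
  let ?\<beta> = "\<alpha> - d0inv (d0 \<alpha>) - d0 (d0inv \<alpha>)"
  show "fs.subspace {\<alpha> \<in> alt_forms. box0 \<alpha> = 0}"
    using fs.lin_op_zero[OF box0_lin_op alt_forms_subspace] fs.lin_op_add[OF box0_lin_op]
      fs.lin_op_scale[OF box0_lin_op]
    by (auto simp: fs.subspace_def alt_0 alt_add alt_scale)
  have b: "?\<beta> \<in> alt_forms" using assms by (intro alt_diff d0_alt d0inv_alt)
  have "d0 ?\<beta> = 0"
    using assms by (simp add: d0_diff alt_diff d0_alt d0inv_alt d0_d0inv_d0 d0_d0)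
  moreover have "d0inv ?\<beta> = 0"
    using assms by (simp add: fs.lin_op_diff[OF d0inv_lin_op alt_forms_subspace] alt_diff d0_alt d0inv_alt
        d0inv_of_coexact d0inv_d0 d0inv_coexact)
  then have "d0t ?\<beta> = 0" by (rule d0inv_eq_0D)
  ultimately show "?\<beta> \<in> {\<alpha> \<in> alt_forms. box0 \<alpha> = 0}"
    using b fs.lin_op_zero[OF d0t_lin_op alt_forms_subspace] d0_0 by (simp add: box0_def)
  fix \<gamma> assume "\<gamma> \<in> {\<alpha> \<in> alt_forms. box0 \<alpha> = 0}"
  then have \<gamma>: "\<gamma> \<in> alt_forms" "d0 \<gamma> = 0" "d0t \<gamma> = 0" using box0_eq_0D by auto
  then have "ip (d0inv (d0 \<alpha>)) \<gamma> = 0" "ip (d0 (d0inv \<alpha>)) \<gamma> = 0"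
    using d0inv_coexact[of "d0 \<alpha>"] by (auto simp: coexact_def d0t_adjoint d0inv_alt)
  then show "ip (\<alpha> - ?\<beta>) \<gamma> = 0" by (simp add: ip_diff_left ip_add_left)
qed auto

lemma Pi0_lin_op: "fs.lin_op alt_forms Pi0"
proof -
  have "fs.lin_op alt_forms (\<lambda>\<alpha>. \<alpha> - d0inv (d0 \<alpha>) - d0 (d0inv \<alpha>))"
    by (rule fs.lin_op_minus[OF fs.lin_op_minus[OF fs.lin_op_id
          fs.lin_op_comp[OF d0inv_lin_op d0_lin_op] alt_forms_subspace]
          fs.lin_op_comp[OF d0_lin_op d0inv_lin_op] alt_forms_subspace])
  then show ?thesis
    using Pi0_eq unfolding fs.lin_op_def by (simp add: alt_add alt_scale)
qed

lemma box0_coexact: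
  assumes "h \<in> coexact"
  shows "box0 h = d0t (d0 h)" and "box0 h \<in> coexact"
  using assms d0_0 d0t_coexact by (simp_all add: box0_def d0t_of_coexact)

lemma box0_coexact_eq_0: "h \<in> coexact \<Longrightarrow> box0 h = 0 \<Longrightarrow> h = 0"
  using box0_eq_0D(1) coexact_alt coexact_eq_0 by blast

text \<open>The action of the single dilation \<open>\<delta>\<^sub>2\<close> on forms; its eigenvalues \<open>2\<^sup>w\<close> already separate the weights.\<close>

definition pullback :: "('g vfield list \<Rightarrow> real) \<Rightarrow> 'g vfield list \<Rightarrow> real" where
  "pullback \<alpha> = (\<lambda>Vs. if set Vs \<subseteq> \<gg> then \<alpha> (map (dilation A 2) Vs) else 0)"

lemma dilation_closed: "V \<in> \<gg> \<Longrightarrow> dilation A 2 V \<in> \<gg>"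
    and dilation_add: "V \<in> \<gg> \<Longrightarrow> W \<in> \<gg> \<Longrightarrow> dilation A 2 (V + W) = dilation A 2 V + dilation A 2 W"
    and dilation_scale: "V \<in> \<gg> \<Longrightarrow> dilation A 2 (scale_vf a V) = scale_vf a (dilation A 2 V)"
    and dilation_bracket: "V \<in> \<gg> \<Longrightarrow> W \<in> \<gg> \<Longrightarrow>
      dilation A 2 (lie_bracket V W) = lie_bracket (dilation A 2 V) (dilation A 2 W)"
  using dilation_morphism[of 2] by (auto simp: lie_morphism_def linear_endo_def)

lemma funpow_A_X: "i \<in> {1..n} \<Longrightarrow> (A ^^ k) (X i) = scale_vf (\<upsilon> i ^ k) (X i)"
  using linear_A
  by (induction k) (auto simp: linear_endo_def X_closed eigenvector mult.commute)

lemma dilation_X: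
  assumes "i \<in> {1..n}"
  shows "dilation A 2 (X i) = scale_vf (2 powr \<upsilon> i) (X i)"
proof (intro ext)
  fix f x
  have "(\<lambda>k. (\<upsilon> i * ln 2) ^ k /\<^sub>R fact k * X i f x) sums (exp (\<upsilon> i * ln 2) * X i f x)"
    by (intro sums_mult2 exp_converges)
  then show "dilation A 2 (X i) f x = scale_vf (2 powr \<upsilon> i) (X i) f x"
    using assms
    by (simp add: dilation_def funpow_A_X scale_vf_def powr_def sums_iff field_simps power_mult_distrib)
qed

definition weight :: "nat list \<Rightarrow> real" where
  "weight is = sum_list (map \<upsilon> is)"

lemma pullback_alt:
  assumes a: "\<alpha> \<in> alt_forms"
  shows "pullback \<alpha> \<in> alt_forms"
  unfolding alt_forms_def
proof (intro CollectI conjI allI impI)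
  show "\<not> set Vs \<subseteq> \<gg> \<Longrightarrow> pullback \<alpha> Vs = 0" for Vs by (simp add: pullback_def)
  show "\<not> distinct Vs \<Longrightarrow> pullback \<alpha> Vs = 0" for Vs
    using alt_not_distinct[OF a, of "map (dilation A 2) Vs"] by (simp add: pullback_def distinct_map)
  fix Us Ws V W a b
  assume h: "set Us \<subseteq> \<gg> \<and> set Ws \<subseteq> \<gg> \<and> V \<in> \<gg> \<and> W \<in> \<gg>"
  have "dilation A 2 (scale_vf a V + scale_vf b W) =
      scale_vf a (dilation A 2 V) + scale_vf b (dilation A 2 W)"
    using h vf.subspace_scale[OF subspace_lie_algebra] by (simp add: dilation_add dilation_scale)
  moreover have "scale_vf a V + scale_vf b W \<in> \<gg>"
    using h lin_comb_closed by blast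
  moreover have "set (map (dilation A 2) Us) \<subseteq> \<gg>" "set (map (dilation A 2) Ws) \<subseteq> \<gg>"
    using h dilation_closed by auto
  ultimately show "pullback \<alpha> (Us @ (scale_vf a V + scale_vf b W) # Ws) =
      a * pullback \<alpha> (Us @ V # Ws) + b * pullback \<alpha> (Us @ W # Ws)"
    using h alt_linear[OF a, of "map (dilation A 2) Us" "map (dilation A 2) Ws"
        "dilation A 2 V" "dilation A 2 W" a b] dilation_closed
    by (simp add: pullback_def)
qed

lemma pullback_lin_op: "fs.lin_op alt_forms pullback"
  by (auto simp: fs.lin_op_def pullback_alt) (auto simp: pullback_def fun_eq_iff)

lemma map_X_closed: "set is \<subseteq> {1..n} \<Longrightarrow> set (map X is) \<subseteq> \<gg>"
  using X_closed by auto

lemma alt_scaled_list: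
  assumes "\<alpha> \<in> alt_forms" "set is \<subseteq> {1..n}"
  shows "\<alpha> (map (\<lambda>i. scale_vf (2 powr \<upsilon> i) (X i)) is) = 2 powr weight is * \<alpha> (map X is)"
  using assms
proof (induction "is" arbitrary: \<alpha>)
  case (Cons i "is")
  let ?R = "map (\<lambda>i. scale_vf (2 powr \<upsilon> i) (X i)) is"
  have i: "X i \<in> \<gg>" and R: "set ?R \<subseteq> \<gg>"
    using Cons.prems X_closed vf.subspace_scale[OF subspace_lie_algebra] by auto
  have "\<alpha> (scale_vf (2 powr \<upsilon> i) (X i) # ?R) = 2 powr \<upsilon> i * \<alpha> (X i # ?R)"
    using alt_linear_Cons[OF Cons.prems(1) R i i, of "2 powr \<upsilon> i" 0] by simp
  also have "\<alpha> (X i # ?R) = 2 powr weight is * \<alpha> (X i # map X is)"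
    using Cons.prems i by (intro Cons.IH[of "\<lambda>R. \<alpha> (X i # R)"] alt_forms_Cons) auto
  finally show ?case by (simp add: weight_def powr_add)
qed (simp add: weight_def)

lemma pullback_X:
  assumes "\<alpha> \<in> alt_forms" "set is \<subseteq> {1..n}"
  shows "pullback \<alpha> (map X is) = 2 powr weight is * \<alpha> (map X is)"
proof -
  have "map (dilation A 2) (map X is) = map (\<lambda>i. scale_vf (2 powr \<upsilon> i) (X i)) is"
    using assms(2) dilation_X by auto
  then show ?thesis
    using map_X_closed[OF assms(2)] alt_scaled_list[OF assms] by (simp only: pullback_def if_True)
qed

text \<open>The dilation is diagonal in the orthonormal basis of the
  \<open>\<theta>\<^sup>I\<close>. Symmetry transfers commutation with \<open>d0\<close> to its
  adjoint and to \<open>d0inv\<close>.\<close>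

lemma pullback_symmetric:
  assumes "\<alpha> \<in> alt_forms" "\<beta> \<in> alt_forms"
  shows "ip (pullback \<alpha>) \<beta> = ip \<alpha> (pullback \<beta>)"
proof -
  have "finite I" "set (sorted_list_of_set I) \<subseteq> {1..n}" if "I \<in> Pow {1..n}" for I
    using that finite_subset[of I "{1..n}"] by auto
  then show ?thesis
    unfolding ip_def using assms by (intro sum.cong) (auto simp: pullback_X)
qed

text \<open>On constant forms only the bracket terms of the exterior derivative survive, and
  dilations are Lie algebra morphisms.\<close>

lemma pullback_d0:
  assumes "\<alpha> \<in> alt_forms"
  shows "pullback (d0 \<alpha>) = d0 (pullback \<alpha>)"
proof (rule alt_form_cong)
  fix Vs assume g: "set Vs \<subseteq> \<gg>"
  have d0: "d0 \<beta> Ws = (\<Sum>j<length Ws. \<Sum>i<j.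
      (- 1) ^ (i + j) * \<beta> (lie_bracket (Ws ! i) (Ws ! j) # nths Ws (- {i, j})))"
    if "set Ws \<subseteq> \<gg>" for \<beta> Ws
  proof -
    have "(Ws ! i) (\<lambda>y. \<beta> (nths Ws (- {i}))) z = 0" if "i < length Ws" for i z
      using lie_algebra_const[of "Ws ! i"] that nth_mem[OF that] \<open>set Ws \<subseteq> \<gg>\<close> by (simp add: subset_iff)
    then show ?thesis using that by (simp add: d0_def ext_d_def)
  qed
  have m: "set (map (dilation A 2) Vs) \<subseteq> \<gg>" using g dilation_closed by auto
  have "lie_bracket (dilation A 2 (Vs ! i)) (dilation A 2 (Vs ! j)) = dilation A 2 (lie_bracket (Vs ! i) (Vs ! j))"
    "set (lie_bracket (Vs ! i) (Vs ! j) # nths Vs (- {i, j})) \<subseteq> \<gg>"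
    if "i < j" "j < length Vs" for i j
  proof -
    have "Vs ! i \<in> \<gg>" "Vs ! j \<in> \<gg>"
      using that g nth_mem[of i Vs] nth_mem[of j Vs] by auto
    then show "lie_bracket (dilation A 2 (Vs ! i)) (dilation A 2 (Vs ! j)) = dilation A 2 (lie_bracket (Vs ! i) (Vs ! j))"
      "set (lie_bracket (Vs ! i) (Vs ! j) # nths Vs (- {i, j})) \<subseteq> \<gg>"
      using g set_nths_subset[of Vs "- {i, j}"] by (auto simp: dilation_bracket lie_bracket_closed)
  qed
  then show "pullback (d0 \<alpha>) Vs = d0 (pullback \<alpha>) Vs"
    unfolding d0[OF g] using g d0[OF m]
    by (subst pullback_def) (auto simp: pullback_def nths_map intro!: sum.cong)
qed (use assms in \<open>simp_all add: pullback_alt d0_alt\<close>)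

lemma pullback_d0t:
  assumes "\<alpha> \<in> alt_forms"
  shows "d0t (pullback \<alpha>) = pullback (d0t \<alpha>)"
proof (rule d0t_unique)
  fix \<gamma> assume g: "\<gamma> \<in> alt_forms"
  have "ip (d0 \<gamma>) (pullback \<alpha>) = ip (d0 (pullback \<gamma>)) \<alpha>"
    using g assms by (simp add: pullback_symmetric[symmetric] d0_alt pullback_d0)
  also have "\<dots> = ip \<gamma> (pullback (d0t \<alpha>))"
    using g assms by (simp add: d0t_adjoint pullback_alt pullback_symmetric d0t_alt)
  finally show "ip (d0 \<gamma>) (pullback \<alpha>) = ip \<gamma> (pullback (d0t \<alpha>))" .
qed (use assms in \<open>simp add: pullback_alt d0t_alt\<close>)

lemma pullback_coexact:
  assumes "h \<in> coexact"
  shows "pullback h \<in> coexact"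
  unfolding coexact_def
proof (intro CollectI conjI ballI impI)
  note h = coexact_alt[OF assms]
  show "pullback h \<in> alt_forms" using h by (rule pullback_alt)
  fix \<gamma> assume g: "\<gamma> \<in> alt_forms" "d0 \<gamma> = 0"
  have "d0 (pullback \<gamma>) = 0"
    using g fs.lin_op_zero[OF pullback_lin_op alt_forms_subspace] by (simp add: pullback_d0[symmetric])
  then show "ip (pullback h) \<gamma> = 0"
    using assms g h by (simp add: pullback_symmetric) (simp add: coexact_def pullback_alt)
qed

lemma pullback_d0inv:
  assumes "\<alpha> \<in> alt_forms"
  shows "d0inv (pullback \<alpha>) = pullback (d0inv \<alpha>)"
proof (rule d0inv_unique)
  fix \<gamma> assume g: "\<gamma> \<in> alt_forms"
  have "pullback \<alpha> - d0 (pullback (d0inv \<alpha>)) = pullback (\<alpha> - d0 (d0inv \<alpha>))"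
    using assms by (simp add: pullback_d0[symmetric] d0inv_alt d0_alt
        fs.lin_op_diff[OF pullback_lin_op alt_forms_subspace])
  then have "ip (pullback \<alpha> - d0 (pullback (d0inv \<alpha>))) (d0 \<gamma>) = ip (\<alpha> - d0 (d0inv \<alpha>)) (d0 (pullback \<gamma>))"
    using assms g by (simp add: pullback_symmetric alt_diff d0_alt d0inv_alt pullback_d0)
  then show "ip (pullback \<alpha> - d0 (pullback (d0inv \<alpha>))) (d0 \<gamma>) = 0"
    using g by (simp add: d0inv_orth pullback_alt)
qed (intro pullback_coexact d0inv_coexact)

lemma pullback_box0:
  "\<alpha> \<in> alt_forms \<Longrightarrow> box0 (pullback \<alpha>) = pullback (box0 \<alpha>)"
  by (simp add: box0_def pullback_d0[symmetric] pullback_d0t d0_alt d0t_alt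
      fs.lin_op_add[OF pullback_lin_op])

subsection \<open>The filtration by weights\<close>

text \<open>The part of weight at least t. A filtration rather than the grading turns an increase of
  weight into a single membership statement.\<close>

definition filt :: "real \<Rightarrow> ('g vfield list \<Rightarrow> real) set" where
  "filt t = {\<alpha> \<in> alt_forms. \<forall>is. set is \<subseteq> {1..n} \<longrightarrow> weight is < t \<longrightarrow> \<alpha> (map X is) = 0}"

text \<open>A polynomial in \<open>pullback\<close> with prescribed roots; being a polynomial, it
  commutes with whatever commutes with \<open>pullback\<close>.\<close>

primrec shift_prod :: "real list \<Rightarrow> ('g vfield list \<Rightarrow> real) \<Rightarrow> 'g vfield list \<Rightarrow> real" where
  "shift_prod [] \<alpha> = \<alpha>"
| "shift_prod (l # ls) \<alpha> = pullback (shift_prod ls \<alpha>) - fscale l (shift_prod ls \<alpha>)"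

lemma shift_prod_lin_op: "fs.lin_op alt_forms (shift_prod ls)"
proof (induction ls)
  case (Cons l ls)
  have "fs.lin_op alt_forms (\<lambda>\<alpha>. fscale l \<alpha>)"
    by (auto simp: fs.lin_op_def alt_scale fs.scale_right_distrib fs.scale_left_commute)
  from fs.lin_op_minus[OF fs.lin_op_comp[OF pullback_lin_op Cons] fs.lin_op_comp[OF this Cons] alt_forms_subspace]
  show "fs.lin_op alt_forms (shift_prod (l # ls))" by (simp only: shift_prod.simps[abs_def])
next
  case Nil
  show "fs.lin_op alt_forms (shift_prod [])" by (simp only: shift_prod.simps[abs_def] fs.lin_op_id)
qed

lemma shift_prod_X:
  assumes "\<alpha> \<in> alt_forms" "set is \<subseteq> {1..n}"
  shows "shift_prod ls \<alpha> (map X is) = (\<Prod>l\<leftarrow>ls. 2 powr weight is - l) * \<alpha> (map X is)"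
  using assms
  by (induction ls) (simp_all add: pullback_X fs.lin_op_mem[OF shift_prod_lin_op] algebra_simps)

lemma shift_prod_commute:
  assumes T: "fs.lin_op alt_forms T" "\<And>\<alpha>. \<alpha> \<in> alt_forms \<Longrightarrow> T (pullback \<alpha>) = pullback (T \<alpha>)"
    and \<alpha>: "\<alpha> \<in> alt_forms"
  shows "T (shift_prod ls \<alpha>) = shift_prod ls (T \<alpha>)"
proof (induction ls)
  case (Cons l ls)
  note mem = fs.lin_op_mem[OF shift_prod_lin_op \<alpha>]
  have "T (pullback (shift_prod ls \<alpha>) - fscale l (shift_prod ls \<alpha>)) =
      pullback (T (shift_prod ls \<alpha>)) - fscale l (T (shift_prod ls \<alpha>))"
    by (simp only: fs.lin_op_diff[OF T(1) alt_forms_subspace] fs.lin_op_scale[OF T(1)]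
        T(2) pullback_alt alt_scale mem)
  then show "T (shift_prod (l # ls) \<alpha>) = shift_prod (l # ls) (T \<alpha>)"
    by (simp only: shift_prod.simps Cons)
qed simp

text \<open>The filtration is cut out by \<open>pullback\<close>, as the common kernel of products of \<open>S - 2\<^sup>w\<close> over
  the weights \<open>w \<ge> t\<close>; hence operators that commute with \<open>S = pullback\<close> preserve it.\<close>

lemma filt_eq_kernel:
  obtains ls where "filt t = {\<alpha> \<in> alt_forms. shift_prod ls \<alpha> = 0}"
proof -
  let ?D = "{is. set is \<subseteq> {1..n} \<and> distinct is}"
  \<comment> \<open>Alternating forms vanish on index lists with repetitions, so finitely many
    weights suffice as roots.\<close>
  have "finite ?D" by (rule finite_subset_distinct) simp
  then have "finite {w \<in> weight ` ?D. t \<le> w}" by simp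
  then obtain ws where ws: "set ws = {w \<in> weight ` ?D. t \<le> w}" using finite_list by blast
  let ?ls = "map (\<lambda>w. 2 powr w) ws"
  have "shift_prod ?ls \<alpha> = 0" if a: "\<alpha> \<in> filt t" for \<alpha>
  proof (rule alt_eq_0_if_zero_on_basis)
    have \<alpha>: "\<alpha> \<in> alt_forms" using a by (simp add: filt_def)
    then show "shift_prod ?ls \<alpha> \<in> alt_forms" by (rule fs.lin_op_mem[OF shift_prod_lin_op])
    fix "is" assume i: "set is \<subseteq> {1..n}"
    have "\<not> distinct is \<Longrightarrow> \<alpha> (map X is) = 0"
      using alt_not_distinct[OF \<alpha>] by (simp add: distinct_map)
    moreover have "weight is < t \<Longrightarrow> \<alpha> (map X is) = 0" using a i by (simp add: filt_def)
    moreover have "(\<Prod>l\<leftarrow>?ls. 2 powr weight is - l) = 0" if "distinct is" "t \<le> weight is"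
      using that i ws by (auto simp: prod_list_zero_iff image_iff)
    ultimately show "shift_prod ?ls \<alpha> (map X is) = 0"
      unfolding shift_prod_X[OF \<alpha> i] by (metis mult_eq_0_iff not_le)
  qed
  moreover have "\<alpha> \<in> filt t" if \<alpha>: "\<alpha> \<in> alt_forms" "shift_prod ?ls \<alpha> = 0" for \<alpha>
    unfolding filt_def
  proof (intro CollectI conjI allI impI \<alpha>(1))
    fix "is" assume i: "set is \<subseteq> {1..n}" "weight is < t"
    have "2 powr weight is \<noteq> (2 powr w :: real)" if "w \<in> set ws" for w
      using that ws i by (auto simp: powr_inj)
    then have "(\<Prod>l\<leftarrow>?ls. 2 powr weight is - l) \<noteq> 0" by (auto simp: prod_list_zero_iff)
    then show "\<alpha> (map X is) = 0"
      using shift_prod_X[OF \<alpha>(1) i(1), of ?ls] \<alpha>(2) by simp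
  qed
  ultimately have "filt t = {\<alpha> \<in> alt_forms. shift_prod ?ls \<alpha> = 0}"
    by (auto simp: filt_def)
  then show thesis by (rule that)
qed

lemma filt_preserved:
  assumes T: "fs.lin_op alt_forms T" "\<And>\<alpha>. \<alpha> \<in> alt_forms \<Longrightarrow> T (pullback \<alpha>) = pullback (T \<alpha>)"
    and \<alpha>: "\<alpha> \<in> filt t"
  shows "T \<alpha> \<in> filt t"
proof -
  obtain ls where ls: "filt t = {\<alpha> \<in> alt_forms. shift_prod ls \<alpha> = 0}" by (rule filt_eq_kernel)
  with \<alpha> have \<alpha>': "\<alpha> \<in> alt_forms" "shift_prod ls \<alpha> = 0" by auto
  have "shift_prod ls (T \<alpha>) = T (shift_prod ls \<alpha>)"
    by (rule shift_prod_commute[OF T \<alpha>'(1), symmetric])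
  also have "\<dots> = 0"
    unfolding \<alpha>'(2) by (rule fs.lin_op_zero[OF T(1) alt_forms_subspace])
  finally have "shift_prod ls (T \<alpha>) = 0" .
  then show ?thesis using ls fs.lin_op_mem[OF T(1) \<alpha>'(1)] by blast
qed

lemma filt_subspace: "fs.subspace (filt t)"
  by (auto simp: fs.subspace_def filt_def alt_0 alt_add alt_scale)

lemma weight_nonneg: "set is \<subseteq> {1..n} \<Longrightarrow> 0 \<le> weight is"
  unfolding weight_def using weight_pos by (intro sum_list_nonneg) (auto simp: less_imp_le subset_iff)

lemma filt_0: "filt 0 = alt_forms"
  using weight_nonneg by (force simp: filt_def)

text \<open>A nonzero value needs an index list without repetitions, whose weight is at most the sum
  of all \<open>\<upsilon> i\<close>.\<close>

lemma filt_top: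
  assumes "t > (\<Sum>i=1..n. \<upsilon> i)" "\<alpha> \<in> filt t"
  shows "\<alpha> = 0"
proof (rule alt_eq_0_if_zero_on_basis)
  show \<alpha>: "\<alpha> \<in> alt_forms" using assms by (simp add: filt_def)
  fix "is" assume i: "set is \<subseteq> {1..n}"
  show "\<alpha> (map X is) = 0"
  proof (cases "distinct is")
    case True
    then have "weight is = sum \<upsilon> (set is)" by (simp add: weight_def sum_list_distinct_conv_sum_set)
    also have "\<dots> \<le> (\<Sum>i=1..n. \<upsilon> i)"
      using i weight_pos by (intro sum_mono2) (auto simp: less_imp_le)
    finally show ?thesis using assms i by (simp add: filt_def)
  next
    case False
    then show ?thesis using alt_not_distinct[OF \<alpha>] by (simp add: distinct_map)
  qed
qed

end


section \<open>The Rumin complex\<close>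

context homogeneous_group
begin

section \<open>Pointwise extension of algebraic operators to forms\<close>

lemma Fscale_at: "Fscale a \<omega> x = fscale a (\<omega> x)"
  by (simp add: fun_eq_iff)

lemma extend_apply: "extend T \<omega> x = T (\<omega> x)"
  by (simp add: extend_def)

text \<open>Expanding \<open>\<omega> x\<close> in a fixed orthonormal basis confines the dependence
  on x to the coefficients, which are combinations of smooth values of \<omega>.\<close>

lemma extend_forms:
  assumes T: "fs.lin_op alt_forms T" and \<omega>: "\<omega> \<in> forms"
  shows "extend T \<omega> \<in> forms"
proof (rule formsI)
  show "extend T \<omega> x \<in> alt_forms" for x
    unfolding extend_apply by (rule fs.lin_op_mem[OF T forms_alt[OF \<omega>]])
  have "\<exists>B. B \<subseteq> alt_forms \<and> (\<forall>f\<in>alt_forms. f = (\<Sum>b\<in>B. fscale (ev.dot f b) b))"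
    by (rule ev.orthonormal_basis[OF alt_forms_subspace subset_refl]) blast
  then obtain B where B: "B \<subseteq> alt_forms"
    "\<And>f. f \<in> alt_forms \<Longrightarrow> f = (\<Sum>b\<in>B. fscale (ev.dot f b) b)"
    by blast
  fix Vs
  have "T (\<omega> x) Vs = (\<Sum>b\<in>B. (\<Sum>I\<in>Pow {1..n}. \<omega> x (map X (sorted_list_of_set I)) *
      b (map X (sorted_list_of_set I))) * T b Vs)" for x
  proof -
    have "T (\<omega> x) = T (\<Sum>b\<in>B. fscale (ev.dot (\<omega> x) b) b)"
      using B(2)[OF forms_alt[OF \<omega>, of x]] by simp
    also have "\<dots> = (\<Sum>b\<in>B. T (fscale (ev.dot (\<omega> x) b) b))"
      using B(1) by (intro fs.lin_op_sum[OF T alt_forms_subspace] alt_scale) auto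
    also have "\<dots> = (\<Sum>b\<in>B. fscale (ev.dot (\<omega> x) b) (T b))"
      using B(1) by (intro sum.cong refl fs.lin_op_scale[OF T]) auto
    finally show ?thesis by (simp only: sum_fun_apply fscale_apply ev.dot_def)
  qed
  then have "(\<lambda>x. extend T \<omega> x Vs) = (\<lambda>x. \<Sum>b\<in>B. (\<Sum>I\<in>Pow {1..n}. \<omega> x (map X (sorted_list_of_set I)) *
      b (map X (sorted_list_of_set I))) * T b Vs)"
    unfolding extend_apply by (intro ext)
  also have "\<dots> \<in> smooth_functions \<A>"
    by (intro smooth_sum smooth_mult smooth_const forms_smooth \<omega>)
  finally show "(\<lambda>x. extend T \<omega> x Vs) \<in> smooth_functions \<A>" .
qed

lemma extend_lin_op:
  assumes T: "fs.lin_op alt_forms T"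
  shows "Fs.lin_op forms (extend T)"
  unfolding Fs.lin_op_def
proof (intro conjI ballI allI extend_forms[OF T])
  fix \<omega> \<eta> assume f: "\<omega> \<in> forms" "\<eta> \<in> forms"
  show "extend T (\<omega> + \<eta>) = extend T \<omega> + extend T \<eta>"
    using fs.lin_op_add[OF T forms_alt[OF f(1)] forms_alt[OF f(2)]] by (simp add: extend_def fun_eq_iff)
next
  fix \<omega> a assume f: "\<omega> \<in> forms"
  show "extend T (Fscale a \<omega>) = Fscale a (extend T \<omega>)"
    by (rule ext) (simp only: extend_apply Fscale_at fs.lin_op_scale[OF T forms_alt[OF f]])
qed

subsection \<open>Operators that increase weights\<close>

definition form_filt :: "real \<Rightarrow> ('g \<Rightarrow> 'g vfield list \<Rightarrow> real) set" where
  "form_filt t = {\<omega> \<in> forms. \<forall>x. \<omega> x \<in> filt t}"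

lemma form_filt_subspace: "Fs.subspace (form_filt t)"
  by (simp add: Fs.subspace_def form_filt_def forms_0 forms_add forms_scale Fscale_at
      fs.subspace_0[OF filt_subspace] fs.subspace_add[OF filt_subspace] fs.subspace_scale[OF filt_subspace])

lemma form_filt_0: "form_filt 0 = forms"
  by (auto simp: form_filt_def filt_0 forms_alt)

lemma form_filt_top: "t > (\<Sum>i=1..n. \<upsilon> i) \<Longrightarrow> \<omega> \<in> form_filt t \<Longrightarrow> \<omega> = 0"
  using filt_top by (auto simp: form_filt_def fun_eq_iff)

lemma extend_form_filt:
  assumes "fs.lin_op alt_forms T" "\<And>\<alpha>. \<alpha> \<in> alt_forms \<Longrightarrow> T (pullback \<alpha>) = pullback (T \<alpha>)"
    and "\<omega> \<in> form_filt t"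
  shows "extend T \<omega> \<in> form_filt t"
  using assms filt_preserved[OF assms(1,2)] extend_forms[OF assms(1)]
  by (simp add: form_filt_def extend_apply)

lemma weight_nths:
  "i < length is \<Longrightarrow> weight (nths is (- {i})) = weight is - \<upsilon> (is ! i)"
proof (induction "is" arbitrary: i)
  case (Cons j "is")
  have "{k. Suc k \<in> - {Suc m}} = - {m}" "{k. Suc k \<in> - {0}} = UNIV" for m by auto
  with Cons show ?case
    by (cases i) (auto simp: weight_def nths_Cons nths_all Collect_neg_eq)
qed simp

lemma ext_d_minus_d0:
  assumes "set Vs \<subseteq> \<gg>"
  shows "ext_d \<omega> x Vs - d0 (\<omega> x) Vs =
    (\<Sum>i<length Vs. (- 1) ^ i * (Vs ! i) (\<lambda>y. \<omega> y (nths Vs (- {i}))) x)"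
proof -
  have "(Vs ! i) (\<lambda>y. \<omega> x (nths Vs (- {i}))) z = 0" if "i < length Vs" for i z
    using lie_algebra_const[of "Vs ! i"] that nth_mem[OF that] assms by (simp add: subset_iff)
  then show ?thesis using assms by (simp add: d0_def ext_d_def)
qed

lemma weight_min: "i \<in> {1..n} \<Longrightarrow> \<upsilon> 1 \<le> \<upsilon> i"
  using weight_mono nontrivial by (auto intro!: mono_onD[of "{1..n}" \<upsilon>])

lemma weight_min_pos: "0 < \<upsilon> 1"
  using weight_pos[of 1] nontrivial by simp

text \<open>The difference consists of the terms that differentiate coefficients. Each drops one
  argument, of weight at least \<open>\<upsilon> 1\<close>; on a list of weight below
  \<open>t + \<upsilon> 1\<close> the differentiated coefficient is therefore identically 0.\<close>

lemma d_minus_d0_filt: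
  assumes "\<omega> \<in> form_filt t"
  shows "ext_d \<omega> - extend d0 \<omega> \<in> form_filt (t + \<upsilon> 1)"
proof -
  have \<omega>: "\<omega> \<in> forms" using assms by (simp add: form_filt_def)
  have f: "ext_d \<omega> - extend d0 \<omega> \<in> forms"
    by (intro forms_diff ext_d_forms extend_forms d0_lin_op \<omega>)
  moreover have "(ext_d \<omega> - extend d0 \<omega>) x \<in> filt (t + \<upsilon> 1)" for x
    unfolding filt_def
  proof (intro CollectI conjI allI impI forms_alt[OF f])
    fix "is" assume i: "set is \<subseteq> {1..n}" and w: "weight is < t + \<upsilon> 1"
    have "(map X is ! i) (\<lambda>y. \<omega> y (nths (map X is) (- {i}))) x = 0" if l: "i < length is" for i
    proof -
      have m: "is ! i \<in> {1..n}" using i l nth_mem by blast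
      have "weight (nths is (- {i})) < t"
        using w weight_min[OF m] by (simp add: weight_nths[OF l])
      then have "\<omega> y (nths (map X is) (- {i})) = 0" for y
        using assms i set_nths_subset[of "is" "- {i}"] by (auto simp: form_filt_def filt_def nths_map)
      then show ?thesis using lie_algebra_const[OF X_closed[OF m]] l by simp
    qed
    then show "(ext_d \<omega> - extend d0 \<omega>) x (map X is) = 0"
      using ext_d_minus_d0[OF map_X_closed[OF i], of \<omega> x] by (simp add: extend_apply)
  qed
  ultimately show ?thesis by (simp add: form_filt_def)
qed

lemma funpow_filt:
  assumes "\<And>t \<omega>. \<omega> \<in> form_filt t \<Longrightarrow> T \<omega> \<in> form_filt (t + \<upsilon> 1)" "\<omega> \<in> forms"
  shows "(T ^^ k) \<omega> \<in> form_filt (k * \<upsilon> 1)"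
proof (induction k)
  case (Suc k)
  have "(T ^^ Suc k) \<omega> \<in> form_filt (k * \<upsilon> 1 + \<upsilon> 1)"
    using assms(1)[OF Suc] by simp
  then show ?case by (simp add: algebra_simps)
qed (use assms in \<open>simp add: form_filt_0\<close>)

text \<open>The gain \<open>\<upsilon> 1\<close> per application is the same on all forms, so one
  exponent N serves them all.\<close>

lemma nilpotent:
  assumes "\<And>t \<omega>. \<omega> \<in> form_filt t \<Longrightarrow> T \<omega> \<in> form_filt (t + \<upsilon> 1)"
  shows "\<exists>N. \<forall>\<omega>\<in>forms. (T ^^ N) \<omega> = 0"
proof -
  obtain N where "(\<Sum>i=1..n. \<upsilon> i) < of_nat N * \<upsilon> 1"
    using reals_Archimedean3[OF weight_min_pos] by blast
  then show ?thesis
    using form_filt_top funpow_filt[of T, OF assms] by blast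
qed

text \<open>A form fixed by T is fixed by \<open>T ^^ N\<close>, hence 0; a preimage is the finite
  geometric series, which telescopes.\<close>

lemma I_minus_nilpotent_bij:
  assumes T: "Fs.lin_op forms T"
    and raise: "\<And>t \<omega>. \<omega> \<in> form_filt t \<Longrightarrow> T \<omega> \<in> form_filt (t + \<upsilon> 1)"
  shows "bij_betw (\<lambda>\<omega>. \<omega> - T \<omega>) forms forms"
proof (rule bij_betwI')
  obtain N where N: "\<And>\<omega>. \<omega> \<in> forms \<Longrightarrow> (T ^^ N) \<omega> = 0"
    using nilpotent[of T, OF raise] by blast
  note memT = Fs.lin_op_mem[OF T]
  fix \<omega> assume \<omega>: "\<omega> \<in> forms"
  show "\<omega> - T \<omega> \<in> forms" using \<omega> by (intro forms_diff memT)
  fix \<eta> assume \<eta>: "\<eta> \<in> forms"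
  show "(\<omega> - T \<omega> = \<eta> - T \<eta>) = (\<omega> = \<eta>)"
  proof
    assume eq: "\<omega> - T \<omega> = \<eta> - T \<eta>"
    have "T \<omega> x Vs - T \<eta> x Vs = \<omega> x Vs - \<eta> x Vs" for x Vs
      using fun_cong[OF fun_cong[OF eq, of x], of Vs] by simp
    then have fix1: "T (\<omega> - \<eta>) = \<omega> - \<eta>"
      unfolding Fs.lin_op_diff[OF T forms_subspace \<omega> \<eta>] by (simp add: fun_eq_iff)
    have "(T ^^ k) (\<omega> - \<eta>) = \<omega> - \<eta>" for k
    proof (induction k)
      case (Suc k)
      have "(T ^^ Suc k) (\<omega> - \<eta>) = T ((T ^^ k) (\<omega> - \<eta>))" by simp
      then show "(T ^^ Suc k) (\<omega> - \<eta>) = \<omega> - \<eta>" unfolding Suc fix1 .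
    qed simp
    then have "\<omega> - \<eta> = 0" using N[OF forms_diff[OF \<omega> \<eta>]] by metis
    then show "\<omega> = \<eta>" by simp
  qed simp
next
  obtain N where N: "\<And>\<omega>. \<omega> \<in> forms \<Longrightarrow> (T ^^ N) \<omega> = 0"
    using nilpotent[of T, OF raise] by blast
  fix \<eta> assume \<eta>: "\<eta> \<in> forms"
  have mem: "(T ^^ k) \<eta> \<in> forms" for k
    using Fs.lin_op_mem[OF Fs.lin_op_funpow[OF T] \<eta>] .
  define \<omega> where "\<omega> = (\<Sum>k<N. (T ^^ k) \<eta>)"
  have "\<omega> \<in> forms" unfolding \<omega>_def by (intro Fs.subspace_sum forms_subspace mem)
  moreover have "\<omega> - T \<omega> = \<eta>"
  proof -
    have "T \<omega> = (\<Sum>k<N. (T ^^ Suc k) \<eta>)"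
      unfolding \<omega>_def using Fs.lin_op_sum[OF T forms_subspace mem] by simp
    then have "\<omega> - T \<omega> = (\<Sum>k<N. (T ^^ k) \<eta> - (T ^^ Suc k) \<eta>)"
      unfolding \<omega>_def by (simp only: sum_subtractf)
    also have "\<dots> = (T ^^ 0) \<eta> - (T ^^ N) \<eta>"
      by (rule sum_lessThan_telescope')
    finally show ?thesis using N[OF \<eta>] by simp
  qed
  ultimately show "\<exists>\<omega>\<in>forms. \<eta> = \<omega> - T \<omega>" by metis
qed

subsection \<open>Rumin's operators\<close>

abbreviation "Q \<equiv> extend d0inv"
abbreviation "K \<omega> \<equiv> inv_I_minus_b (Q \<omega>)"

lemmas Q_lin = extend_lin_op[OF d0inv_lin_op]
lemmas Q_forms = extend_forms[OF d0inv_lin_op]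
lemmas Q_0 = Fs.lin_op_zero[OF Q_lin forms_subspace]

lemma b_op_eq: "\<omega> \<in> forms \<Longrightarrow> b_op \<omega> = Q (extend d0 \<omega> - ext_d \<omega>)"
  unfolding b_op_def
  by (intro Fs.lin_op_diff[OF Q_lin forms_subspace, symmetric] extend_forms[OF d0_lin_op] ext_d_forms)

lemma b_op_lin: "Fs.lin_op forms b_op"
proof -
  have "b_op = (\<lambda>\<omega>. Q (extend d0 \<omega>) - Q (ext_d \<omega>))" by (intro ext) (simp only: b_op_def)
  then show ?thesis
    using Fs.lin_op_minus[OF Fs.lin_op_comp[OF Q_lin extend_lin_op[OF d0_lin_op]]
        Fs.lin_op_comp[OF Q_lin ext_d_lin_op] forms_subspace] by simp
qed

text \<open>\<open>Q\<close> commutes with dilations and so keeps the filtration; the gain comes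
  from \<open>d - d\<^sub>0\<close>.\<close>

lemma b_op_filt: "\<omega> \<in> form_filt t \<Longrightarrow> b_op \<omega> \<in> form_filt (t + \<upsilon> 1)"
proof -
  assume a: "\<omega> \<in> form_filt t"
  have "- (ext_d \<omega> - extend d0 \<omega>) \<in> form_filt (t + \<upsilon> 1)"
    by (intro Fs.subspace_neg[OF form_filt_subspace] d_minus_d0_filt a)
  then have "extend d0 \<omega> - ext_d \<omega> \<in> form_filt (t + \<upsilon> 1)" by simp
  from extend_form_filt[OF d0inv_lin_op pullback_d0inv this]
  show ?thesis using b_op_eq[of \<omega>] a by (simp add: form_filt_def)
qed

lemmas I_minus_b_bij = I_minus_nilpotent_bij[OF b_op_lin b_op_filt]

lemma J_forms: "\<eta> \<in> forms \<Longrightarrow> inv_I_minus_b \<eta> \<in> forms"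
  and J_eq: "\<eta> \<in> forms \<Longrightarrow> inv_I_minus_b \<eta> - b_op (inv_I_minus_b \<eta>) = \<eta>"
  using I_minus_b_bij unfolding inv_I_minus_b_def bij_betw_def
  by (metis inv_into_into, metis (no_types, lifting) f_inv_into_f)

lemma J_unique: "\<omega> \<in> forms \<Longrightarrow> \<omega> - b_op \<omega> = \<eta> \<Longrightarrow> inv_I_minus_b \<eta> = \<omega>"
  using I_minus_b_bij unfolding inv_I_minus_b_def bij_betw_def
  by (metis (no_types, lifting) inv_into_f_f)

lemma J_lin: "Fs.lin_op forms inv_I_minus_b"
  unfolding Fs.lin_op_def
proof (intro conjI ballI allI J_forms)
  fix \<omega> \<eta> assume f: "\<omega> \<in> forms" "\<eta> \<in> forms"
  note m = J_forms[OF f(1)] J_forms[OF f(2)]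
  show "inv_I_minus_b (\<omega> + \<eta>) = inv_I_minus_b \<omega> + inv_I_minus_b \<eta>"
  proof (intro J_unique forms_add m)
    have "inv_I_minus_b \<omega> + inv_I_minus_b \<eta> - b_op (inv_I_minus_b \<omega> + inv_I_minus_b \<eta>) =
        (inv_I_minus_b \<omega> - b_op (inv_I_minus_b \<omega>)) + (inv_I_minus_b \<eta> - b_op (inv_I_minus_b \<eta>))"
      unfolding Fs.lin_op_add[OF b_op_lin m] by (simp only: add_diff_add)
    then show "inv_I_minus_b \<omega> + inv_I_minus_b \<eta> - b_op (inv_I_minus_b \<omega> + inv_I_minus_b \<eta>) = \<omega> + \<eta>"
      by (simp only: J_eq f)
  qed
next
  fix \<omega> a assume f: "\<omega> \<in> forms"
  show "inv_I_minus_b (Fscale a \<omega>) = Fscale a (inv_I_minus_b \<omega>)"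
  proof (intro J_unique forms_scale J_forms f)
    show "Fscale a (inv_I_minus_b \<omega>) - b_op (Fscale a (inv_I_minus_b \<omega>)) = Fscale a \<omega>"
      unfolding Fs.lin_op_scale[OF b_op_lin J_forms[OF f]] Fs.scale_right_diff_distrib[symmetric] J_eq[OF f] ..
  qed
qed

lemmas K_lin = Fs.lin_op_comp[OF J_lin Q_lin]
lemmas K_forms = Fs.lin_op_mem[OF K_lin]
lemmas K_0 = Fs.lin_op_zero[OF K_lin forms_subspace]
lemmas J_0 = Fs.lin_op_zero[OF J_lin forms_subspace]

definition coexact_forms :: "('g \<Rightarrow> 'g vfield list \<Rightarrow> real) set" where
  "coexact_forms = {\<omega> \<in> forms. \<forall>x. \<omega> x \<in> coexact}"

lemma coexact_forms_forms: "h \<in> coexact_forms \<Longrightarrow> h \<in> forms"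
  by (simp add: coexact_forms_def)

lemma coexact_forms_add: "h \<in> coexact_forms \<Longrightarrow> k \<in> coexact_forms \<Longrightarrow> h + k \<in> coexact_forms"
  by (simp add: coexact_forms_def forms_add fs.subspace_add[OF coexact_subspace])

lemma Q_coexact: "\<omega> \<in> forms \<Longrightarrow> Q \<omega> \<in> coexact_forms"
  by (simp add: coexact_forms_def Q_forms extend_apply d0inv_coexact)

lemma Q_of_coexact: "h \<in> coexact_forms \<Longrightarrow> Q h = 0"
  by (simp add: coexact_forms_def fun_eq_iff extend_apply d0inv_of_coexact)

lemma Q_d0_of_coexact: "h \<in> coexact_forms \<Longrightarrow> Q (extend d0 h) = h"
  by (simp add: coexact_forms_def fun_eq_iff extend_apply d0inv_d0)

text \<open>\<open>K \<omega> = Q \<omega> + b_op (K \<omega>)\<close>, and \<open>b_op\<close>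
  itself ends with an application of \<open>Q\<close>.\<close>

lemma K_coexact:
  assumes "\<omega> \<in> forms"
  shows "K \<omega> \<in> coexact_forms"
proof -
  have "K \<omega> = Q \<omega> + b_op (K \<omega>)"
    using J_eq[OF Q_forms[OF assms]] by (metis diff_add_cancel)
  moreover have "b_op (K \<omega>) \<in> coexact_forms"
    using K_forms[OF assms]
    by (subst b_op_eq) (auto intro!: Q_coexact forms_diff extend_forms d0_lin_op ext_d_forms)
  ultimately show ?thesis
    using coexact_forms_add[OF Q_coexact[OF assms]] by metis
qed

lemma K_of_coexact: "h \<in> coexact_forms \<Longrightarrow> K h = 0"
  by (simp only: Q_of_coexact J_0)

text \<open>On H-valued forms \<open>Q d\<^sub>0\<close> is the identity, so
  \<open>(I - b) h = Q d h\<close>.\<close>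

lemma K_d_of_coexact:
  assumes "h \<in> coexact_forms"
  shows "K (ext_d h) = h"
  by (rule J_unique) (use assms in \<open>simp_all add: b_op_def Q_d0_of_coexact coexact_forms_forms\<close>)

lemma K_eq_0D:
  assumes "\<omega> \<in> forms" "K \<omega> = 0"
  shows "Q \<omega> = 0"
  using J_eq[OF Q_forms[OF assms(1)]] Fs.lin_op_zero[OF b_op_lin forms_subspace]
  unfolding assms(2) by simp

lemma Pi_E_eq: "Pi_E \<omega> = \<omega> - (K (ext_d \<omega>) + ext_d (K \<omega>))"
  by (simp only: Pi_E_def Pi_op_def)

lemma Pi_E_lin: "Fs.lin_op forms Pi_E"
proof -
  have "Pi_E = (\<lambda>\<omega>. \<omega> - (K (ext_d \<omega>) + ext_d (K \<omega>)))" by (intro ext) (simp only: Pi_E_eq)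
  then show ?thesis
    using Fs.lin_op_minus[OF Fs.lin_op_id Fs.lin_op_plus[OF Fs.lin_op_comp[OF K_lin ext_d_lin_op]
        Fs.lin_op_comp[OF ext_d_lin_op K_lin] forms_subspace] forms_subspace] by simp
qed

lemmas Pi_E_forms = Fs.lin_op_mem[OF Pi_E_lin]

text \<open>Since K takes values in H, \<open>K K = 0\<close> and \<open>K d K = K\<close>.\<close>

lemma K_Pi_E:
  assumes "\<omega> \<in> forms"
  shows "K (Pi_E \<omega>) = 0"
proof -
  have 1: "K (ext_d \<omega>) \<in> forms" "ext_d (K \<omega>) \<in> forms"
    using assms by (auto intro!: K_forms ext_d_forms)
  have "K (Pi_E \<omega>) = K \<omega> - (K (K (ext_d \<omega>)) + K (ext_d (K \<omega>)))"
    unfolding Pi_E_eq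
    by (simp only: Fs.lin_op_diff[OF K_lin forms_subspace assms forms_add[OF 1]] Fs.lin_op_add[OF K_lin 1])
  also have "\<dots> = 0"
    unfolding K_of_coexact[OF K_coexact[OF ext_d_forms[OF assms]]] K_d_of_coexact[OF K_coexact[OF assms]]
    by simp
  finally show ?thesis .
qed

lemma Q_Pi_E: "\<omega> \<in> forms \<Longrightarrow> Q (Pi_E \<omega>) = 0"
  by (intro K_eq_0D Pi_E_forms K_Pi_E)

lemma d_Pi_E:
  assumes "\<omega> \<in> forms"
  shows "ext_d (Pi_E \<omega>) = Pi_E (ext_d \<omega>)"
proof -
  have 1: "K (ext_d \<omega>) \<in> forms" "ext_d (K \<omega>) \<in> forms"
    using assms by (auto intro!: K_forms ext_d_forms)
  have "ext_d (Pi_E \<omega>) = ext_d \<omega> - (ext_d (K (ext_d \<omega>)) + ext_d (ext_d (K \<omega>)))"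
    unfolding Pi_E_eq
    by (simp only: ext_d_diff[OF assms forms_add[OF 1]] Fs.lin_op_add[OF ext_d_lin_op 1])
  also have "\<dots> = ext_d \<omega> - (K (ext_d (ext_d \<omega>)) + ext_d (K (ext_d \<omega>)))"
    by (simp only: ext_d_ext_d[OF assms] ext_d_ext_d[OF K_forms[OF assms]] K_0 add_0_left add_0_right)
  finally show ?thesis by (simp only: Pi_E_eq)
qed

lemma Pi_E_of_coexact:
  assumes "h \<in> coexact_forms"
  shows "Pi_E h = 0"
  unfolding Pi_E_eq K_d_of_coexact[OF assms] K_of_coexact[OF assms] ext_d_zero by simp

lemma Pi_E_Pi_E:
  assumes "\<omega> \<in> forms"
  shows "Pi_E (Pi_E \<omega>) = Pi_E \<omega>"
  unfolding Pi_E_eq[of "Pi_E \<omega>"] d_Pi_E[OF assms] K_Pi_E[OF assms] K_Pi_E[OF ext_d_forms[OF assms]]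
    ext_d_zero by simp

abbreviation "P0 \<equiv> extend Pi0"

lemmas P0_lin = extend_lin_op[OF Pi0_lin_op]
lemmas P0_forms = extend_forms[OF Pi0_lin_op]

lemma P0_eq: "\<omega> \<in> forms \<Longrightarrow> P0 \<omega> = \<omega> - Q (extend d0 \<omega>) - extend d0 (Q \<omega>)"
  by (simp add: fun_eq_iff extend_apply Pi0_eq forms_alt)

lemma Q_d0_Q: "\<omega> \<in> forms \<Longrightarrow> Q (extend d0 (Q \<omega>)) = Q \<omega>"
  by (intro Q_d0_of_coexact Q_coexact)

lemma P0_of_coexact:
  assumes "h \<in> coexact_forms"
  shows "P0 h = 0"
  unfolding P0_eq[OF coexact_forms_forms[OF assms]] Q_d0_of_coexact[OF assms] Q_of_coexact[OF assms]
  using Fs.lin_op_zero[OF extend_lin_op[OF d0_lin_op] forms_subspace] by simp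

lemma Q_P0:
  assumes "\<omega> \<in> forms"
  shows "Q (P0 \<omega>) = 0"
proof -
  note f = extend_forms[OF d0_lin_op assms] Q_forms[OF assms]
  have "Q (P0 \<omega>) = Q \<omega> - Q (Q (extend d0 \<omega>)) - Q (extend d0 (Q \<omega>))"
    unfolding P0_eq[OF assms]
    by (simp only: Fs.lin_op_diff[OF Q_lin forms_subspace] assms f forms_diff Q_forms extend_forms[OF d0_lin_op])
  then show ?thesis
    by (simp only: Q_d0_Q[OF assms] Q_of_coexact[OF Q_coexact[OF f(1)]]) simp
qed

lemma P0_P0:
  assumes "\<omega> \<in> forms"
  shows "P0 (P0 \<omega>) = P0 \<omega>"
proof -
  have "d0 (Pi0 \<alpha>) = 0" if "\<alpha> \<in> alt_forms" for \<alpha>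
    using that by (simp add: Pi0_eq d0_diff alt_diff d0_alt d0inv_alt d0_d0inv_d0 d0_d0)
  then have "extend d0 (P0 \<omega>) = 0"
    using forms_alt[OF assms] by (simp add: extend_apply fun_eq_iff)
  then show ?thesis
    unfolding P0_eq[OF P0_forms[OF assms]] Q_P0[OF assms]
    using Q_0 Fs.lin_op_zero[OF extend_lin_op[OF d0_lin_op] forms_subspace] by simp
qed

text \<open>On the image of \<open>Pi_E\<close>, where \<open>Q\<close> vanishes, \<open>P0\<close>
  differs from the identity only by an H-valued form, and \<open>Pi_E\<close> kills those.\<close>

lemma Pi_E_P0_Pi_E:
  assumes "\<omega> \<in> forms"
  shows "Pi_E (P0 (Pi_E \<omega>)) = Pi_E \<omega>"
proof -
  note e = Pi_E_forms[OF assms]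
  have "P0 (Pi_E \<omega>) = Pi_E \<omega> - Q (extend d0 (Pi_E \<omega>))"
    unfolding P0_eq[OF e] Q_Pi_E[OF assms]
    using Fs.lin_op_zero[OF extend_lin_op[OF d0_lin_op] forms_subspace] by simp
  then have "Pi_E (P0 (Pi_E \<omega>)) = Pi_E (Pi_E \<omega>) - Pi_E (Q (extend d0 (Pi_E \<omega>)))"
    by (simp only: Fs.lin_op_diff[OF Pi_E_lin forms_subspace] e Q_forms extend_forms[OF d0_lin_op])
  also have "\<dots> = Pi_E \<omega>"
    unfolding Pi_E_of_coexact[OF Q_coexact[OF extend_forms[OF d0_lin_op e]]] Pi_E_Pi_E[OF assms] by simp
  finally show ?thesis .
qed

text \<open>The mirror image: \<open>Q P0 = 0\<close> reduces \<open>Pi_E P0\<close> to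
  \<open>P0 - K d P0\<close>, and \<open>P0\<close> kills H-valued forms.\<close>

lemma P0_Pi_E_P0:
  assumes "\<omega> \<in> forms"
  shows "P0 (Pi_E (P0 \<omega>)) = P0 \<omega>"
proof -
  note p = P0_forms[OF assms]
  note dp = ext_d_forms[OF p]
  have "Pi_E (P0 \<omega>) = P0 \<omega> - K (ext_d (P0 \<omega>))"
    unfolding Pi_E_eq Q_P0[OF assms] J_0 ext_d_zero by simp
  then have "P0 (Pi_E (P0 \<omega>)) = P0 (P0 \<omega>) - P0 (K (ext_d (P0 \<omega>)))"
    by (simp only: Fs.lin_op_diff[OF P0_lin forms_subspace] p K_forms dp)
  also have "\<dots> = P0 \<omega>"
    unfolding P0_of_coexact[OF K_coexact[OF dp]] P0_P0[OF assms] by simp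
  finally show ?thesis .
qed

end


section \<open>The spectral projection\<close>

context homogeneous_group
begin

subsection \<open>Complexified operators\<close>

text \<open>Complexified operators act separately on real and imaginary parts, so complex statements
  are proved as pairs of real ones.\<close>

definition re_form :: "('g \<Rightarrow> 'g vfield list \<Rightarrow> complex) \<Rightarrow> 'g \<Rightarrow> 'g vfield list \<Rightarrow> real" where
  "re_form \<omega> = (\<lambda>x Vs. Re (\<omega> x Vs))"

definition im_form :: "('g \<Rightarrow> 'g vfield list \<Rightarrow> complex) \<Rightarrow> 'g \<Rightarrow> 'g vfield list \<Rightarrow> real" where
  "im_form \<omega> = (\<lambda>x Vs. Im (\<omega> x Vs))"

lemma complex_forms_iff: "\<omega> \<in> complex_forms \<longleftrightarrow> re_form \<omega> \<in> forms \<and> im_form \<omega> \<in> forms"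
  by (simp add: complex_forms_def re_form_def im_form_def)

lemma re_form_complexify: "re_form (complexify T \<omega>) = T (re_form \<omega>)"
  and im_form_complexify: "im_form (complexify T \<omega>) = T (im_form \<omega>)"
  by (simp_all add: complexify_def re_form_def im_form_def)

lemma complex_form_eqI: "re_form \<omega> = re_form \<eta> \<Longrightarrow> im_form \<omega> = im_form \<eta> \<Longrightarrow> \<omega> = \<eta>"
  by (simp add: re_form_def im_form_def fun_eq_iff complex_eq_iff)

text \<open>This one shape covers sums, differences and multiples of complex forms; it is the origin
  of the factors \<open>1\<close> and \<open>- 1\<close> in later formulas.\<close>

lemma re_form_lin_comb: "re_form (\<lambda>x Vs. c * \<omega> x Vs + c' * \<eta> x Vs) =
    (Fscale (Re c) (re_form \<omega>) - Fscale (Im c) (im_form \<omega>)) +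
    (Fscale (Re c') (re_form \<eta>) - Fscale (Im c') (im_form \<eta>))"
  and im_form_lin_comb: "im_form (\<lambda>x Vs. c * \<omega> x Vs + c' * \<eta> x Vs) =
    (Fscale (Re c) (im_form \<omega>) + Fscale (Im c) (re_form \<omega>)) +
    (Fscale (Re c') (im_form \<eta>) + Fscale (Im c') (re_form \<eta>))"
  by (simp_all add: re_form_def im_form_def fun_eq_iff)

lemma complex_forms_lin_comb:
  "\<omega> \<in> complex_forms \<Longrightarrow> \<eta> \<in> complex_forms \<Longrightarrow> (\<lambda>x Vs. c * \<omega> x Vs + c' * \<eta> x Vs) \<in> complex_forms"
  unfolding complex_forms_iff re_form_lin_comb im_form_lin_comb
  by (intro conjI forms_add forms_diff forms_scale) auto

lemma complexify_forms: "Fs.lin_op forms T \<Longrightarrow> \<omega> \<in> complex_forms \<Longrightarrow> complexify T \<omega> \<in> complex_forms"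
  by (simp add: complex_forms_iff re_form_complexify im_form_complexify Fs.lin_op_mem)

lemma complexify_lin_comb:
  assumes T: "Fs.lin_op forms T" and "\<omega> \<in> complex_forms" "\<eta> \<in> complex_forms"
  shows "complexify T (\<lambda>x Vs. c * \<omega> x Vs + c' * \<eta> x Vs) =
    (\<lambda>x Vs. c * complexify T \<omega> x Vs + c' * complexify T \<eta> x Vs)"
proof (rule complex_form_eqI)
  have f: "re_form \<omega> \<in> forms" "im_form \<omega> \<in> forms" "re_form \<eta> \<in> forms" "im_form \<eta> \<in> forms"
    using assms by (auto simp: complex_forms_iff)
  show "re_form (complexify T (\<lambda>x Vs. c * \<omega> x Vs + c' * \<eta> x Vs)) =
      re_form (\<lambda>x Vs. c * complexify T \<omega> x Vs + c' * complexify T \<eta> x Vs)"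
    unfolding re_form_complexify im_form_complexify re_form_lin_comb im_form_lin_comb
    by (simp only: Fs.lin_op_add[OF T] Fs.lin_op_diff[OF T forms_subspace] Fs.lin_op_scale[OF T]
        forms_add forms_diff forms_scale f)
  show "im_form (complexify T (\<lambda>x Vs. c * \<omega> x Vs + c' * \<eta> x Vs)) =
      im_form (\<lambda>x Vs. c * complexify T \<omega> x Vs + c' * complexify T \<eta> x Vs)"
    unfolding re_form_complexify im_form_complexify re_form_lin_comb im_form_lin_comb
    by (simp only: Fs.lin_op_add[OF T] Fs.lin_op_diff[OF T forms_subspace] Fs.lin_op_scale[OF T]
        forms_add forms_diff forms_scale f)
qed

lemma re_form_of_real: "re_form (of_real_form \<omega>) = \<omega>"
  and im_form_of_real: "im_form (of_real_form \<omega>) = 0"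
  by (intro ext; simp add: re_form_def im_form_def of_real_form_def)+

lemma of_real_form_forms: "\<omega> \<in> forms \<Longrightarrow> of_real_form \<omega> \<in> complex_forms"
  by (simp add: complex_forms_iff re_form_of_real im_form_of_real forms_0)

lemma complexify_of_real:
  assumes "Fs.lin_op forms T"
  shows "complexify T (of_real_form \<omega>) = of_real_form (T \<omega>)"
proof (rule complex_form_eqI)
  show "re_form (complexify T (of_real_form \<omega>)) = re_form (of_real_form (T \<omega>))"
    by (simp only: re_form_complexify re_form_of_real)
  show "im_form (complexify T (of_real_form \<omega>)) = im_form (of_real_form (T \<omega>))"
    by (simp only: im_form_complexify im_form_of_real Fs.lin_op_zero[OF assms forms_subspace])
qed

lemma complexify_complexify_commute:
  assumes "\<And>\<omega>. \<omega> \<in> forms \<Longrightarrow> T (R \<omega>) = R (T \<omega>)" "\<omega> \<in> complex_forms"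
  shows "complexify T (complexify R \<omega>) = complexify R (complexify T \<omega>)"
  by (rule complex_form_eqI) (use assms in \<open>simp_all add: re_form_complexify im_form_complexify complex_forms_iff\<close>)

subsection \<open>The operator \<open>box\<close>\<close>

lemmas d0t_ext_lin = extend_lin_op[OF d0t_lin_op]

lemma box_lin: "Fs.lin_op forms box"
proof -
  have "box = (\<lambda>\<omega>. ext_d (extend d0t \<omega>) + extend d0t (ext_d \<omega>))" by (intro ext) (simp only: box_def)
  then show ?thesis
    using Fs.lin_op_plus[OF Fs.lin_op_comp[OF ext_d_lin_op d0t_ext_lin]
        Fs.lin_op_comp[OF d0t_ext_lin ext_d_lin_op] forms_subspace] by simp
qed

text \<open>By \<open>d d = 0\<close> both sides reduce to
  \<open>d d\<^sub>0\<^sup>t d\<close>.\<close>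

lemma box_ext_d:
  assumes "\<omega> \<in> forms"
  shows "box (ext_d \<omega>) = ext_d (box \<omega>)"
proof -
  have f: "ext_d (extend d0t \<omega>) \<in> forms" "extend d0t (ext_d \<omega>) \<in> forms"
    using assms by (auto intro!: ext_d_forms extend_forms d0t_lin_op)
  show ?thesis
    unfolding box_def Fs.lin_op_add[OF ext_d_lin_op f] ext_d_ext_d[OF assms]
      ext_d_ext_d[OF extend_forms[OF d0t_lin_op assms]] Fs.lin_op_zero[OF d0t_ext_lin forms_subspace]
    by simp
qed

lemma box_eq_0:
  assumes "\<omega> \<in> forms" "Q \<omega> = 0" "Q (ext_d \<omega>) = 0"
  shows "box \<omega> = 0"
proof -
  have "extend d0t \<eta> = 0" if "Q \<eta> = 0" for \<eta>
    using that d0inv_eq_0D by (simp add: fun_eq_iff[of "extend _ _"] extend_apply) (metis ext zero_fun_apply)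
  then show ?thesis using assms by (simp add: box_def ext_d_zero)
qed

text \<open>The difference is \<open>(d - d\<^sub>0) d\<^sub>0\<^sup>t + d\<^sub>0\<^sup>t (d -
  d\<^sub>0)\<close>, and the adjoint keeps the filtration.\<close>

lemma box_minus_box0_filt:
  assumes "\<omega> \<in> form_filt t"
  shows "box \<omega> - extend box0 \<omega> \<in> form_filt (t + \<upsilon> 1)"
proof -
  have \<omega>: "\<omega> \<in> forms" using assms by (simp add: form_filt_def)
  have f: "extend d0t \<omega> \<in> form_filt t"
    by (rule extend_form_filt[OF d0t_lin_op pullback_d0t assms])
  have "ext_d (extend d0t \<omega>) - extend d0 (extend d0t \<omega>) + extend d0t (ext_d \<omega> - extend d0 \<omega>)
      \<in> form_filt (t + \<upsilon> 1)"
    by (intro Fs.subspace_add[OF form_filt_subspace] d_minus_d0_filt f assms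
        extend_form_filt[OF d0t_lin_op pullback_d0t])
  moreover have "extend d0t (ext_d \<omega> - extend d0 \<omega>) = extend d0t (ext_d \<omega>) - extend d0t (extend d0 \<omega>)"
    by (intro Fs.lin_op_diff[OF d0t_ext_lin forms_subspace] ext_d_forms extend_forms d0_lin_op \<omega>)
  moreover have "extend box0 \<omega> = extend d0 (extend d0t \<omega>) + extend d0t (extend d0 \<omega>)"
    by (simp add: fun_eq_iff extend_apply box0_def)
  ultimately show ?thesis by (simp add: box_def algebra_simps)
qed

text \<open>With z = a + \<i> b, this is injectivity of \<open>z - box0\<close> on \<alpha> + \<i>
  \<beta>. Symmetry of \<open>box0\<close>, tested on the pair, forces b times the sum of the
  squared norms to be 0, so only real eigenvalues can obstruct.\<close>

lemma box0_pair_eq_0: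
  assumes \<alpha>: "\<alpha> \<in> alt_forms" and \<beta>: "\<beta> \<in> alt_forms"
    and 1: "fscale a \<alpha> - fscale b \<beta> - box0 \<alpha> = 0" and 2: "fscale a \<beta> + fscale b \<alpha> - box0 \<beta> = 0"
    and ne: "b \<noteq> 0 \<or> \<not> eigenvalue_box0 a"
  shows "\<alpha> = 0 \<and> \<beta> = 0"
proof -
  have e1: "box0 \<alpha> = fscale a \<alpha> - fscale b \<beta>" and e2: "box0 \<beta> = fscale a \<beta> + fscale b \<alpha>"
    using 1 2 by simp_all
  have "ip (box0 \<alpha>) \<beta> = ip \<alpha> (box0 \<beta>)" by (rule box0_symmetric[OF \<alpha> \<beta>])
  then have *: "b * (ip \<alpha> \<alpha> + ip \<beta> \<beta>) = 0"
    unfolding e1 e2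
    by (simp add: ip_diff_left ip_add_right ip_scale_left ip_scale_right algebra_simps)
  show ?thesis
  proof (cases "b = 0")
    case True
    have "\<gamma> = 0" if "\<gamma> \<in> alt_forms" "box0 \<gamma> = fscale a \<gamma>" for \<gamma>
      using that ne True unfolding eigenvalue_box0_def fscale_def by blast
    then show ?thesis using e1 e2 \<alpha> \<beta> True by simp
  next
    case False
    then have "ip \<alpha> \<alpha> = 0" "ip \<beta> \<beta> = 0"
      using * ip_self_nonneg[of \<alpha>] ip_self_nonneg[of \<beta>] by auto
    then show ?thesis using \<alpha> \<beta> ip_self_eq_0 by blast
  qed
qed

text \<open>The same modulo \<open>filt t\<close>: a polynomial in the dilation with kernel
  \<open>filt t\<close> commutes with \<open>box0\<close> and turns the memberships into the
  equations already treated.\<close>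

lemma box0_pair_filt:
  assumes \<alpha>: "\<alpha> \<in> alt_forms" and \<beta>: "\<beta> \<in> alt_forms"
    and 1: "fscale a \<alpha> - fscale b \<beta> - box0 \<alpha> \<in> filt t" and 2: "fscale a \<beta> + fscale b \<alpha> - box0 \<beta> \<in> filt t"
    and ne: "b \<noteq> 0 \<or> \<not> eigenvalue_box0 a"
  shows "\<alpha> \<in> filt t \<and> \<beta> \<in> filt t"
proof -
  obtain ls where ls: "filt t = {\<alpha> \<in> alt_forms. shift_prod ls \<alpha> = 0}" by (rule filt_eq_kernel)
  let ?S = "shift_prod ls"
  note S = shift_prod_lin_op[of ls]
  have comm: "box0 (?S \<gamma>) = ?S (box0 \<gamma>)" if "\<gamma> \<in> alt_forms" for \<gamma>
    by (rule shift_prod_commute[OF box0_lin_op pullback_box0 that])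
  note mem = \<alpha> \<beta> fs.lin_op_mem[OF box0_lin_op \<alpha>] fs.lin_op_mem[OF box0_lin_op \<beta>]
  have "?S (fscale a \<alpha> - fscale b \<beta> - box0 \<alpha>) = 0" "?S (fscale a \<beta> + fscale b \<alpha> - box0 \<beta>) = 0"
    using 1 2 ls by auto
  then have "fscale a (?S \<alpha>) - fscale b (?S \<beta>) - box0 (?S \<alpha>) = 0"
    "fscale a (?S \<beta>) + fscale b (?S \<alpha>) - box0 (?S \<beta>) = 0"
    unfolding comm[OF \<alpha>] comm[OF \<beta>]
    by (simp_all only: fs.lin_op_diff[OF S alt_forms_subspace] fs.lin_op_add[OF S] fs.lin_op_scale[OF S]
        alt_add alt_diff alt_scale mem)
  from box0_pair_eq_0[OF _ _ this ne] show ?thesis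
    using ls \<alpha> \<beta> fs.lin_op_mem[OF S] by blast
qed

text \<open>A kernel element satisfies \<open>(z - box0) \<omega> = (box - box0) \<omega>\<close>,
  whose right side lies one step further in the filtration; hence so does \<omega>, and iteration
  leads past the top weight.\<close>

lemma resolvent_kernel:
  assumes \<omega>: "\<omega> \<in> complex_forms" and ker: "(\<lambda>x Vs. z * \<omega> x Vs - complexify box \<omega> x Vs) = (\<lambda>_ _. 0)"
    and ne: "Im z \<noteq> 0 \<or> \<not> eigenvalue_box0 (Re z)"
  shows "\<omega> = (\<lambda>_ _. 0)"
proof -
  let ?u = "re_form \<omega>" and ?w = "im_form \<omega>"
  have f: "?u \<in> forms" "?w \<in> forms" using \<omega> by (auto simp: complex_forms_iff)
  have k: "z * \<omega> x Vs = complexify box \<omega> x Vs" for x Vs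
    using fun_cong[OF fun_cong[OF ker, of x], of Vs] by simp
  have e1: "Fscale (Re z) ?u - Fscale (Im z) ?w = box ?u"
    unfolding re_form_complexify[of box, symmetric] by (simp add: fun_eq_iff re_form_def im_form_def k[symmetric])
  have e2: "Fscale (Re z) ?w + Fscale (Im z) ?u = box ?w"
    unfolding im_form_complexify[of box, symmetric] by (simp add: fun_eq_iff re_form_def im_form_def k[symmetric])
  have step: "?u \<in> form_filt (t + \<upsilon> 1) \<and> ?w \<in> form_filt (t + \<upsilon> 1)"
    if "?u \<in> form_filt t" "?w \<in> form_filt t" for t
  proof -
    have "?u x \<in> filt (t + \<upsilon> 1) \<and> ?w x \<in> filt (t + \<upsilon> 1)" for x
    proof (rule box0_pair_filt[OF forms_alt[OF f(1)] forms_alt[OF f(2)] _ _ ne])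
      have "fscale (Re z) (?u x) - fscale (Im z) (?w x) - box0 (?u x) = (box ?u - extend box0 ?u) x"
        unfolding e1[symmetric] by (simp add: extend_apply Fscale_at)
      then show "fscale (Re z) (?u x) - fscale (Im z) (?w x) - box0 (?u x) \<in> filt (t + \<upsilon> 1)"
        using box_minus_box0_filt[OF that(1)] by (simp add: form_filt_def)
      have "fscale (Re z) (?w x) + fscale (Im z) (?u x) - box0 (?w x) = (box ?w - extend box0 ?w) x"
        unfolding e2[symmetric] by (simp add: extend_apply Fscale_at)
      then show "fscale (Re z) (?w x) + fscale (Im z) (?u x) - box0 (?w x) \<in> filt (t + \<upsilon> 1)"
        using box_minus_box0_filt[OF that(2)] by (simp add: form_filt_def)
    qed
    then show ?thesis using f by (simp add: form_filt_def)
  qed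
  have "?u \<in> form_filt (k * \<upsilon> 1) \<and> ?w \<in> form_filt (k * \<upsilon> 1)" for k :: nat
  proof (induction k)
    case (Suc k)
    then show "?u \<in> form_filt (Suc k * \<upsilon> 1) \<and> ?w \<in> form_filt (Suc k * \<upsilon> 1)"
      using step[of "k * \<upsilon> 1"] by (simp add: algebra_simps)
  qed (use f in \<open>simp add: form_filt_0\<close>)
  moreover obtain N where "(\<Sum>i=1..n. \<upsilon> i) < of_nat N * \<upsilon> 1"
    using reals_Archimedean3[OF weight_min_pos] by blast
  ultimately have "?u = 0" "?w = 0" using form_filt_top by blast+
  then show ?thesis
    by (intro complex_form_eqI) (simp_all add: re_form_def im_form_def fun_eq_iff)
qed

lemma resolvent_eqI:
  assumes \<eta>: "\<eta> \<in> complex_forms" and eq: "(\<lambda>x Vs. z * \<eta> x Vs - complexify box \<eta> x Vs) = \<omega>"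
    and ne: "Im z \<noteq> 0 \<or> \<not> eigenvalue_box0 (Re z)"
  shows "resolvent z \<omega> = \<eta>"
  unfolding resolvent_def
proof (rule inv_into_f_eq)
  show "\<eta> \<in> complex_forms" "(\<lambda>x Vs. z * \<eta> x Vs - complexify box \<eta> x Vs) = \<omega>"
    by (fact \<eta>, fact eq)
  show "inj_on (\<lambda>\<omega> x Vs. z * \<omega> x Vs - complexify box \<omega> x Vs) complex_forms"
  proof (rule inj_onI)
    fix \<omega> \<eta> assume f: "\<omega> \<in> complex_forms" "\<eta> \<in> complex_forms"
      and eq: "(\<lambda>x Vs. z * \<omega> x Vs - complexify box \<omega> x Vs) = (\<lambda>x Vs. z * \<eta> x Vs - complexify box \<eta> x Vs)"
    let ?d = "\<lambda>x Vs. 1 * \<omega> x Vs + (- 1) * \<eta> x Vs"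
    have "z * \<omega> x Vs - complexify box \<omega> x Vs = z * \<eta> x Vs - complexify box \<eta> x Vs" for x Vs
      using fun_cong[OF fun_cong[OF eq, of x], of Vs] .
    then have "(\<lambda>x Vs. z * ?d x Vs - complexify box ?d x Vs) = (\<lambda>_ _. 0)"
      unfolding complexify_lin_comb[OF box_lin f] by (simp add: fun_eq_iff algebra_simps)
    then have "?d = (\<lambda>_ _. 0)"
      by (rule resolvent_kernel[OF complex_forms_lin_comb[OF f] _ ne])
    then have "\<omega> x Vs = \<eta> x Vs" for x Vs
      using fun_cong[OF fun_cong[of ?d "\<lambda>_ _. 0" x], of Vs] by simp
    then show "\<omega> = \<eta>" by (intro ext)
  qed
qed

subsection \<open>Holomorphic solutions of the resolvent equation\<close>

text \<open>Finite sums of fixed real forms with holomorphic scalar coefficients. Complexified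
  operators act on them term by term, so holomorphy survives without a topology on forms.\<close>

inductive holo_family :: "real \<Rightarrow> (complex \<Rightarrow> 'g \<Rightarrow> 'g vfield list \<Rightarrow> complex) \<Rightarrow> bool" for \<rho> where
  zero: "holo_family \<rho> (\<lambda>z x Vs. 0)"
| step: "holo_family \<rho> f \<Longrightarrow> c holomorphic_on ball 0 \<rho> \<Longrightarrow> \<omega> \<in> forms \<Longrightarrow>
    holo_family \<rho> (\<lambda>z x Vs. c z * of_real_form \<omega> x Vs + 1 * f z x Vs)"

lemma zero_complex_form: "(\<lambda>_ _. 0) \<in> complex_forms"
  using of_real_form_forms[OF forms_0] by (simp add: of_real_form_def)

lemma holo_family_form: "holo_family \<rho> f \<Longrightarrow> f z \<in> complex_forms"
proof (induction rule: holo_family.induct)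
  case (step f c \<omega>)
  then show ?case by (intro complex_forms_lin_comb of_real_form_forms)
qed (rule zero_complex_form)

lemma holo_family_holomorphic: "holo_family \<rho> f \<Longrightarrow> (\<lambda>z. f z x Vs) holomorphic_on ball 0 \<rho>"
  by (induction rule: holo_family.induct) (auto intro!: holomorphic_intros)

lemma holo_family_add: "holo_family \<rho> f \<Longrightarrow> holo_family \<rho> g \<Longrightarrow> holo_family \<rho> (\<lambda>z x Vs. f z x Vs + g z x Vs)"
proof (induction rule: holo_family.induct)
  case (step f c \<omega>)
  from holo_family.step[OF step.IH[OF step.prems] step.hyps(2,3)]
  show ?case by (simp add: add.assoc)
qed simp

lemma holo_family_mult:
  "holo_family \<rho> f \<Longrightarrow> a holomorphic_on ball 0 \<rho> \<Longrightarrow> holo_family \<rho> (\<lambda>z x Vs. a z * f z x Vs)"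
proof (induction rule: holo_family.induct)
  case (step f c \<omega>)
  from holo_family.step[OF step.IH[OF step.prems] holomorphic_on_mult[OF step.prems step.hyps(2)] step.hyps(3)]
  show ?case by (simp add: algebra_simps)
qed (simp add: holo_family.zero)

lemma holo_family_sum:
  "(\<And>b. b \<in> B \<Longrightarrow> holo_family \<rho> (f b)) \<Longrightarrow> holo_family \<rho> (\<lambda>z x Vs. \<Sum>b\<in>B. f b z x Vs)"
  by (induction B rule: infinite_finite_induct) (auto intro: holo_family.zero holo_family_add)

lemma complexify_zero:
  assumes "Fs.lin_op forms T"
  shows "complexify T (\<lambda>_ _. 0) = (\<lambda>_ _. 0)"
proof -
  have "of_real_form 0 = (\<lambda>_ _. 0)" by (simp add: of_real_form_def)
  then show ?thesis
    using complexify_of_real[OF assms, of 0] Fs.lin_op_zero[OF assms forms_subspace] by simp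
qed

lemma holo_family_complexify:
  assumes T: "Fs.lin_op forms T" and f: "holo_family \<rho> f"
  shows "holo_family \<rho> (\<lambda>z. complexify T (f z))"
  using f
proof (induction rule: holo_family.induct)
  case zero
  show ?case by (simp add: complexify_zero[OF T] holo_family.zero)
next
  case (step f c \<omega>)
  show ?case
    unfolding complexify_lin_comb[OF T of_real_form_forms[OF step.hyps(3)] holo_family_form[OF step.hyps(1)]]
      complexify_of_real[OF T]
    by (rule holo_family.step[OF step.IH step.hyps(2) Fs.lin_op_mem[OF T step.hyps(3)]])
qed

text \<open>A solution of the resolvent equation without pole in the disc, its centre 0
  included.\<close>

definition solves :: "real \<Rightarrow> (complex \<Rightarrow> 'g \<Rightarrow> 'g vfield list \<Rightarrow> complex) \<Rightarrow>
    ('g \<Rightarrow> 'g vfield list \<Rightarrow> real) \<Rightarrow> bool" where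
  "solves \<rho> \<eta> h \<longleftrightarrow> holo_family \<rho> \<eta> \<and>
     (\<forall>z\<in>ball 0 \<rho>. \<forall>x Vs. z * \<eta> z x Vs - complexify box (\<eta> z) x Vs = of_real (h x Vs))"

lemma complexify_sum:
  assumes T: "Fs.lin_op forms T" and "\<And>b. b \<in> B \<Longrightarrow> f b \<in> complex_forms"
  shows "(\<lambda>x Vs. \<Sum>b\<in>B. c b * f b x Vs) \<in> complex_forms \<and>
    complexify T (\<lambda>x Vs. \<Sum>b\<in>B. c b * f b x Vs) = (\<lambda>x Vs. \<Sum>b\<in>B. c b * complexify T (f b) x Vs)"
  using assms(2)
proof (induction B rule: infinite_finite_induct)
  case (insert b B)
  have f: "f b \<in> complex_forms" "(\<lambda>x Vs. \<Sum>b\<in>B. c b * f b x Vs) \<in> complex_forms"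
    and IH: "complexify T (\<lambda>x Vs. \<Sum>b\<in>B. c b * f b x Vs) = (\<lambda>x Vs. \<Sum>b\<in>B. c b * complexify T (f b) x Vs)"
    using insert by auto
  have "(\<lambda>x Vs. \<Sum>b\<in>insert b B. c b * f b x Vs) = (\<lambda>x Vs. c b * f b x Vs + 1 * (\<Sum>b\<in>B. c b * f b x Vs))"
    using insert by simp
  then show ?case
    using complex_forms_lin_comb[OF f, of "c b" 1] complexify_lin_comb[OF T f, of "c b" 1] insert.hyps
    by (simp add: IH)
qed (simp_all add: zero_complex_form complexify_zero[OF T])

text \<open>\<open>box\<close> commutes with d, so solvability passes from H-valued forms to their
  exterior derivatives.\<close>

lemma solves_ext_d:
  assumes "solves \<rho> \<eta> h"
  shows "solves \<rho> (\<lambda>z. complexify ext_d (\<eta> z)) (ext_d h)"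
  unfolding solves_def
proof (intro conjI ballI allI)
  have fam: "holo_family \<rho> \<eta>" using assms by (simp add: solves_def)
  show "holo_family \<rho> (\<lambda>z. complexify ext_d (\<eta> z))"
    by (rule holo_family_complexify[OF ext_d_lin_op fam])
  fix z :: complex and x Vs assume z: "z \<in> ball 0 \<rho>"
  note f = holo_family_form[OF fam, where z = z]
  have eq: "(\<lambda>x Vs. z * \<eta> z x Vs + (- 1) * complexify box (\<eta> z) x Vs) = of_real_form h"
    using assms z by (auto simp: solves_def of_real_form_def fun_eq_iff)
  have "(\<lambda>x Vs. z * complexify ext_d (\<eta> z) x Vs + (- 1) * complexify ext_d (complexify box (\<eta> z)) x Vs) =
      of_real_form (ext_d h)"
    unfolding complexify_lin_comb[OF ext_d_lin_op f complexify_forms[OF box_lin f], symmetric] eq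
    by (rule complexify_of_real[OF ext_d_lin_op])
  moreover have "complexify box (complexify ext_d (\<eta> z)) = complexify ext_d (complexify box (\<eta> z))"
    by (rule complexify_complexify_commute[of box ext_d "\<eta> z", OF box_ext_d f])
  ultimately have "(\<lambda>x Vs. z * complexify ext_d (\<eta> z) x Vs + (- 1) * complexify box (complexify ext_d (\<eta> z)) x Vs) =
      of_real_form (ext_d h)"
    by (simp only:)
  from fun_cong[OF fun_cong[OF this, of x], of Vs]
  show "z * complexify ext_d (\<eta> z) x Vs - complexify box (complexify ext_d (\<eta> z)) x Vs = of_real (ext_d h x Vs)"
    by (simp add: of_real_form_def)
qed

text \<open>Diagonalising the dilation along with \<open>box0\<close> makes the projections onto
  single basis vectors commute with it, hence preserve the filtration. The eigenvalues are nonzero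
  because \<open>box0\<close> is injective on H.\<close>

lemma coexact_eigenbasis:
  "\<exists>B \<mu> \<sigma>. finite B \<and> B \<subseteq> coexact \<and>
    (\<forall>b\<in>B. box0 b = fscale (\<mu> b) b) \<and> (\<forall>b\<in>B. pullback b = fscale (\<sigma> b) b) \<and>
    (\<forall>f\<in>coexact. f = (\<Sum>b\<in>B. fscale (ip f b) b)) \<and>
    (\<forall>b\<in>B. \<mu> b \<noteq> 0 \<and> eigenvalue_box0 (\<mu> b))"
proof -
  have lin: "fs.lin_op coexact box0" "fs.lin_op coexact pullback"
    using box0_lin_op pullback_lin_op
    by (auto simp: fs.lin_op_def coexact_alt box0_coexact(2) pullback_coexact)
  have "\<exists>B. ev.orthonormal B \<and> B \<subseteq> coexact \<and>
      (\<forall>b\<in>B. (\<exists>\<mu>. box0 b = fscale \<mu> b) \<and> (\<exists>\<sigma>. pullback b = fscale \<sigma> b)) \<and>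
      (\<forall>f\<in>coexact. f = (\<Sum>b\<in>B. fscale (ip f b) b))"
  proof (rule ev.simultaneous_eigenbasis[OF coexact_subspace _ lin, folded ip_eq_dot])
    fix B
    assume B: "ev.orthonormal B" "B \<subseteq> coexact"
      "\<And>b. b \<in> B \<Longrightarrow> (\<exists>\<mu>. box0 b = fscale \<mu> b) \<and> (\<exists>\<sigma>. pullback b = fscale \<sigma> b)"
      "\<And>f. f \<in> coexact \<Longrightarrow> f = (\<Sum>b\<in>B. fscale (ip f b) b)"
    show ?thesis
      by (intro exI[of _ B] conjI ballI B(1,2,4) conjunct1[OF B(3)] conjunct2[OF B(3)])
  qed (auto simp: coexact_alt box0_symmetric pullback_symmetric pullback_box0)
  then obtain B where B: "ev.orthonormal B" "B \<subseteq> coexact"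
    "\<forall>b\<in>B. (\<exists>\<mu>. box0 b = fscale \<mu> b) \<and> (\<exists>\<sigma>. pullback b = fscale \<sigma> b)"
    "\<forall>f\<in>coexact. f = (\<Sum>b\<in>B. fscale (ip f b) b)"
    by (elim exE conjE)
  obtain \<mu> where \<mu>: "\<And>b. b \<in> B \<Longrightarrow> box0 b = fscale (\<mu> b) b" using B(3) by metis
  obtain \<sigma> where \<sigma>: "\<And>b. b \<in> B \<Longrightarrow> pullback b = fscale (\<sigma> b) b" using B(3) by metis
  have ne: "\<mu> b \<noteq> 0 \<and> eigenvalue_box0 (\<mu> b)" if b: "b \<in> B" for b
  proof -
    have "ip b b = 1" using B(1) b unfolding ev.orthonormal_def ip_eq_dot by simp
    then have "b \<noteq> 0" by auto
    moreover have "b \<in> coexact" using b B by auto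
    moreover have "\<mu> b \<noteq> 0"
      using \<mu>[OF b] box0_coexact_eq_0[OF \<open>b \<in> coexact\<close>] \<open>b \<noteq> 0\<close> by (metis fs.scale_zero_left)
    ultimately show ?thesis
      using \<mu>[OF b] coexact_alt[of b] unfolding eigenvalue_box0_def fscale_def by blast
  qed
  have "finite B" using B(1) unfolding ev.orthonormal_def by simp
  then show ?thesis
    by (intro exI[of _ B] exI[of _ \<mu>] exI[of _ \<sigma>] conjI B(2,4) ballI \<mu> \<sigma>) (use ne in auto)
qed

text \<open>The adjoint of \<open>d0\<close> vanishes on H, so \<open>box h\<close> and
  \<open>box0 h\<close> are both images under it and return to H.\<close>

lemma coexact_remainder:
  assumes "h \<in> coexact_forms" "h \<in> form_filt t"
  shows "box h - extend box0 h \<in> coexact_forms" and "box h - extend box0 h \<in> form_filt (t + \<upsilon> 1)"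
proof -
  note h = coexact_forms_forms[OF assms(1)]
  have "extend d0t h = 0"
    using assms(1) by (simp add: coexact_forms_def fun_eq_iff extend_apply d0t_of_coexact)
  then have "box h = extend d0t (ext_d h)" by (simp add: box_def ext_d_zero)
  moreover have "extend box0 h = extend d0t (extend d0 h)"
    using assms(1) by (simp add: coexact_forms_def fun_eq_iff extend_apply box0_coexact)
  ultimately show "box h - extend box0 h \<in> coexact_forms"
    unfolding coexact_forms_def
    using h by (auto simp: extend_apply intro!: forms_diff extend_forms ext_d_forms d0_lin_op d0t_lin_op
        fs.subspace_diff[OF coexact_subspace] d0t_coexact)
  show "box h - extend box0 h \<in> form_filt (t + \<upsilon> 1)" by (rule box_minus_box0_filt[OF assms(2)])
qed

text \<open>Descending induction on the filtration level, starting above the top weight, where h =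
  0. Dividing an eigencomponent of h by \<open>z - \<mu> b\<close> solves the equation for
  \<open>box0\<close>; the error \<open>box - box0\<close> is again H-valued and one level higher,
  where a solution is already available.\<close>

lemma solvable:
  assumes \<rho>: "\<And>b. b \<in> B \<Longrightarrow> \<rho> \<le> \<mu> b"
    and B: "finite B" "B \<subseteq> coexact"
    and \<mu>: "\<And>b. b \<in> B \<Longrightarrow> box0 b = fscale (\<mu> b) b" and \<sigma>: "\<And>b. b \<in> B \<Longrightarrow> pullback b = fscale (\<sigma> b) b"
    and exp: "\<And>f. f \<in> coexact \<Longrightarrow> f = (\<Sum>b\<in>B. fscale (ip f b) b)"
    and h: "h \<in> coexact_forms"
  shows "\<exists>\<eta>. solves \<rho> \<eta> h"
proof -
  define \<pi> where "\<pi> = (\<lambda>b \<alpha>. fscale (ip \<alpha> b) b)"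
  have Bc: "b \<in> coexact" and Ba: "b \<in> alt_forms" if "b \<in> B" for b
    using that B coexact_alt by auto
  have \<pi>_lin: "fs.lin_op alt_forms (\<pi> b)" if "b \<in> B" for b
    using Ba[OF that]
    by (auto simp: \<pi>_def fs.lin_op_def alt_scale ip_add_left ip_scale_left fs.scale_left_distrib)
  have \<pi>_pull: "\<pi> b (pullback \<alpha>) = pullback (\<pi> b \<alpha>)" if "b \<in> B" "\<alpha> \<in> alt_forms" for b \<alpha>
    using that Ba[OF that(1)]
    by (simp add: \<pi>_def pullback_symmetric \<sigma> ip_scale_right fs.lin_op_scale[OF pullback_lin_op] mult.commute)
  obtain N where N: "(\<Sum>i=1..n. \<upsilon> i) < of_nat N * \<upsilon> 1"
    using reals_Archimedean3[OF weight_min_pos] by blast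
  have "\<exists>\<eta>. solves \<rho> \<eta> h" if "h \<in> coexact_forms" "h \<in> form_filt (k * \<upsilon> 1)" "k + m = N" for h and k m :: nat
    using that
  proof (induction m arbitrary: h k)
    case 0
    then have "h = 0" using form_filt_top[of "k * \<upsilon> 1" h] N by simp
    then have "solves \<rho> (\<lambda>z x Vs. 0) h"
      by (auto simp: solves_def holo_family.zero complexify_zero[OF box_lin])
    then show ?case by blast
  next
    case (Suc m)
    note h = coexact_forms_forms[OF Suc.prems(1)]
    define p where "p = (\<lambda>b. extend (\<pi> b) h)"
    define r where "r = (\<lambda>b. box (p b) - extend box0 (p b))"
    have pf: "p b \<in> form_filt (k * \<upsilon> 1)" if "b \<in> B" for b
      unfolding p_def by (rule extend_form_filt[OF \<pi>_lin[OF that] \<pi>_pull[OF that] Suc.prems(2)])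
    then have pforms: "p b \<in> forms" if "b \<in> B" for b using that by (simp add: form_filt_def)
    have pc: "p b \<in> coexact_forms" if "b \<in> B" for b
    proof -
      have "p b x \<in> coexact" for x
        unfolding p_def extend_apply \<pi>_def by (rule fs.subspace_scale[OF coexact_subspace Bc[OF that]])
      then show ?thesis using pforms[OF that] by (simp add: coexact_forms_def)
    qed
    have "\<exists>\<eta>. solves \<rho> \<eta> (r b)" if "b \<in> B" for b
    proof (rule Suc.IH[of _ "Suc k"])
      show "r b \<in> coexact_forms" "r b \<in> form_filt (Suc k * \<upsilon> 1)"
        using coexact_remainder[OF pc[OF that] pf[OF that]] by (simp_all add: r_def algebra_simps)
    qed (use Suc.prems in simp)
    then obtain \<eta> where \<eta>: "\<And>b. b \<in> B \<Longrightarrow> solves \<rho> (\<eta> b) (r b)" by metis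
    have fam: "holo_family \<rho> (\<eta> b)" if "b \<in> B" for b
      using \<eta>[OF that] by (simp add: solves_def)
    \<comment> \<open>The summand \<open>\<eta> b\<close> compensates the error \<open>r b\<close>,
      so \<open>z - box\<close> maps \<open>\<zeta> b z\<close> to exactly
      \<open>(z - \<mu> b)\<close> times \<open>p b\<close>.\<close>
    define \<zeta> where "\<zeta> = (\<lambda>b z x Vs. 1 * of_real_form (p b) x Vs + 1 * \<eta> b z x Vs)"
    have \<zeta>_fam: "holo_family \<rho> (\<zeta> b)" if "b \<in> B" for b
      unfolding \<zeta>_def by (rule holo_family.step[OF fam[OF that] _ pforms[OF that]]) (intro holomorphic_intros)
    \<comment> \<open>The poles are the real points \<open>\<mu> b\<close>, at distance at least
      \<rho> from the centre.\<close>
    have ne: "z - of_real (\<mu> b) \<noteq> 0" if "b \<in> B" "z \<in> ball 0 \<rho>" for b and z :: complex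
      using \<rho>[OF that(1)] that(2) by auto
    have \<zeta>_eq: "z * \<zeta> b z x Vs - complexify box (\<zeta> b z) x Vs = (z - of_real (\<mu> b)) * of_real (p b x Vs)"
      if b: "b \<in> B" and z: "z \<in> ball 0 \<rho>" for b z x Vs
    proof -
      have "extend box0 (p b) = Fscale (\<mu> b) (p b)"
        by (rule ext) (simp only: p_def extend_apply \<pi>_def Fscale_at
            fs.lin_op_scale[OF box0_lin_op Ba[OF b]] \<mu>[OF b] fs.scale_scale mult.commute)
      then have bx: "box (p b) = Fscale (\<mu> b) (p b) + r b" by (simp add: r_def)
      have "complexify box (\<zeta> b z) = (\<lambda>x Vs. 1 * of_real_form (box (p b)) x Vs + 1 * complexify box (\<eta> b z) x Vs)"
        unfolding \<zeta>_def complexify_lin_comb[OF box_lin of_real_form_forms[OF pforms[OF b]] holo_family_form[OF fam[OF b]]]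
          complexify_of_real[OF box_lin] ..
      moreover have "z * \<eta> b z x Vs - complexify box (\<eta> b z) x Vs = of_real (r b x Vs)"
        using \<eta>[OF b] z by (simp add: solves_def)
      ultimately show ?thesis
        by (simp add: \<zeta>_def of_real_form_def bx algebra_simps)
    qed
    let ?c = "\<lambda>b z. 1 / (z - of_real (\<mu> b)) :: complex"
    let ?\<eta> = "\<lambda>z x Vs. \<Sum>b\<in>B. ?c b z * \<zeta> b z x Vs"
    have "solves \<rho> ?\<eta> h"
      unfolding solves_def
    proof (intro conjI ballI allI)
      show "holo_family \<rho> ?\<eta>"
        using ne by (intro holo_family_sum holo_family_mult \<zeta>_fam) (auto intro!: holomorphic_intros)
      fix z :: complex and x Vs assume z: "z \<in> ball 0 \<rho>"
      have "complexify box (?\<eta> z) x Vs = (\<Sum>b\<in>B. ?c b z * complexify box (\<zeta> b z) x Vs)"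
        using complexify_sum[OF box_lin, of B "\<lambda>b. \<zeta> b z" "\<lambda>b. ?c b z"] holo_family_form[OF \<zeta>_fam] by simp
      then have "z * ?\<eta> z x Vs - complexify box (?\<eta> z) x Vs =
          (\<Sum>b\<in>B. ?c b z * (z * \<zeta> b z x Vs - complexify box (\<zeta> b z) x Vs))"
        by (simp add: sum_distrib_left sum_subtractf[symmetric] algebra_simps diff_divide_distrib)
      also have "\<dots> = (\<Sum>b\<in>B. of_real (p b x Vs))"
        using ne[OF _ z] by (intro sum.cong refl) (simp add: \<zeta>_eq[OF _ z])
      also have "\<dots> = of_real ((\<Sum>b\<in>B. fscale (ip (h x) b) b) Vs)"
        by (simp add: p_def extend_apply \<pi>_def sum_fun_apply)
      also have "(\<Sum>b\<in>B. fscale (ip (h x) b) b) = h x"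
        using exp[of "h x"] Suc.prems(1) by (simp add: coexact_forms_def)
      finally show "z * ?\<eta> z x Vs - complexify box (?\<eta> z) x Vs = of_real (h x Vs)" .
    qed
    then show ?case by blast
  qed
  from this[of h 0 N] h show ?thesis
    by (simp add: form_filt_0 coexact_forms_forms)
qed

subsection \<open>The operator \<open>P\<close> is Rumin's projection\<close>

lemma P_eq_Pi_E:
  assumes \<epsilon>: "0 < \<epsilon>" "\<forall>\<mu>. eigenvalue_box0 \<mu> \<and> \<mu> \<noteq> 0 \<longrightarrow> \<epsilon> < \<mu>"
    and \<omega>: "\<omega> \<in> forms"
  shows "P \<epsilon> \<omega> = Pi_E \<omega>"
proof -
  obtain B \<mu> \<sigma> where fin: "finite B" and B: "B \<subseteq> coexact"
    "\<forall>b\<in>B. box0 b = fscale (\<mu> b) b" "\<forall>b\<in>B. pullback b = fscale (\<sigma> b) b"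
    "\<forall>f\<in>coexact. f = (\<Sum>b\<in>B. fscale (ip f b) b)"
    and ev: "\<forall>b\<in>B. \<mu> b \<noteq> 0 \<and> eigenvalue_box0 (\<mu> b)"
    using coexact_eigenbasis by (elim exE conjE)
  \<comment> \<open>The entry \<open>\<epsilon> + 1\<close> keeps the minimum meaningful when B is
    empty. All eigenvalues on H exceed \<epsilon>, so the contour lies inside the open disc of
    radius \<rho>.\<close>
  define \<rho> where "\<rho> = Min (insert (\<epsilon> + 1) (\<mu> ` B))"
  have "\<epsilon> < \<rho>" using fin ev \<epsilon> by (auto simp: \<rho>_def)
  have \<rho>: "\<rho> \<le> \<mu> b" if "b \<in> B" for b using that fin by (simp add: \<rho>_def)
  have solv: "\<exists>\<eta>. solves \<rho> \<eta> h" if "h \<in> coexact_forms" for h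
    by (rule solvable[OF \<rho> fin B(1) bspec[OF B(2)] bspec[OF B(3)] bspec[OF B(4)] that])
  define e where "e = Pi_E \<omega>"
  have e: "e \<in> forms" unfolding e_def by (rule Pi_E_forms[OF \<omega>])
  obtain \<eta>1 where \<eta>1: "solves \<rho> \<eta>1 (K (ext_d \<omega>))"
    using solv[OF K_coexact[OF ext_d_forms[OF \<omega>]]] by blast
  obtain \<eta>2 where "solves \<rho> \<eta>2 (K \<omega>)"
    using solv[OF K_coexact[OF \<omega>]] by blast
  note \<eta>2 = solves_ext_d[OF this]
  define g where "g = (\<lambda>z x Vs. \<eta>1 z x Vs + complexify ext_d (\<eta>2 z) x Vs)"
  have fam: "holo_family \<rho> g"
    using \<eta>1 \<eta>2 unfolding g_def by (intro holo_family_add) (simp_all add: solves_def)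
  have f1: "\<eta>1 z \<in> complex_forms" and f2: "complexify ext_d (\<eta>2 z) \<in> complex_forms" for z
    using \<eta>1 \<eta>2 holo_family_form[of \<rho> \<eta>1] holo_family_form[of \<rho> "\<lambda>z. complexify ext_d (\<eta>2 z)"]
    by (simp_all add: solves_def)
  have box_e: "box e = 0"
    unfolding e_def by (rule box_eq_0[OF Pi_E_forms[OF \<omega>] Q_Pi_E[OF \<omega>]])
      (simp only: d_Pi_E[OF \<omega>] Q_Pi_E[OF ext_d_forms[OF \<omega>]])
  have \<omega>_eq: "\<omega> x Vs = e x Vs + (K (ext_d \<omega>) x Vs + ext_d (K \<omega>) x Vs)" for x Vs
    unfolding e_def Pi_E_eq by simp
  have res: "resolvent z (of_real_form \<omega>) = (\<lambda>x Vs. (1 / z) * of_real_form e x Vs + 1 * g z x Vs)"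
    if z: "cmod z = \<epsilon>" for z
  proof (rule resolvent_eqI)
    have z0: "z \<noteq> 0" and zb: "z \<in> ball 0 \<rho>" using z \<epsilon> \<open>\<epsilon> < \<rho>\<close> by auto
    show "(\<lambda>x Vs. (1 / z) * of_real_form e x Vs + 1 * g z x Vs) \<in> complex_forms"
      by (intro complex_forms_lin_comb of_real_form_forms e holo_family_form[OF fam])
    have "g z = (\<lambda>x Vs. 1 * \<eta>1 z x Vs + 1 * complexify ext_d (\<eta>2 z) x Vs)" by (simp add: g_def)
    then have cg: "complexify box (g z) =
        (\<lambda>x Vs. 1 * complexify box (\<eta>1 z) x Vs + 1 * complexify box (complexify ext_d (\<eta>2 z)) x Vs)"
      by (simp only: complexify_lin_comb[OF box_lin f1 f2])
    have g_eq: "z * g z x Vs - complexify box (g z) x Vs =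
        of_real (K (ext_d \<omega>) x Vs) + of_real (ext_d (K \<omega>) x Vs)" for x Vs
    proof -
      have "z * g z x Vs - complexify box (g z) x Vs = (z * \<eta>1 z x Vs - complexify box (\<eta>1 z) x Vs)
          + (z * complexify ext_d (\<eta>2 z) x Vs - complexify box (complexify ext_d (\<eta>2 z)) x Vs)"
        unfolding cg by (simp add: g_def algebra_simps)
      then show ?thesis using \<eta>1 \<eta>2 zb by (simp add: solves_def)
    qed
    show "(\<lambda>x Vs. z * ((1 / z) * of_real_form e x Vs + 1 * g z x Vs)
        - complexify box (\<lambda>x Vs. (1 / z) * of_real_form e x Vs + 1 * g z x Vs) x Vs) = of_real_form \<omega>"
    proof (intro ext)
      fix x Vs
      have "z * ((1 / z) * of_real_form e x Vs + 1 * g z x Vs)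
          - complexify box (\<lambda>x Vs. (1 / z) * of_real_form e x Vs + 1 * g z x Vs) x Vs =
          of_real_form e x Vs + (z * g z x Vs - complexify box (g z) x Vs)"
        unfolding complexify_lin_comb[OF box_lin of_real_form_forms[OF e] holo_family_form[OF fam]]
          complexify_of_real[OF box_lin] box_e
        using z0 by (simp add: of_real_form_def algebra_simps)
      also have "\<dots> = of_real_form \<omega> x Vs"
        unfolding g_eq by (simp add: of_real_form_def \<omega>_eq)
      finally show "z * ((1 / z) * of_real_form e x Vs + 1 * g z x Vs)
          - complexify box (\<lambda>x Vs. (1 / z) * of_real_form e x Vs + 1 * g z x Vs) x Vs = of_real_form \<omega> x Vs" .
    qed
    show "Im z \<noteq> 0 \<or> \<not> eigenvalue_box0 (Re z)"
    \<comment> \<open>A real point of the circle has absolute value \<epsilon> and is not 0, whereas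
      nonzero eigenvalues exceed \<epsilon>.\<close>
    proof (rule ccontr)
      assume a: "\<not> ?thesis"
      then have "cmod z = \<bar>Re z\<bar>" by (simp add: cmod_eq_Re)
      then show False using \<epsilon>(2)[rule_format, of "Re z"] z a \<epsilon>(1) by auto
    qed
  qed
  have int: "contour_integral (circlepath 0 \<epsilon>) (\<lambda>z. resolvent z (of_real_form \<omega>) x Vs) =
      2 * of_real pi * \<i> * of_real (e x Vs)" for x Vs
  proof -
    \<comment> \<open>The resolvent equals \<open>?f z / z\<close>, so Cauchy's formula at 0 treats
      the polar and the holomorphic part at once; the factor z removes g from
      \<open>?f 0\<close>.\<close>
    let ?f = "\<lambda>z. of_real (e x Vs) + z * g z x Vs"
    have "?f holomorphic_on cball 0 \<epsilon>"
      using \<open>\<epsilon> < \<rho>\<close>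
      by (intro holomorphic_intros holomorphic_on_subset[OF holo_family_holomorphic[OF fam]]) auto
    then have "((\<lambda>z. ?f z / (z - 0)) has_contour_integral (2 * of_real pi * \<i> * ?f 0)) (circlepath 0 \<epsilon>)"
      using \<epsilon>(1) by (intro Cauchy_integral_circlepath_simple) auto
    moreover have "contour_integral (circlepath 0 \<epsilon>) (\<lambda>z. resolvent z (of_real_form \<omega>) x Vs) =
        contour_integral (circlepath 0 \<epsilon>) (\<lambda>z. ?f z / (z - 0))"
    proof (rule contour_integral_eq)
      fix z assume "z \<in> path_image (circlepath 0 \<epsilon>)"
      then have "cmod z = \<epsilon>" "z \<noteq> 0" using \<epsilon>(1) by auto
      then show "resolvent z (of_real_form \<omega>) x Vs = ?f z / (z - 0)"
        unfolding res[OF \<open>cmod z = \<epsilon>\<close>] by (simp add: of_real_form_def field_simps)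
    qed
    ultimately show ?thesis by (simp add: contour_integral_unique)
  qed
  have "P_complex \<epsilon> (of_real_form \<omega>) = of_real_form e"
    unfolding P_complex_def int by (simp add: of_real_form_def)
  moreover have "inj_on of_real_form forms"
    by (rule inj_onI) (metis re_form_of_real)
  ultimately show ?thesis
    unfolding P_def using inv_into_f_f[of of_real_form forms e] e e_def by simp
qed

section \<open>Injectivity of \<open>L\<close> and comparison of the two operators\<close>

context
  fixes \<epsilon> :: real
  assumes \<epsilon>: "0 < \<epsilon>" "\<forall>\<mu>. eigenvalue_box0 \<mu> \<and> \<mu> \<noteq> 0 \<longrightarrow> \<epsilon> < \<mu>"
begin

lemma L_eq: "\<omega> \<in> forms \<Longrightarrow> L \<epsilon> \<omega> = Pi_E (P0 \<omega>) + ((\<omega> - P0 \<omega>) - Pi_E (\<omega> - P0 \<omega>))"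
  by (simp only: L_def P_eq_Pi_E[OF \<epsilon>] P0_forms forms_diff)

lemma L_P0:
  assumes "\<omega> \<in> forms" "P0 \<omega> = \<omega>"
  shows "L \<epsilon> \<omega> = Pi_E \<omega>"
  using Fs.lin_op_zero[OF Pi_E_lin forms_subspace] by (simp add: L_eq[OF assms(1)] assms(2))

text \<open>Applying the idempotent \<open>Pi_E\<close> isolates
  \<open>Pi_E (P0 \<omega>) = 0\<close>, and \<open>P0 Pi_E P0 = P0\<close> then gives
  \<open>P0 \<omega> = 0\<close>. What remains says that \<omega> is its own image under
  \<open>Pi_E\<close>, and \<open>Pi_E P0 Pi_E = Pi_E\<close> forces it to vanish.\<close>

lemma L_kernel:
  assumes "\<omega> \<in> forms" "L \<epsilon> \<omega> = 0"
  shows "\<omega> = 0"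
proof -
  note p = P0_forms[OF assms(1)]
  define r where "r = \<omega> - P0 \<omega>"
  have r: "r \<in> forms" unfolding r_def by (intro forms_diff p assms)
  have L: "Pi_E (P0 \<omega>) + (r - Pi_E r) = 0"
    using assms(2) L_eq[OF assms(1)] by (simp only: r_def)
  have "Pi_E (Pi_E (P0 \<omega>) + (r - Pi_E r)) = Pi_E (P0 \<omega>) + (Pi_E r - Pi_E r)"
    by (simp only: Fs.lin_op_add[OF Pi_E_lin] Fs.lin_op_diff[OF Pi_E_lin forms_subspace] Pi_E_forms forms_diff
        r p Pi_E_Pi_E)
  then have 1: "Pi_E (P0 \<omega>) = 0"
    unfolding L Fs.lin_op_zero[OF Pi_E_lin forms_subspace] by simp
  then have 2: "P0 \<omega> = 0"
    using P0_Pi_E_P0[OF assms(1)] Fs.lin_op_zero[OF P0_lin forms_subspace] by simp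
  then have 3: "\<omega> = Pi_E \<omega>" using L 1 by (simp add: r_def)
  have "Pi_E (P0 (Pi_E \<omega>)) = 0" unfolding 3[symmetric] by (rule 1)
  then show ?thesis using Pi_E_P0_Pi_E[OF assms(1)] 3 by simp
qed

lemma L_inj: "inj_on (L \<epsilon>) forms"
proof (rule inj_onI)
  fix \<omega> \<eta> assume f: "\<omega> \<in> forms" "\<eta> \<in> forms" and eq: "L \<epsilon> \<omega> = L \<epsilon> \<eta>"
  have lin: "Fs.lin_op forms (\<lambda>\<omega>. Pi_E (P0 \<omega>) + ((\<omega> - P0 \<omega>) - Pi_E (\<omega> - P0 \<omega>)))"
    by (rule Fs.lin_op_plus[OF Fs.lin_op_comp[OF Pi_E_lin P0_lin] Fs.lin_op_minus[OF
          Fs.lin_op_minus[OF Fs.lin_op_id P0_lin forms_subspace] Fs.lin_op_comp[OF Pi_E_lin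
          Fs.lin_op_minus[OF Fs.lin_op_id P0_lin forms_subspace]] forms_subspace] forms_subspace])
  have "L \<epsilon> (\<omega> - \<eta>) = L \<epsilon> \<omega> - L \<epsilon> \<eta>"
    unfolding L_eq[OF f(1)] L_eq[OF f(2)] L_eq[OF forms_diff[OF f]]
    by (rule Fs.lin_op_diff[OF lin forms_subspace f])
  then show "\<omega> = \<eta>" using L_kernel[OF forms_diff[OF f]] eq by simp
qed

lemma d_c_eq_D:
  assumes \<omega>: "\<omega> \<in> forms"
  shows "d_c \<omega> = D \<epsilon> \<omega>"
proof -
  note p = P0_forms[OF \<omega>]
  define g where "g = ext_d (Pi_E (P0 \<omega>))"
  have g: "g \<in> forms" unfolding g_def by (intro ext_d_forms Pi_E_forms p)
  have dc: "d_c \<omega> = P0 g" by (simp only: d_c_def g_def)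
  have "L \<epsilon> (d_c \<omega>) = Pi_E (P0 g)"
    unfolding dc by (rule L_P0[OF P0_forms[OF g] P0_P0[OF g]])
  also have "\<dots> = g"
    unfolding g_def d_Pi_E[OF p] by (rule Pi_E_P0_Pi_E[OF ext_d_forms[OF p]])
  also have "g = ext_d (L \<epsilon> (P0 \<omega>))"
    unfolding g_def L_P0[OF p P0_P0[OF \<omega>]] ..
  finally have "L \<epsilon> (d_c \<omega>) = ext_d (L \<epsilon> (P0 \<omega>))" .
  \<comment> \<open>\<open>d_c \<omega>\<close> is a form with the prescribed value under the
    injective \<open>L\<close>, so it is what \<open>inv_into\<close> returns.\<close>
  then show ?thesis
    unfolding D_def by (intro inv_into_f_eq[OF L_inj, symmetric]) (simp_all only: dc P0_forms g)
qed

end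

end

theorem theorem4p9:
  fixes \<A> :: "('g::{topological_group_add, t2_space, second_countable_topology},
                  'e::euclidean_space) chart set"
    and A :: "'g vfield \<Rightarrow> 'g vfield"
    and n :: nat
    and X :: "nat \<Rightarrow> 'g vfield"
    and \<upsilon> :: "nat \<Rightarrow> real"
    and \<epsilon> :: real
  assumes "homogeneous_group \<A> A n X \<upsilon>"
    and "0 < \<epsilon>"
    and "\<forall>\<mu>. homogeneous_group.eigenvalue_box0 \<A> n X \<mu> \<and> \<mu> \<noteq> 0 \<longrightarrow> \<epsilon> < \<mu>"
  shows "\<forall>\<omega>\<in>homogeneous_group.forms \<A>.
           homogeneous_group.d_c \<A> n X \<omega> = homogeneous_group.D \<A> n X \<epsilon> \<omega>"
proof -
  interpret homogeneous_group \<A> A n X \<upsilon> by (rule assms(1))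
  show ?thesis using d_c_eq_D[of \<epsilon>] assms(2,3) by blast
qed

end
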